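(* Consider the stochastic minimax problem $\min_{x\in\mathbb{R}^{d_1}}\max_{y\in\mathbb{R}^{d_2}} f(x,y)$, $f(x,y)=\mathbb{E}[F(x,y;\xi)]$, under Assumptions (A1)–(A5) described in the context, and let $\kappa=\ell/\mu$ and $\varepsilon>0$. Run the algorithm SREDA described in the context with the parameters $$\zeta=\kappa^{-2}\varepsilon^2,\quad \eta_k=\min\Big(\frac{\varepsilon}{5\kappa\ell\|v_k\|},\frac{1}{10\kappa\ell}\Big),\quad \lambda=\frac{2}{7\ell},\quad q=\lceil \varepsilon^{-1}\rceil,\quad S_1=\lceil 24\sigma^2\kappa^2\varepsilon^{-2}\rceil,$$ $$S_2=\Big\lceil \frac{7368}{175}\kappa q\Big\rceil,\quad K=\Big\lceil \frac{100\kappa\ell\varepsilon^{-2}\Delta_f}{9}\Big\rceil,\quad m=\lceil 28\kappa-1\rceil,$$ where $\Delta_f=f(x_0,y_0)+\frac{\kappa^{-2}\varepsilon^2}{2\mu}-\Phi^*$. Then the output $\hat x$ satisfies $$\mathbb{E}\|\nabla\Phi(\hat x)\|\le \frac{1073}{108}\varepsilon,$$ and the algorithm uses $\mathcal{O}(\kappa^3\varepsilon^{-3})$ stochastic gradient evaluations in total.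
   Context: Problem setting. Let $\xi$ be a random vector and $F(x,y;\xi)$ be differentiable in $(x,y)\in\mathbb{R}^{d_1}\times\mathbb{R}^{d_2}$, with $f(x,y)=\mathbb{E}[F(x,y;\xi)]$, $\Phi(x)=\max_{y}f(x,y)$. Assumptions: (A1) $\Phi$ is bounded below, $\Phi^*=\inf_x\Phi(x)>-\infty$. (A2) There is $\ell>0$ with $\mathbb{E}\|\nabla F(x,y;\xi)-\nabla F(x',y';\xi)\|^2\le \ell^2(\|x-x'\|^2+\|y-y'\|^2)$ for all $(x,y),(x',y')$. (A3) For every realization of $\xi$ and every $x$, $F(x,\cdot;\xi)$ is concave. (A4) There is $\mu>0$ such that $f(x,\cdot)$ is $\mu$-strongly concave for every $x$. (A5) There is $\sigma>0$ with $\mathbb{E}\|\nabla F(x,y;\xi)-\nabla f(x,y)\|^2\le\sigma^2$ for all $(x,y)$. Write $G_x(x,y;\xi)=\nabla_xF(x,y;\xi)$, $G_y(x,y;\xi)=\nabla_yF(x,y;\xi)$. "Draw $S$ samples" means drawing $S$ i.i.d. copies of $\xi$ independent of everything else; a stochastic gradient evaluation is one evaluation of $\nabla F(\cdot,\cdot;\xi)$ at one point for one sample. Algorithm SREDA (inputs $x_0$, $\zeta$, step sizes $\eta_k,\lambda>0$, batch sizes $S_1,S_2$, integers $q,m,K>0$). Initialization: $y_0$ is obtained by running inexact SARAH on the strongly convex function $w\mapsto -f(x_0,w)$ (epochs of: a minibatch gradient estimate $v_0$ at the current point $w_0$, step $w_1=w_0-\gamma v_0$, then recursive updates $v_t=\nabla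 H(w_t;\xi_t)-\nabla H(w_{t-1};\xi_t)+v_{t-1}$, $w_{t+1}=w_t-\gamma v_t$ for $t=1,\dots,m'-1$ with single samples, and the epoch output $w_{t'}$ with $t'$ uniform in $\{0,\dots,m'\}$; here $H(w;\xi)=-F(x_0,w;\xi)$, $\gamma=2/(5\ell)$, $m'=\lceil 20\kappa-1\rceil$, and minibatch size and number of epochs chosen so that) $\mathbb{E}\|\nabla_y f(x_0,y_0)\|^2\le\zeta$, at a cost of $\mathcal{O}(\kappa^2\varepsilon^{-2}\log(\kappa/\varepsilon))$ stochastic gradient evaluations. Then for $k=0,\dots,K-1$: if $k\equiv 0 \pmod q$, draw $S_1$ samples $\xi_1,\dots,\xi_{S_1}$ and set $v_k=\frac1{S_1}\sum_i G_x(x_k,y_k;\xi_i)$, $u_k=\frac1{S_1}\sum_iG_y(x_k,y_k;\xi_i)$; otherwise set $v_k=\tilde v_{k-1,s_{k-1}+1}$, $u_k=\tilde u_{k-1,s_{k-1}+1}$. Set $x_{k+1}=x_k-\eta_kv_k$. Then run the ConcaveMaximizer: set $\tilde x_{k,-1}=x_k$, $\tilde y_{k,-1}=y_k$, $\tilde v_{k,-1}=v_k$, $\tilde u_{k,-1}=u_k$, $\tilde x_{k,0}=x_{k+1}$, $\tilde y_{k,0}=y_k$; for $t=0,1,\dots,m+1$: draw $S_2$ fresh samples $\xi_{t,1},\dots,\xi_{t,S_2}$ and set $\tilde v_{k,t}=\tilde v_{k,t-1}+\frac1{S_2}\sum_i\big[G_x(\tilde x_{k,t},\tilde y_{k,t};\xi_{t,i})-G_x(\tilde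 x_{k,t-1},\tilde y_{k,t-1};\xi_{t,i})\big]$, $\tilde u_{k,t}=\tilde u_{k,t-1}+\frac1{S_2}\sum_i\big[G_y(\tilde x_{k,t},\tilde y_{k,t};\xi_{t,i})-G_y(\tilde x_{k,t-1},\tilde y_{k,t-1};\xi_{t,i})\big]$, $\tilde x_{k,t+1}=\tilde x_{k,t}$, $\tilde y_{k,t+1}=\tilde y_{k,t}+\lambda\tilde u_{k,t}$. Draw $s_k$ uniformly from $\{0,1,\dots,m\}$ and set $y_{k+1}=\tilde y_{k,s_k+1}$. Output: $\hat x$ chosen uniformly at random from $\{x_0,\dots,x_{K-1}\}$. *)

theory Defs
  imports "HOL-Analysis.Analysis" "HOL-Probability.Probability"
begin

definition grad :: "(real^'n \<Rightarrow> real) \<Rightarrow> real^'n \<Rightarrow> real^'n" where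
  "grad g x = (\<chi> i. frechet_derivative g (at x) (axis i 1))"

definition gradx :: "(real^'n \<Rightarrow> real^'d \<Rightarrow> real) \<Rightarrow> real^'n \<Rightarrow> real^'d \<Rightarrow> real^'n" where
  "gradx g x y = (\<chi> i. frechet_derivative (\<lambda>p. g (fst p) (snd p)) (at (x, y)) (axis i 1, 0))"

definition grady :: "(real^'n \<Rightarrow> real^'d \<Rightarrow> real) \<Rightarrow> real^'n \<Rightarrow> real^'d \<Rightarrow> real^'d" where
  "grady g x y = (\<chi> i. frechet_derivative (\<lambda>p. g (fst p) (snd p)) (at (x, y)) (0, axis i 1))"

definition strongly_concave_on :: "real \<Rightarrow> 'a::real_normed_vector set \<Rightarrow> ('a \<Rightarrow> real) \<Rightarrow> bool" where
  "strongly_concave_on \<mu> S g \<longleftrightarrow> convex S \<and>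
     (\<forall>x\<in>S. \<forall>y\<in>S. \<forall>t\<in>{0..1::real}.
        g ((1 - t) *\<^sub>R x + t *\<^sub>R y) \<ge> (1 - t) * g x + t * g y + \<mu> / 2 * t * (1 - t) * (norm (x - y))\<^sup>2)"

definition fexp :: "(real^'n \<Rightarrow> real^'d \<Rightarrow> 'c \<Rightarrow> real) \<Rightarrow> 'c measure \<Rightarrow> real^'n \<Rightarrow> real^'d \<Rightarrow> real" where
  "fexp F D x y = (\<integral>\<xi>. F x y \<xi> \<partial>D)"

definition Phi :: "(real^'n \<Rightarrow> real^'d \<Rightarrow> 'c \<Rightarrow> real) \<Rightarrow> 'c measure \<Rightarrow> real^'n \<Rightarrow> real" where
  "Phi F D x = (SUP y. fexp F D x y)"

definition Phi_star :: "(real^'n \<Rightarrow> real^'d \<Rightarrow> 'c \<Rightarrow> real) \<Rightarrow> 'c measure \<Rightarrow> real" where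
  "Phi_star F D = (INF x. Phi F D x)"

definition Gx :: "(real^'n \<Rightarrow> real^'d \<Rightarrow> 'c \<Rightarrow> real) \<Rightarrow> real^'n \<Rightarrow> real^'d \<Rightarrow> 'c \<Rightarrow> real^'n" where
  "Gx F x y \<xi> = gradx (\<lambda>x y. F x y \<xi>) x y"

definition Gy :: "(real^'n \<Rightarrow> real^'d \<Rightarrow> 'c \<Rightarrow> real) \<Rightarrow> real^'n \<Rightarrow> real^'d \<Rightarrow> 'c \<Rightarrow> real^'d" where
  "Gy F x y \<xi> = grady (\<lambda>x y. F x y \<xi>) x y"

text \<open>Standing assumptions (A1)--(A5), together with the implicit regularity needed for
  f = E F to make sense (measurability/integrability of F in xi, differentiability of F and f).\<close>
definition minimax_assms ::
  "(real^'n \<Rightarrow> real^'d \<Rightarrow> 'c \<Rightarrow> real) \<Rightarrow> 'c measure \<Rightarrow> real \<Rightarrow> real \<Rightarrow> real \<Rightarrow> bool" where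
  "minimax_assms F D L \<mu> \<sigma> \<longleftrightarrow>
     prob_space D \<and> L > 0 \<and> \<mu> > 0 \<and> \<sigma> > 0 \<and>
     (\<forall>x y. integrable D (F x y)) \<and>
     (\<forall>\<xi> x y. (\<lambda>p. F (fst p) (snd p) \<xi>) differentiable (at (x, y))) \<and>
     (\<forall>x y. (\<lambda>p. fexp F D (fst p) (snd p)) differentiable (at (x, y))) \<and>
     \<comment> \<open>(A1)\<close>
     bdd_below (range (Phi F D)) \<and>
     \<comment> \<open>(A2) mean-squared Lipschitz gradient\<close>
     (\<forall>x y x' y'. (\<integral>\<^sup>+\<xi>. ennreal ((norm (Gx F x y \<xi> - Gx F x' y' \<xi>))\<^sup>2
                                   + (norm (Gy F x y \<xi> - Gy F x' y' \<xi>))\<^sup>2) \<partial>D)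
          \<le> ennreal (L\<^sup>2 * ((norm (x - x'))\<^sup>2 + (norm (y - y'))\<^sup>2))) \<and>
     \<comment> \<open>(A3) each F(x,.;xi) concave\<close>
     (\<forall>\<xi> x. concave_on UNIV (\<lambda>y. F x y \<xi>)) \<and>
     \<comment> \<open>(A4) f(x,.) mu-strongly concave\<close>
     (\<forall>x. strongly_concave_on \<mu> UNIV (\<lambda>y. fexp F D x y)) \<and>
     \<comment> \<open>(A5) bounded variance\<close>
     (\<forall>x y. (\<integral>\<^sup>+\<xi>. ennreal ((norm (Gx F x y \<xi> - gradx (fexp F D) x y))\<^sup>2
                             + (norm (Gy F x y \<xi> - grady (fexp F D) x y))\<^sup>2) \<partial>D)
          \<le> ennreal (\<sigma>\<^sup>2))"

definition avg :: "nat \<Rightarrow> (nat \<Rightarrow> 'a::real_vector) \<Rightarrow> 'a" where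
  "avg S g = (1 / real S) *\<^sub>R (\<Sum>i<S. g i)"

text \<open>ConcaveMaximizer in outer iteration k: given x_k (xold), x_{k+1} (xnew), y_k, v_k, u_k and
  the samples xi t i (= xi_{t,i}), cm_state ... t = (ytilde_{k,t}, vtilde_{k,t}, utilde_{k,t});
  note xtilde_{k,t} = x_{k+1} for t \<ge> 0.\<close>
fun cm_state :: "(real^'n \<Rightarrow> real^'d \<Rightarrow> 'c \<Rightarrow> real) \<Rightarrow> nat \<Rightarrow> real \<Rightarrow> (nat \<Rightarrow> nat \<Rightarrow> 'c)
    \<Rightarrow> real^'n \<Rightarrow> real^'n \<Rightarrow> real^'d \<Rightarrow> real^'n \<Rightarrow> real^'d \<Rightarrow> nat \<Rightarrow> (real^'d) \<times> (real^'n) \<times> (real^'d)" where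
  "cm_state F S2 lam \<xi> xold xnew y v u 0 =
     (y, v + avg S2 (\<lambda>i. Gx F xnew y (\<xi> 0 i) - Gx F xold y (\<xi> 0 i)),
         u + avg S2 (\<lambda>i. Gy F xnew y (\<xi> 0 i) - Gy F xold y (\<xi> 0 i)))"
| "cm_state F S2 lam \<xi> xold xnew y v u (Suc t) =
     (let (yt, vt, ut) = cm_state F S2 lam \<xi> xold xnew y v u t;
          yn = yt + lam *\<^sub>R ut
      in (yn, vt + avg S2 (\<lambda>i. Gx F xnew yn (\<xi> (Suc t) i) - Gx F xnew yt (\<xi> (Suc t) i)),
              ut + avg S2 (\<lambda>i. Gy F xnew yn (\<xi> (Suc t) i) - Gy F xnew yt (\<xi> (Suc t) i))))"

text \<open>Outer iterates: sreda_state ... k = (x_k, y_k, v_k, u_k).  Samples: xic k i are the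
  S1 checkpoint samples drawn at iteration k (used when k mod q = 0), xim k t i are the samples
  xi_{t,i} of ConcaveMaximizer in iteration k, s k is the index s_k.
  Step size eta_k = min(eps/(kappa*5*ell*|v_k|), 1/(10*kappa*ell)).\<close>
fun sreda_state :: "(real^'n \<Rightarrow> real^'d \<Rightarrow> 'c \<Rightarrow> real) \<Rightarrow> real \<Rightarrow> real \<Rightarrow> real \<Rightarrow> real
    \<Rightarrow> nat \<Rightarrow> nat \<Rightarrow> nat \<Rightarrow> real^'n \<Rightarrow> real^'d
    \<Rightarrow> (nat \<Rightarrow> nat \<Rightarrow> 'c) \<Rightarrow> (nat \<Rightarrow> nat \<Rightarrow> nat \<Rightarrow> 'c) \<Rightarrow> (nat \<Rightarrow> nat)
    \<Rightarrow> nat \<Rightarrow> (real^'n) \<times> (real^'d) \<times> (real^'n) \<times> (real^'d)" where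
  "sreda_state F \<epsilon> \<kappa> L lam S1 S2 q x0 y0 xic xim s 0 =
     (x0, y0, avg S1 (\<lambda>i. Gx F x0 y0 (xic 0 i)), avg S1 (\<lambda>i. Gy F x0 y0 (xic 0 i)))"
| "sreda_state F \<epsilon> \<kappa> L lam S1 S2 q x0 y0 xic xim s (Suc k) =
     (let (x, y, v, u) = sreda_state F \<epsilon> \<kappa> L lam S1 S2 q x0 y0 xic xim s k;
          \<eta> = min (\<epsilon> / (5 * \<kappa> * L * norm v)) (1 / (10 * \<kappa> * L));
          x' = x - \<eta> *\<^sub>R v;
          (y', v', u') = cm_state F S2 lam (xim k) x x' y v u (s k + 1)
      in if Suc k mod q = 0
         then (x', y', avg S1 (\<lambda>i. Gx F x' y' (xic (Suc k) i)), avg S1 (\<lambda>i. Gy F x' y' (xic (Suc k) i)))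
         else (x', y', v', u'))"

text \<open>Number of stochastic gradient evaluations of the main loop (k = 0..K-1): S1 per
  checkpoint iteration (k mod q = 0), and 2*S2 (two points per sample) in each of the m+2
  inner steps t = 0..m+1 of ConcaveMaximizer.\<close>
definition sreda_main_cost :: "nat \<Rightarrow> nat \<Rightarrow> nat \<Rightarrow> nat \<Rightarrow> nat \<Rightarrow> nat" where
  "sreda_main_cost S1 S2 q m K = card {k. k < K \<and> k mod q = 0} * S1 + K * (m + 2) * (2 * S2)"

end

theory Submission
  imports Defs
begin

text \<open>
  The mean-square smoothness of \<open>F\<close> transfers to \<open>f\<close> once \<open>E \<nabla>F = \<nabla>f\<close> is known, so the whole analysis of
  the gradient estimator is a martingale variance computation: an inner step moving the point by \<open>d\<close>
  adds at most \<open>L\<^sup>2 |d|\<^sup>2 / S2\<close> to the mean-square estimation error. For the inner loop the usual SARAH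
  contraction, which rests on co-coercivity of every single \<open>F(x, \<cdot>; \<xi>)\<close>, is not available from
  mean-square smoothness. Instead, the ascent inequality for the \<open>L\<close>-smooth function \<open>f(x, \<cdot>)\<close> is summed
  over the inner loop; since \<open>S2\<close> exceeds the loop length, the accumulated variance is absorbed by the
  \<open>|u|\<^sup>2\<close> terms. The gap at the start of the loop is at most \<open>|\<nabla>\<^sub>y f|\<^sup>2 / (2\<mu>)\<close>, and dividing by the loop
  length \<open>m + 1 \<ge> 28\<kappa>\<close> shows that \<open>E |\<nabla>\<^sub>y f(x\<^sub>k, y\<^sub>k)|\<^sup>2 \<le> (\<epsilon>/\<kappa>)\<^sup>2\<close> and a mean-square estimation error of
  at most \<open>(\<epsilon>/\<kappa>)\<^sup>2 / 10\<close> persist through all outer iterations. Then \<open>v\<^sub>k\<close> is within \<open>O(\<epsilon>)\<close> of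
  \<open>\<nabla>\<Phi>(x\<^sub>k)\<close> in mean square, and the normalised descent on the \<open>2\<kappa>L\<close>-smooth function \<open>\<Phi>\<close> gives the bound.
\<close>

text \<open>Unbiasedness, \<open>E \<nabla>F = \<nabla>f\<close>, is not among the assumptions,
  which only make \<open>f\<close> the mean of \<open>F\<close>; it has to be derived. Along the run
  every expectation is an integral in \<open>ennreal\<close>, so no integrability of iterates is
  ever shown. This dictates the form of the estimates: whatever has a sign, such as the telescoping
  of \<Phi>, is treated for each sample point, norms are bounded by squares through pointwise AM-GM
  instead of Jensen, and only nonnegative remainders are integrated. The inner loop controls a sum
  of squared gradients, not its last term; the uniform draw of \<open>s_k\<close> turns the sum into
  a bound at \<open>y_{k+1}\<close>. Gradient size and estimation error feed each other, hence one
  joint induction. Its budget, in units of \<open>(\<epsilon>/\<kappa>)^2\<close>: a checkpoint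
  leaves an error of 1/24 and each further outer iteration adds at most 1/(20q), so 1/10 is never
  exceeded; with that error the loop brings the squared gradient down from 1 to
  \<open>21\<kappa>/(2(m + 1)) \<le> 3/8\<close>, and the induction closes with room.\<close>

section \<open>Independence as invariance under resampling\<close>

text \<open>\<open>upd w z\<close> overwrites one coordinate of the sample point \<open>w\<close> by \<open>z\<close>, and \<open>resample \<Omega> D upd\<close> says
  that drawing this coordinate afresh from \<open>D\<close> does not change the law \<open>\<Omega>\<close>. Independence enters the
  proof only in this form, with integrands some of whose parts are invariant under \<open>upd\<close>.\<close>

definition resample :: "'w measure \<Rightarrow> 'z measure \<Rightarrow> ('w \<Rightarrow> 'z \<Rightarrow> 'w) \<Rightarrow> bool" where
  "resample \<Omega> D upd \<longleftrightarrow> (\<lambda>(w, z). upd w z) \<in> \<Omega> \<Otimes>\<^sub>M D \<rightarrow>\<^sub>M \<Omega> \<and>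
     (\<forall>h \<in> borel_measurable \<Omega>. (\<integral>\<^sup>+w. (\<integral>\<^sup>+z. h (upd w z) \<partial>D) \<partial>\<Omega>) = (\<integral>\<^sup>+w. h w \<partial>\<Omega>))"

lemma resample_measurable:
  "resample \<Omega> D upd \<Longrightarrow> (\<lambda>(w, z). upd w z) \<in> \<Omega> \<Otimes>\<^sub>M D \<rightarrow>\<^sub>M \<Omega>"
  by (simp add: resample_def)

lemma resample_nn_integral:
  "resample \<Omega> D upd \<Longrightarrow> h \<in> borel_measurable \<Omega> \<Longrightarrow>
    (\<integral>\<^sup>+w. (\<integral>\<^sup>+z. h (upd w z) \<partial>D) \<partial>\<Omega>) = (\<integral>\<^sup>+w. h w \<partial>\<Omega>)"
  by (simp add: resample_def)

lemma resample_self: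
  assumes "prob_space D"
  shows "resample D D (\<lambda>_ z. z)"
proof -
  interpret prob_space D by fact
  show ?thesis
    by (auto simp: resample_def emeasure_space_1)
qed

text \<open>The product law is the image of \<open>D\<close> times the product over the other
  coordinates. After coordinate \<open>i\<close> is overwritten, the integrand no longer sees the
  old value, which integrates to 1, and Tonelli swaps the two remaining integrals.\<close>

lemma resample_PiM:
  fixes D :: "'z measure" and i :: 'i
  assumes D: "prob_space D"
  shows "resample (PiM UNIV (\<lambda>_::'i. D)) D (\<lambda>w z. w(i := z))"
proof -
  interpret D: prob_space D by fact
  let ?M = "PiM UNIV (\<lambda>_::'i. D)" and ?N = "PiM (UNIV - {i}) (\<lambda>_::'i. D)"
  interpret N: prob_space ?N by (rule prob_space_PiM) (rule D)
  interpret DN: pair_sigma_finite D ?N ..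
  have ins: "insert i (UNIV - {i}) = UNIV" by auto
  have eq: "distr (D \<Otimes>\<^sub>M ?N) ?M (\<lambda>(x, X). X(i := x)) = ?M"
    using distr_pair_PiM_eq_PiM[of "UNIV - {i}" "\<lambda>_. D" i] D by (simp add: ins)
  have m: "(\<lambda>(x, X). X(i := x)) \<in> D \<Otimes>\<^sub>M ?N \<rightarrow>\<^sub>M ?M"
    unfolding split_beta'
    by (rule measurable_fun_upd[where J="UNIV - {i}"]) (auto simp: ins)
  have m': "(\<lambda>(w, z). w(i := z)) \<in> ?M \<Otimes>\<^sub>M D \<rightarrow>\<^sub>M ?M"
    unfolding split_beta'
    by (rule measurable_fun_upd[where J="UNIV"]) auto
  have int: "(\<integral>\<^sup>+w. h w \<partial>?M) = (\<integral>\<^sup>+x. \<integral>\<^sup>+X. h (X(i := x)) \<partial>?N \<partial>D)"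
    if [measurable]: "h \<in> borel_measurable ?M" for h
  proof -
    have "(\<integral>\<^sup>+w. h w \<partial>?M) = (\<integral>\<^sup>+w. h w \<partial>distr (D \<Otimes>\<^sub>M ?N) ?M (\<lambda>(x, X). X(i := x)))"
      by (simp add: eq)
    also have "\<dots> = (\<integral>\<^sup>+p. h ((\<lambda>(x, X). X(i := x)) p) \<partial>(D \<Otimes>\<^sub>M ?N))"
      by (rule nn_integral_distr[OF m]) simp
    also have "\<dots> = (\<integral>\<^sup>+x. \<integral>\<^sup>+X. h (X(i := x)) \<partial>?N \<partial>D)"
      using N.nn_integral_fst[of "\<lambda>p. h ((\<lambda>(x, X). X(i := x)) p)" D] measurable_compose[OF m, of h borel]
      by simp
    finally show ?thesis .
  qed
  show ?thesis
    unfolding resample_def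
  proof (intro conjI ballI)
    fix h :: "('i \<Rightarrow> 'z) \<Rightarrow> ennreal" assume h[measurable]: "h \<in> borel_measurable ?M"
    have hm': "(\<lambda>(w, z). h (w(i := z))) \<in> borel_measurable (?M \<Otimes>\<^sub>M D)"
      using measurable_compose[OF m' h] by (simp add: split_beta')
    have hm: "(\<lambda>(x, X). h (X(i := x))) \<in> borel_measurable (D \<Otimes>\<^sub>M ?N)"
      using measurable_compose[OF m h] by (simp add: split_beta')
    have "(\<integral>\<^sup>+w. (\<integral>\<^sup>+z. h (w(i := z)) \<partial>D) \<partial>?M) = (\<integral>\<^sup>+x. \<integral>\<^sup>+X. (\<integral>\<^sup>+z. h (X(i := z)) \<partial>D) \<partial>?N \<partial>D)"
      by (subst int) (use D.borel_measurable_nn_integral[OF hm'] in simp_all)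
    also have "\<dots> = (\<integral>\<^sup>+X. (\<integral>\<^sup>+z. h (X(i := z)) \<partial>D) \<partial>?N)"
      by (simp add: D.emeasure_space_1)
    also have "\<dots> = (\<integral>\<^sup>+z. (\<integral>\<^sup>+X. h (X(i := z)) \<partial>?N) \<partial>D)"
      by (rule DN.Fubini'[OF hm])
    also have "\<dots> = (\<integral>\<^sup>+w. h w \<partial>?M)" by (simp add: int)
    finally show "(\<integral>\<^sup>+w. (\<integral>\<^sup>+z. h (w(i := z)) \<partial>D) \<partial>?M) = (\<integral>\<^sup>+w. h w \<partial>?M)" .
  qed (rule m')
qed

text \<open>Tonelli: the untouched factor is a parameter. Nesting this with
  \<open>resample_fst\<close> reaches every component of the iterated product that carries the
  run.\<close>

lemma resample_snd:
  assumes N: "sigma_finite_measure N" and M: "sigma_finite_measure M" and D: "sigma_finite_measure D"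
    and r: "resample M D u"
  shows "resample (N \<Otimes>\<^sub>M M) D (\<lambda>p z. (fst p, u (snd p) z))"
proof -
  interpret N: sigma_finite_measure N by fact
  interpret M: sigma_finite_measure M by fact
  interpret D: sigma_finite_measure D by fact
  note um[measurable] = resample_measurable[OF r]
  have m: "(\<lambda>(w, z). (fst w, u (snd w) z)) \<in> (N \<Otimes>\<^sub>M M) \<Otimes>\<^sub>M D \<rightarrow>\<^sub>M N \<Otimes>\<^sub>M M"
    using measurable_compose[of "\<lambda>p. (snd (fst p), snd p)" "(N \<Otimes>\<^sub>M M) \<Otimes>\<^sub>M D" _ _, OF _ um]
    by (auto simp: split_beta' intro!: measurable_Pair)
  show ?thesis
    unfolding resample_def
  proof (intro conjI ballI)
    fix h :: "'a \<times> 'b \<Rightarrow> ennreal" assume h[measurable]: "h \<in> borel_measurable (N \<Otimes>\<^sub>M M)"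
    have hm: "(\<lambda>(w, z). h (fst w, u (snd w) z)) \<in> borel_measurable ((N \<Otimes>\<^sub>M M) \<Otimes>\<^sub>M D)"
      using measurable_compose[OF m h] by (simp add: split_beta')
    have "(\<integral>\<^sup>+w. \<integral>\<^sup>+z. h (fst w, u (snd w) z) \<partial>D \<partial>(N \<Otimes>\<^sub>M M)) = (\<integral>\<^sup>+a. \<integral>\<^sup>+b. \<integral>\<^sup>+z. h (a, u b z) \<partial>D \<partial>M \<partial>N)"
      by (subst M.nn_integral_fst[symmetric]) (use D.borel_measurable_nn_integral[OF hm] in simp_all)
    also have "\<dots> = (\<integral>\<^sup>+a. \<integral>\<^sup>+b. h (a, b) \<partial>M \<partial>N)"
      by (intro nn_integral_cong resample_nn_integral[OF r]) simp
    also have "\<dots> = (\<integral>\<^sup>+w. h w \<partial>(N \<Otimes>\<^sub>M M))"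
      by (subst M.nn_integral_fst) auto
    finally show "(\<integral>\<^sup>+w. \<integral>\<^sup>+z. h (fst w, u (snd w) z) \<partial>D \<partial>(N \<Otimes>\<^sub>M M)) = (\<integral>\<^sup>+w. h w \<partial>(N \<Otimes>\<^sub>M M))" .
  qed (use m in simp)
qed

lemma resample_fst:
  assumes N: "sigma_finite_measure N" and M: "sigma_finite_measure M" and D: "sigma_finite_measure D"
    and r: "resample M D u"
  shows "resample (M \<Otimes>\<^sub>M N) D (\<lambda>p z. (u (fst p) z, snd p))"
proof -
  interpret N: sigma_finite_measure N by fact
  interpret M: sigma_finite_measure M by fact
  interpret D: sigma_finite_measure D by fact
  interpret P: pair_sigma_finite M N ..
  note um[measurable] = resample_measurable[OF r]
  have m: "(\<lambda>(w, z). (u (fst w) z, snd w)) \<in> (M \<Otimes>\<^sub>M N) \<Otimes>\<^sub>M D \<rightarrow>\<^sub>M M \<Otimes>\<^sub>M N"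
    using measurable_compose[of "\<lambda>p. (fst (fst p), snd p)" "(M \<Otimes>\<^sub>M N) \<Otimes>\<^sub>M D" _ _, OF _ um]
    by (auto simp: split_beta' intro!: measurable_Pair)
  show ?thesis
    unfolding resample_def
  proof (intro conjI ballI)
    fix h :: "'b \<times> 'a \<Rightarrow> ennreal" assume h[measurable]: "h \<in> borel_measurable (M \<Otimes>\<^sub>M N)"
    have hm: "(\<lambda>(w, z). h (u (fst w) z, snd w)) \<in> borel_measurable ((M \<Otimes>\<^sub>M N) \<Otimes>\<^sub>M D)"
      using measurable_compose[OF m h] by (simp add: split_beta')
    have "(\<integral>\<^sup>+w. \<integral>\<^sup>+z. h (u (fst w) z, snd w) \<partial>D \<partial>(M \<Otimes>\<^sub>M N)) = (\<integral>\<^sup>+b. \<integral>\<^sup>+a. \<integral>\<^sup>+z. h (u a z, b) \<partial>D \<partial>M \<partial>N)"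
      by (subst P.nn_integral_snd[symmetric]) (use D.borel_measurable_nn_integral[OF hm] in \<open>simp_all add: split_beta'\<close>)
    also have "\<dots> = (\<integral>\<^sup>+b. \<integral>\<^sup>+a. h (a, b) \<partial>M \<partial>N)"
      by (intro nn_integral_cong resample_nn_integral[OF r]) simp
    also have "\<dots> = (\<integral>\<^sup>+w. h w \<partial>(M \<Otimes>\<^sub>M N))"
      by (subst P.nn_integral_snd[symmetric]) (auto simp: split_beta')
    finally show "(\<integral>\<^sup>+w. \<integral>\<^sup>+z. h (u (fst w) z, snd w) \<partial>D \<partial>(M \<Otimes>\<^sub>M N)) = (\<integral>\<^sup>+w. h w \<partial>(M \<Otimes>\<^sub>M N))" .
  qed (use m in simp)
qed

text \<open>The conditional expectation given all other coordinates: no \<open>h j\<close> sees the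
  resampled index, so its law can be integrated out, leaving the plain average. It serves the inner
  indices and the output index alike.\<close>

lemma resample_nn_integral_pmf:
  fixes h :: "nat \<Rightarrow> 'w \<Rightarrow> ennreal"
  assumes r: "resample \<Omega> (measure_pmf (pmf_of_set A)) upd" and A: "finite A" "A \<noteq> {}"
    and h: "\<And>j. h j \<in> borel_measurable \<Omega>" and c: "c \<in> \<Omega> \<rightarrow>\<^sub>M count_space UNIV"
    and crd: "\<And>w z. c (upd w z) = z" and inv: "\<And>j w z. h j (upd w z) = h j w"
  shows "(\<integral>\<^sup>+w. h (c w) w \<partial>\<Omega>) = (\<integral>\<^sup>+w. (\<Sum>j\<in>A. h j w) / of_nat (card A) \<partial>\<Omega>)"
proof -
  have hc: "(\<lambda>w. h (c w) w) \<in> borel_measurable \<Omega>"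
    by (rule measurable_compose_countable[OF h c])
  have "(\<integral>\<^sup>+w. h (c w) w \<partial>\<Omega>) = (\<integral>\<^sup>+w. \<integral>\<^sup>+z. h (c (upd w z)) (upd w z) \<partial>measure_pmf (pmf_of_set A) \<partial>\<Omega>)"
    using resample_nn_integral[OF r hc] by simp
  also have "\<dots> = (\<integral>\<^sup>+w. (\<Sum>j\<in>A. h j w) / of_nat (card A) \<partial>\<Omega>)"
    unfolding crd inv using A by (simp add: nn_integral_pmf_of_set)
  finally show ?thesis .
qed

section \<open>Second moments of centred batch means\<close>

lemma integrable_of_second_moment:
  fixes A :: "'z \<Rightarrow> 'a::euclidean_space"
  assumes D: "prob_space D" and A [measurable]: "A \<in> borel_measurable D"
    and V: "(\<integral>\<^sup>+z. ennreal ((norm (A z))\<^sup>2) \<partial>D) \<le> ennreal V"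
  shows "integrable D A" "integrable D (\<lambda>z. (norm (A z))\<^sup>2)"
proof -
  interpret prob_space D by fact
  show i2: "integrable D (\<lambda>z. (norm (A z))\<^sup>2)"
    by (rule integrableI_bounded) (use V in \<open>auto simp: less_top[symmetric] top_unique\<close>)
  show "integrable D A"
  proof (rule Bochner_Integration.integrable_bound[where f="\<lambda>z. 1 + (norm (A z))\<^sup>2"])
    show "AE x in D. norm (A x) \<le> norm (1 + (norm (A x))\<^sup>2)"
    proof (rule AE_I2)
      fix x have "0 \<le> (norm (A x) - 1)\<^sup>2" by simp
      then show "norm (A x) \<le> norm (1 + (norm (A x))\<^sup>2)"
        by (simp add: power2_eq_square algebra_simps)
           (smt (verit) mult_nonneg_nonneg norm_ge_zero)
    qed
  qed (use i2 in auto)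
qed

lemma second_moment_ge:
  fixes A :: "'z \<Rightarrow> 'a::euclidean_space"
  assumes D: "prob_space D" and A [measurable]: "A \<in> borel_measurable D"
    and V: "(\<integral>\<^sup>+z. ennreal ((norm (A z))\<^sup>2) \<partial>D) \<le> ennreal (c\<^sup>2)" and c: "c \<ge> 0"
  shows "(\<integral>z. norm (A z) \<partial>D) \<le> c"
proof -
  interpret prob_space D by fact
  note i = integrable_of_second_moment[OF D A V]
  let ?m = "\<integral>z. norm (A z) \<partial>D"
  have "0 \<le> (\<integral>z. (norm (A z) - ?m)\<^sup>2 \<partial>D)" by simp
  also have "\<dots> = (\<integral>z. (norm (A z))\<^sup>2 - 2 * ?m * norm (A z) + ?m\<^sup>2 \<partial>D)"
    by (simp add: power2_diff algebra_simps)
  also have "\<dots> = (\<integral>z. (norm (A z))\<^sup>2 \<partial>D) - ?m\<^sup>2"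
    using i by (simp add: prob_space power2_eq_square)
  finally have "?m\<^sup>2 \<le> (\<integral>z. (norm (A z))\<^sup>2 \<partial>D)" by simp
  also have "\<dots> \<le> c\<^sup>2"
    using V nn_integral_eq_integral[OF i(2)] by simp
  finally show ?thesis using c by (rule power2_le_imp_le)
qed

text \<open>Expanding the square, the cross term \<open>2 c (e \<bullet> A z)\<close> has mean zero;
  this is why the errors accumulate in squares and not in norms.\<close>

lemma mean_zero_second_moment:
  fixes A :: "'z \<Rightarrow> 'a::euclidean_space"
  assumes D: "prob_space D" and A [measurable]: "A \<in> borel_measurable D"
    and V: "(\<integral>\<^sup>+z. ennreal ((norm (A z))\<^sup>2) \<partial>D) \<le> ennreal V" "V \<ge> 0"
    and zero: "(\<integral>z. A z \<partial>D) = 0"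
  shows "(\<integral>\<^sup>+z. ennreal ((norm (e + c *\<^sub>R A z))\<^sup>2) \<partial>D) \<le> ennreal ((norm e)\<^sup>2 + c\<^sup>2 * V)"
proof -
  interpret prob_space D by fact
  note i1 = integrable_of_second_moment(1)[OF D A V(1)] and i2 = integrable_of_second_moment(2)[OF D A V(1)]
  have V2: "(\<integral>z. (norm (A z))\<^sup>2 \<partial>D) \<le> V"
    using V nn_integral_eq_integral[OF i2] by simp
  have exp: "(norm (e + c *\<^sub>R A z))\<^sup>2 = (norm e)\<^sup>2 + 2 * c * (e \<bullet> A z) + c\<^sup>2 * (norm (A z))\<^sup>2" for z
    unfolding power2_norm_eq_inner
    by (simp add: inner_simps power2_eq_square inner_commute algebra_simps)
  have ii: "integrable D (\<lambda>z. (norm (e + c *\<^sub>R A z))\<^sup>2)"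
    unfolding exp using i1 i2 by auto
  have "(\<integral>z. (norm (e + c *\<^sub>R A z))\<^sup>2 \<partial>D) = (norm e)\<^sup>2 + 2 * c * (e \<bullet> (\<integral>z. A z \<partial>D)) + c\<^sup>2 * (\<integral>z. (norm (A z))\<^sup>2 \<partial>D)"
    unfolding exp using i1 i2 by (simp add: prob_space)
  also have "\<dots> \<le> (norm e)\<^sup>2 + c\<^sup>2 * V"
    using V2 by (simp add: zero mult_left_mono)
  finally show ?thesis
    using nn_integral_eq_integral[OF ii] by (simp add: ennreal_leI)
qed

text \<open>\<open>e\<close> is the error before the fresh sample, \<open>st\<close> the point at
  which it is evaluated; both are blind to the coordinate. \<open>R\<close> is a bystander under the
  same integral: it carries the Lyapunov terms later, and the variance already paid in the batch
  induction.\<close>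

lemma resample_mean_zero:
  fixes A :: "'p::topological_space \<Rightarrow> 'z \<Rightarrow> 'a::euclidean_space"
  assumes D: "prob_space D" and r: "resample \<Omega> D upd"
    and A [measurable]: "(\<lambda>(p, z). A p z) \<in> borel_measurable (borel \<Otimes>\<^sub>M D)"
    and V: "\<And>p. (\<integral>\<^sup>+z. ennreal ((norm (A p z))\<^sup>2) \<partial>D) \<le> ennreal (V p)" "\<And>p. V p \<ge> 0"
    and Vm [measurable]: "V \<in> borel_measurable borel"
    and zero: "\<And>p. (\<integral>z. A p z \<partial>D) = 0"
    and [measurable]: "crd \<in> \<Omega> \<rightarrow>\<^sub>M D" "st \<in> borel_measurable \<Omega>" "e \<in> borel_measurable \<Omega>" "R \<in> borel_measurable \<Omega>"
    and crd: "\<And>w z. crd (upd w z) = z"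
    and inv: "\<And>w z. st (upd w z) = st w" "\<And>w z. e (upd w z) = e w" "\<And>w z. R (upd w z) = R w"
    and R0: "\<And>w. R w \<ge> 0" and b: "b \<ge> 0"
  shows "(\<integral>\<^sup>+w. ennreal (R w + b * (norm (e w + c *\<^sub>R A (st w) (crd w)))\<^sup>2) \<partial>\<Omega>)
       \<le> (\<integral>\<^sup>+w. ennreal (R w + b * ((norm (e w))\<^sup>2 + c\<^sup>2 * V (st w))) \<partial>\<Omega>)"
proof -
  interpret D: prob_space D by fact
  have Ap [measurable]: "A p \<in> borel_measurable D" for p
    using measurable_compose[OF measurable_Pair1' A, of p] by simp
  let ?h = "\<lambda>w. ennreal (R w + b * (norm (e w + c *\<^sub>R A (st w) (crd w)))\<^sup>2)"
  have "(\<integral>\<^sup>+w. ?h w \<partial>\<Omega>) = (\<integral>\<^sup>+w. \<integral>\<^sup>+z. ?h (upd w z) \<partial>D \<partial>\<Omega>)"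
    by (rule resample_nn_integral[OF r, symmetric]) measurable
  also have "\<dots> \<le> (\<integral>\<^sup>+w. ennreal (R w + b * ((norm (e w))\<^sup>2 + c\<^sup>2 * V (st w))) \<partial>\<Omega>)"
  proof (rule nn_integral_mono)
    fix w
    have "(\<integral>\<^sup>+z. ?h (upd w z) \<partial>D) = (\<integral>\<^sup>+z. ennreal (R w) + ennreal b * ennreal ((norm (e w + c *\<^sub>R A (st w) z))\<^sup>2) \<partial>D)"
      by (simp add: crd inv R0 b ennreal_plus ennreal_mult'')
    also have "\<dots> = ennreal (R w) + ennreal b * (\<integral>\<^sup>+z. ennreal ((norm (e w + c *\<^sub>R A (st w) z))\<^sup>2) \<partial>D)"
      by (simp add: nn_integral_add nn_integral_cmult D.emeasure_space_1)
    also have "\<dots> \<le> ennreal (R w) + ennreal b * ennreal ((norm (e w))\<^sup>2 + c\<^sup>2 * V (st w))"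
      by (intro add_left_mono mult_left_mono mean_zero_second_moment D V zero) auto
    also have "\<dots> = ennreal (R w + b * ((norm (e w))\<^sup>2 + c\<^sup>2 * V (st w)))"
      using R0 b V by (simp add: ennreal_mult'' ennreal_plus del: distrib_left)
    finally show "(\<integral>\<^sup>+z. ?h (upd w z) \<partial>D) \<le> ennreal (R w + b * ((norm (e w))\<^sup>2 + c\<^sup>2 * V (st w)))" .
  qed
  finally show ?thesis .
qed

lemma resample_avg_mean_zero:
  fixes A :: "'p::topological_space \<Rightarrow> 'z \<Rightarrow> 'a::euclidean_space"
  assumes D: "prob_space D" and r: "\<And>i. resample \<Omega> D (upd i)"
    and A [measurable]: "(\<lambda>(p, z). A p z) \<in> borel_measurable (borel \<Otimes>\<^sub>M D)"
    and V: "\<And>p. (\<integral>\<^sup>+z. ennreal ((norm (A p z))\<^sup>2) \<partial>D) \<le> ennreal (V p)" "\<And>p. V p \<ge> 0"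
    and Vm [measurable]: "V \<in> borel_measurable borel"
    and zero: "\<And>p. (\<integral>z. A p z \<partial>D) = 0"
    and [measurable]: "\<And>i. crd i \<in> \<Omega> \<rightarrow>\<^sub>M D" "st \<in> borel_measurable \<Omega>" "e \<in> borel_measurable \<Omega>"
    and Rm: "R \<in> borel_measurable \<Omega>"
    and crd: "\<And>i w z. crd i (upd i w z) = z" "\<And>i j w z. i \<noteq> j \<Longrightarrow> crd j (upd i w z) = crd j w"
    and inv: "\<And>i w z. st (upd i w z) = st w" "\<And>i w z. e (upd i w z) = e w"
    and Rinv: "\<And>i w z. R (upd i w z) = R w"
    and R0: "\<And>w. R w \<ge> 0" and b: "b \<ge> 0" and S: "S > 0"
  shows "(\<integral>\<^sup>+w. ennreal (R w + b * (norm (e w + avg S (\<lambda>i. A (st w) (crd i w))))\<^sup>2) \<partial>\<Omega>)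
       \<le> (\<integral>\<^sup>+w. ennreal (R w + b * ((norm (e w))\<^sup>2 + V (st w) / real S)) \<partial>\<Omega>)"
proof -
  \<comment> \<open>The weight \<open>1/S\<close> stays fixed while \<open>n\<close> runs, so a
    partial sum costs \<open>n V / S^2\<close>, which is \<open>V / S\<close> at
    \<open>n = S\<close>. \<open>R\<close> varies in the induction because each peeled sample moves
    its variance into it.\<close>
  have *: "(\<integral>\<^sup>+w. ennreal (R w + b * (norm (e w + (1 / real S) *\<^sub>R (\<Sum>i<n. A (st w) (crd i w))))\<^sup>2) \<partial>\<Omega>)
       \<le> (\<integral>\<^sup>+w. ennreal (R w + b * ((norm (e w))\<^sup>2 + real n * V (st w) / (real S)\<^sup>2)) \<partial>\<Omega>)" for n
    using Rm R0 Rinv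
  proof (induction n arbitrary: R)
    case 0
    then show ?case by simp
  next
    case (Suc n)
    note [measurable] = Suc.prems(1)
    let ?e = "\<lambda>w. e w + (1 / real S) *\<^sub>R (\<Sum>i<n. A (st w) (crd i w))"
    let ?R = "\<lambda>w. R w + b * ((1 / real S)\<^sup>2 * V (st w))"
    have "(\<integral>\<^sup>+w. ennreal (R w + b * (norm (e w + (1 / real S) *\<^sub>R (\<Sum>i<Suc n. A (st w) (crd i w))))\<^sup>2) \<partial>\<Omega>)
       = (\<integral>\<^sup>+w. ennreal (R w + b * (norm (?e w + (1 / real S) *\<^sub>R A (st w) (crd n w)))\<^sup>2) \<partial>\<Omega>)"
      by (simp add: scaleR_add_right add.assoc)
    also have "\<dots> \<le> (\<integral>\<^sup>+w. ennreal (R w + b * ((norm (?e w))\<^sup>2 + (1 / real S)\<^sup>2 * V (st w))) \<partial>\<Omega>)"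
    proof (rule resample_mean_zero[OF D r[of n] A V Vm zero])
      show "?e (upd n w z) = ?e w" for w z
        using crd(2)[of n _ w z] inv by (auto intro!: sum.cong)
    qed (use Suc.prems crd inv b in simp_all)
    also have "\<dots> = (\<integral>\<^sup>+w. ennreal (?R w + b * (norm (?e w))\<^sup>2) \<partial>\<Omega>)"
      by (simp add: algebra_simps)
    also have "\<dots> \<le> (\<integral>\<^sup>+w. ennreal (?R w + b * ((norm (e w))\<^sup>2 + real n * V (st w) / (real S)\<^sup>2)) \<partial>\<Omega>)"
      by (rule Suc.IH) (use Suc.prems b V inv in auto)
    also have "\<dots> = (\<integral>\<^sup>+w. ennreal (R w + b * ((norm (e w))\<^sup>2 + real (Suc n) * V (st w) / (real S)\<^sup>2)) \<partial>\<Omega>)"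
      by (simp add: algebra_simps power_divide add_divide_distrib)
    finally show ?case .
  qed
  show ?thesis
    using *[of S] S by (simp add: avg_def power2_eq_square)
qed

section \<open>Gradients of expectations\<close>

text \<open>With \<open>p\<close> replaced by a simple approximation the map is measurable piece by
  piece; continuity in \<open>p\<close> passes this to the limit.\<close>

lemma borel_measurable_Caratheodory:
  fixes F :: "'a::{metric_space, second_countable_topology} \<Rightarrow> 'c \<Rightarrow> 'b::{metric_space, second_countable_topology}"
  assumes cont: "\<And>\<xi>. continuous_on UNIV (\<lambda>p. F p \<xi>)" and F: "\<And>p. F p \<in> borel_measurable D"
  shows "(\<lambda>(p, \<xi>). F p \<xi>) \<in> borel_measurable (borel \<Otimes>\<^sub>M D)"
proof -
  obtain s where s: "\<And>i. simple_function borel (s i)" "\<And>x::'a. (\<lambda>i. s i x) \<longlonglongrightarrow> x"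
    using borel_measurable_implies_sequence_metric[of "\<lambda>x::'a. x" borel undefined] by auto
  show ?thesis
  proof (rule borel_measurable_LIMSEQ_metric)
    fix i
    have "s i \<in> borel \<rightarrow>\<^sub>M count_space (range (s i))"
      using simple_functionD[OF s(1)[of i]] by (subst measurable_count_space_eq2) auto
    then have g: "(\<lambda>p. s i (fst p)) \<in> borel \<Otimes>\<^sub>M D \<rightarrow>\<^sub>M count_space (range (s i))"
      by (rule measurable_compose[OF measurable_fst])
    have "(\<lambda>p. F (s i (fst p)) (snd p)) \<in> borel_measurable (borel \<Otimes>\<^sub>M D)"
    proof (rule measurable_compose_countable'[OF _ g])
      show "countable (range (s i))"
        using simple_functionD(1)[OF s(1)[of i]] by (simp add: countable_finite)
    qed (use F in measurable)
    then show "(\<lambda>(p, \<xi>). F (s i p) \<xi>) \<in> borel_measurable (borel \<Otimes>\<^sub>M D)"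
      by (simp add: split_beta')
  next
    fix w :: "'a \<times> 'c"
    show "(\<lambda>i. case w of (p, \<xi>) \<Rightarrow> F (s i p) \<xi>) \<longlonglongrightarrow> (case w of (p, \<xi>) \<Rightarrow> F p \<xi>)"
      using continuous_on_tendsto_compose[OF cont s(2)[of "fst w"], of "snd w"]
      by (simp add: split_beta')
  qed
qed

lemma has_derivative_along_line:
  fixes H :: "'a::real_inner \<Rightarrow> real"
  assumes "(H has_derivative (\<lambda>h. g \<bullet> h)) (at (p + t *\<^sub>R d))"
  shows "((\<lambda>t. H (p + t *\<^sub>R d)) has_real_derivative g \<bullet> d) (at t)"
proof -
  have "((\<lambda>t. p + t *\<^sub>R d) has_derivative (\<lambda>s. s *\<^sub>R d)) (at t)"
    by (auto intro!: derivative_eq_intros)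
  from has_derivative_compose[OF this assms] show ?thesis
    by (simp add: has_field_derivative_def mult_commute_abs)
qed

text \<open>\<open>G\<close> is the pointwise limit of difference quotients of the Caratheodory
  function \<open>H\<close>, so its joint measurability is a consequence and not an
  assumption.\<close>

lemma borel_measurable_gradient:
  fixes H :: "'a::euclidean_space \<Rightarrow> 'c \<Rightarrow> real"
  assumes der: "\<And>p \<xi>. ((\<lambda>p. H p \<xi>) has_derivative (\<lambda>h. G p \<xi> \<bullet> h)) (at p)"
    and H: "\<And>p. H p \<in> borel_measurable D"
  shows "(\<lambda>(p, \<xi>). G p \<xi>) \<in> borel_measurable (borel \<Otimes>\<^sub>M D)"
proof -
  have "continuous_on UNIV (\<lambda>p. H p \<xi>)" for \<xi>
    using der has_derivative_continuous by (fastforce simp: continuous_on_eq_continuous_at)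
  from borel_measurable_Caratheodory[OF this H]
  have Hm: "(\<lambda>q. H (fst q) (snd q)) \<in> borel_measurable (borel \<Otimes>\<^sub>M D)"
    by (simp add: split_beta')
  have "(\<lambda>q. G (fst q) (snd q)) \<in> borel_measurable (borel \<Otimes>\<^sub>M D)"
    unfolding borel_measurable_euclidean_space[of "\<lambda>q. G (fst q) (snd q)"]
  proof
    fix b :: 'a assume "b \<in> Basis"
    let ?d = "\<lambda>i q. (H (fst q + inverse (real (Suc i)) *\<^sub>R b) (snd q) - H (fst q) (snd q)) / inverse (real (Suc i))"
    show "(\<lambda>q. G (fst q) (snd q) \<bullet> b) \<in> borel_measurable (borel \<Otimes>\<^sub>M D)"
    proof (rule borel_measurable_LIMSEQ_metric)
      fix i
      have "(\<lambda>q. H (fst q + inverse (real (Suc i)) *\<^sub>R b) (snd q)) \<in> borel_measurable (borel \<Otimes>\<^sub>M D)"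
        using measurable_compose[OF _ Hm, of "\<lambda>q. (fst q + inverse (real (Suc i)) *\<^sub>R b, snd q)" "borel \<Otimes>\<^sub>M D"]
        by simp
      then show "?d i \<in> borel_measurable (borel \<Otimes>\<^sub>M D)"
        using Hm by measurable
    next
      fix q :: "'a \<times> 'c"
      have "((\<lambda>t. H (fst q + t *\<^sub>R b) (snd q)) has_real_derivative G (fst q) (snd q) \<bullet> b) (at 0)"
        by (rule has_derivative_along_line) (use der in simp)
      then have "(\<lambda>h. (H (fst q + h *\<^sub>R b) (snd q) - H (fst q) (snd q)) / h) \<midarrow>0\<rightarrow> G (fst q) (snd q) \<bullet> b"
        by (simp add: DERIV_def)
      moreover have "filterlim (\<lambda>i. inverse (real (Suc i))) (at 0) sequentially"
        using LIMSEQ_inverse_real_of_nat by (auto simp: filterlim_at)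
      ultimately show "(\<lambda>i. ?d i q) \<longlonglongrightarrow> G (fst q) (snd q) \<bullet> b"
        by (rule filterlim_compose)
    qed
  qed
  then show ?thesis by (simp add: split_beta')
qed

text \<open>If the right side is finite, \<open>\<phi>'\<close> is Lebesgue integrable on the
  interval and its integral agrees with the gauge integral, for which the fundamental theorem holds
  for every everywhere differentiable function.\<close>

lemma abs_increment_le_nn_integral_deriv:
  fixes \<phi> :: "real \<Rightarrow> real"
  assumes der: "\<And>t. (\<phi> has_real_derivative \<phi>' t) (at t)"
    and [measurable]: "\<phi>' \<in> borel_measurable borel"
  shows "ennreal \<bar>\<phi> 1 - \<phi> 0\<bar> \<le> (\<integral>\<^sup>+t. ennreal \<bar>\<phi>' t\<bar> * indicator {0..1} t \<partial>lborel)" (is "_ \<le> ?I")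
proof (cases "?I = \<infinity>")
  case False
  have eq: "?I = (\<integral>\<^sup>+t. ennreal (norm (indicator {0..1} t *\<^sub>R \<phi>' t)) \<partial>lborel)"
    by (intro nn_integral_cong) (auto split: split_indicator)
  have si: "set_integrable lborel {0..1} \<phi>'"
    unfolding set_integrable_def
    by (rule integrableI_bounded) (use False eq in \<open>auto simp: less_top[symmetric]\<close>)
  have "(\<phi>' has_integral (\<phi> 1 - \<phi> 0)) {0..1}"
    by (rule fundamental_theorem_of_calculus)
       (auto intro: has_field_derivative_at_within[OF der] simp: has_real_derivative_iff_has_vector_derivative[symmetric])
  then have "\<phi> 1 - \<phi> 0 = (LINT t:{0..1}|lborel. \<phi>' t)"
    using set_borel_integral_eq_integral(2)[OF si] by (simp add: integral_unique)
  then have "\<bar>\<phi> 1 - \<phi> 0\<bar> = norm (\<integral>t. indicator {0..1} t *\<^sub>R \<phi>' t \<partial>lborel)"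
    by (simp add: set_lebesgue_integral_def)
  then show ?thesis
    using integral_norm_bound_ennreal[OF si[unfolded set_integrable_def]] eq by simp
qed simp

text \<open>No continuity of \<open>G\<close> in \<open>p\<close> is available for a single \<open>\<xi>\<close>, so differentiation under the
  integral goes through the fundamental theorem of calculus on segments for the gauge integral,
  which needs no integrability of the derivative.\<close>

lemma integral_gradient:
  fixes H :: "'a::euclidean_space \<Rightarrow> 'c \<Rightarrow> real"
  assumes D: "prob_space D"
    and der: "\<And>p \<xi>. ((\<lambda>p. H p \<xi>) has_derivative (\<lambda>h. G p \<xi> \<bullet> h)) (at p)"
    and H: "\<And>p. integrable D (H p)"
    and f: "\<And>p. ((\<lambda>p. \<integral>\<xi>. H p \<xi> \<partial>D) has_derivative (\<lambda>h. df p \<bullet> h)) (at p)"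
    and Lip: "\<And>p p'. (\<integral>\<^sup>+\<xi>. ennreal ((norm (G p \<xi> - G p' \<xi>))\<^sup>2) \<partial>D) \<le> ennreal ((L * norm (p - p'))\<^sup>2)" "L \<ge> 0"
    and var: "\<And>p. (\<integral>\<^sup>+\<xi>. ennreal ((norm (G p \<xi> - df p))\<^sup>2) \<partial>D) \<le> ennreal (\<sigma>\<^sup>2)"
  shows "integrable D (G p)" "(\<integral>\<xi>. G p \<xi> \<partial>D) = df p" "norm (df p - df q) \<le> L * norm (p - q)"
proof -
  interpret prob_space D by fact
  have Gm: "(\<lambda>(p, \<xi>). G p \<xi>) \<in> borel_measurable (borel \<Otimes>\<^sub>M D)"
    by (rule borel_measurable_gradient[OF der]) (use H in auto)
  then have Gm' [measurable]: "(\<lambda>w. G (fst w) (snd w)) \<in> borel_measurable (borel \<Otimes>\<^sub>M D)"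
    by (simp add: split_beta')
  have Gp [measurable]: "G p \<in> borel_measurable D" for p
    using measurable_compose[OF measurable_Pair1' Gm, of p] by simp
  have Gi: "integrable D (G p)" for p
  proof -
    have "integrable D (\<lambda>\<xi>. G p \<xi> - df p)"
      by (rule integrable_of_second_moment(1)[OF D _ var]) measurable
    then have "integrable D (\<lambda>\<xi>. (G p \<xi> - df p) + df p)"
      by (rule Bochner_Integration.integrable_add) simp
    then show ?thesis by simp
  qed
  show "integrable D (G p)" by (rule Gi)
  have dist: "(\<integral>\<xi>. norm (G p \<xi> - G q \<xi>) \<partial>D) \<le> L * norm (p - q)" for p q
    by (rule second_moment_ge[OF D _ Lip(1)]) (use Lip(2) in auto)
  let ?f = "\<lambda>p. \<integral>\<xi>. H p \<xi> \<partial>D"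
  have mean: "(\<integral>\<xi>. G p \<xi> \<partial>D) = df p" for p
  proof -
    \<comment> \<open>\<open>g\<close> is only a candidate: a quadratic remainder makes it a
      gradient of the mean, and uniqueness of derivatives identifies it with
      \<open>df p\<close>.\<close>
    define g where "g = (\<integral>\<xi>. G p \<xi> \<partial>D)"
    have incr: "\<bar>?f (p + d) - ?f p - g \<bullet> d\<bar> \<le> L * (norm d)\<^sup>2" for d
    proof -
      let ?Z = "\<lambda>\<xi>. H (p + d) \<xi> - H p \<xi> - G p \<xi> \<bullet> d"
      let ?W = "\<lambda>\<xi> t. norm (G (p + t *\<^sub>R d) \<xi> - G p \<xi>) * norm d"
      have Zi: "integrable D ?Z"
        using H Gi by auto
      have eq: "?f (p + d) - ?f p - g \<bullet> d = (\<integral>\<xi>. ?Z \<xi> \<partial>D)"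
        using H Gi by (simp add: g_def)
      have m1: "(\<lambda>w. G (p + snd w *\<^sub>R d) (fst w)) \<in> borel_measurable (D \<Otimes>\<^sub>M lborel)"
        using measurable_compose[OF _ Gm', of "\<lambda>w. (p + snd w *\<^sub>R d, fst w)" "D \<Otimes>\<^sub>M lborel"] by simp
      have m2: "(\<lambda>w. ennreal (?W (fst w) (snd w)) * indicator {0..1} (snd w)) \<in> borel_measurable (D \<Otimes>\<^sub>M lborel)"
        using m1 by measurable
      have m3: "(\<lambda>t. G (p + t *\<^sub>R d) \<xi>) \<in> borel_measurable borel" if "\<xi> \<in> space D" for \<xi>
        using measurable_compose[OF _ Gm', of "\<lambda>t. (p + t *\<^sub>R d, \<xi>)" borel] that by simp
      interpret pair_sigma_finite D "lborel :: real measure" ..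
      have "ennreal \<bar>?f (p + d) - ?f p - g \<bullet> d\<bar> \<le> (\<integral>\<^sup>+\<xi>. ennreal \<bar>?Z \<xi>\<bar> \<partial>D)"
        unfolding eq using integral_norm_bound_ennreal[OF Zi] by simp
      also have "\<dots> \<le> (\<integral>\<^sup>+\<xi>. (\<integral>\<^sup>+t. ennreal (?W \<xi> t) * indicator {0..1} t \<partial>lborel) \<partial>D)"
      proof (rule nn_integral_mono)
        fix \<xi> assume \<xi>: "\<xi> \<in> space D"
        \<comment> \<open>The linear part is subtracted before integrating, so that the derivative
          is a difference of gradients, the quantity that \<open>Lip\<close> controls.\<close>
        let ?\<phi> = "\<lambda>t. H (p + t *\<^sub>R d) \<xi> - t * (G p \<xi> \<bullet> d)"
        have "ennreal \<bar>?\<phi> 1 - ?\<phi> 0\<bar> \<le> (\<integral>\<^sup>+t. ennreal \<bar>(G (p + t *\<^sub>R d) \<xi> - G p \<xi>) \<bullet> d\<bar> * indicator {0..1} t \<partial>lborel)"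
        proof (rule abs_increment_le_nn_integral_deriv)
          show "(?\<phi> has_real_derivative (G (p + t *\<^sub>R d) \<xi> - G p \<xi>) \<bullet> d) (at t)" for t
            using has_derivative_along_line[OF der[of \<xi> "p + t *\<^sub>R d"]]
            by (auto intro!: derivative_eq_intros simp: inner_diff_left)
        qed (use m3[OF \<xi>] in measurable)
        also have "\<dots> \<le> (\<integral>\<^sup>+t. ennreal (?W \<xi> t) * indicator {0..1} t \<partial>lborel)"
          by (intro nn_integral_mono mult_right_mono ennreal_leI Cauchy_Schwarz_ineq2) auto
        finally show "ennreal \<bar>?Z \<xi>\<bar> \<le> (\<integral>\<^sup>+t. ennreal (?W \<xi> t) * indicator {0..1} t \<partial>lborel)"
          by (simp add: algebra_simps)
      qed
      also have "\<dots> = (\<integral>\<^sup>+t. (\<integral>\<^sup>+\<xi>. ennreal (?W \<xi> t) * indicator {0..1} t \<partial>D) \<partial>lborel)"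
        by (rule Fubini'[symmetric]) (use m2 in \<open>simp add: split_beta'\<close>)
      also have "\<dots> \<le> (\<integral>\<^sup>+t. ennreal (L * (norm d)\<^sup>2) * indicator {0..1} (t::real) \<partial>lborel)"
      proof (rule nn_integral_mono)
        fix t :: real
        have Wi: "integrable D (\<lambda>\<xi>. ?W \<xi> t)"
          using Gi by auto
        have "(\<integral>\<^sup>+\<xi>. ennreal (?W \<xi> t) \<partial>D) = ennreal (\<integral>\<xi>. ?W \<xi> t \<partial>D)"
          by (rule nn_integral_eq_integral[OF Wi]) simp
        also have "\<dots> \<le> ennreal (L * (norm d)\<^sup>2)" if t: "t \<in> {0..1}"
        proof (rule ennreal_leI)
          have "(\<integral>\<xi>. ?W \<xi> t \<partial>D) \<le> (L * (\<bar>t\<bar> * norm d)) * norm d"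
            using mult_right_mono[OF dist[of "p + t *\<^sub>R d" p], of "norm d"] by simp
          also have "\<dots> \<le> L * (1 * norm d) * norm d"
            using t Lip(2) by (intro mult_right_mono mult_left_mono) auto
          finally show "(\<integral>\<xi>. ?W \<xi> t \<partial>D) \<le> L * (norm d)\<^sup>2"
            by (simp add: power2_eq_square algebra_simps)
        qed
        finally show "(\<integral>\<^sup>+\<xi>. ennreal (?W \<xi> t) * indicator {0..1} t \<partial>D) \<le> ennreal (L * (norm d)\<^sup>2) * indicator {0..1} t"
          by (cases "t \<in> {0..1}") simp_all
      qed
      also have "\<dots> = ennreal (L * (norm d)\<^sup>2)"
        by (simp add: nn_integral_cmult_indicator)
      finally show ?thesis using Lip(2) by simp
    qed
    have "(?f has_derivative (\<lambda>h. g \<bullet> h)) (at p)"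
      unfolding has_derivative_at
    proof
      show "(\<lambda>h. norm (?f (p + h) - ?f p - g \<bullet> h) / norm h) \<midarrow>0\<rightarrow> 0"
      proof (rule tendsto_sandwich[where f="\<lambda>_. 0" and h="\<lambda>h. L * norm h"])
        show "\<forall>\<^sub>F h in at 0. norm (?f (p + h) - ?f p - g \<bullet> h) / norm h \<le> L * norm h"
        proof (rule always_eventually, rule allI)
          fix h show "norm (?f (p + h) - ?f p - g \<bullet> h) / norm h \<le> L * norm h"
            using incr[of h] Lip(2) by (cases "h = 0") (auto simp: field_simps power2_eq_square)
        qed
        show "(\<lambda>h. L * norm h) \<midarrow>(0::'a)\<rightarrow> 0"
          by (auto intro!: tendsto_eq_intros)
      qed (auto intro!: always_eventually)
    qed (rule bounded_linear_inner_right)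
    with f have "(\<lambda>h. g \<bullet> h) = (\<lambda>h. df p \<bullet> h)"
      by (rule has_derivative_unique[symmetric])
    then have "(g - df p) \<bullet> (g - df p) = 0"
      by (metis inner_diff_left right_minus_eq)
    then show ?thesis by (simp add: g_def)
  qed
  show "(\<integral>\<xi>. G p \<xi> \<partial>D) = df p" by (rule mean)
  have "norm (df p - df q) = norm (\<integral>\<xi>. G p \<xi> - G q \<xi> \<partial>D)"
    using Gi by (simp add: mean)
  also have "\<dots> \<le> (\<integral>\<xi>. norm (G p \<xi> - G q \<xi>) \<partial>D)"
    by (rule integral_norm_bound)
  finally show "norm (df p - df q) \<le> L * norm (p - q)"
    using dist[of p q] by simp
qed

lemma Lipschitz_gradient_quadratic_bound:
  fixes f :: "'a::real_inner \<Rightarrow> real"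
  assumes der: "\<And>p. (f has_derivative (\<lambda>h. g p \<bullet> h)) (at p)"
    and Lip: "\<And>p q. norm (g p - g q) \<le> L * norm (p - q)" 
  shows "\<bar>f q - f p - g p \<bullet> (q - p)\<bar> \<le> L / 2 * (norm (q - p))\<^sup>2"
proof -
  define d where "d = q - p"
  have bd: "\<bar>(g (p + t *\<^sub>R d) - g p) \<bullet> d\<bar> \<le> L * t * (norm d)\<^sup>2" if "t \<ge> 0" for t
  proof -
    have "\<bar>(g (p + t *\<^sub>R d) - g p) \<bullet> d\<bar> \<le> norm (g (p + t *\<^sub>R d) - g p) * norm d"
      by (rule Cauchy_Schwarz_ineq2)
    also have "\<dots> \<le> (L * norm (t *\<^sub>R d)) * norm d"
      using Lip[of "p + t *\<^sub>R d" p] by (intro mult_right_mono) auto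
    finally show ?thesis using that by (simp add: power2_eq_square algebra_simps)
  qed
  have *: "a * (f (p + 1 *\<^sub>R d) - f p - g p \<bullet> d) \<le> L / 2 * (norm d)\<^sup>2" if a: "a = 1 \<or> a = -1" for a :: real
  proof -
    let ?\<phi> = "\<lambda>t. a * (f (p + t *\<^sub>R d) - t * (g p \<bullet> d)) - L / 2 * t\<^sup>2 * (norm d)\<^sup>2"
    have "?\<phi> 1 \<le> ?\<phi> 0"
    proof (rule DERIV_nonpos_imp_nonincreasing[where f="?\<phi>"])
      fix t :: real assume t: "0 \<le> t" "t \<le> 1"
      have "(?\<phi> has_real_derivative a * ((g (p + t *\<^sub>R d) - g p) \<bullet> d) - L * t * (norm d)\<^sup>2) (at t)"
        using has_derivative_along_line[OF der[of "p + t *\<^sub>R d"]]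
        by (auto intro!: derivative_eq_intros simp: inner_diff_left)
      moreover have "a * ((g (p + t *\<^sub>R d) - g p) \<bullet> d) - L * t * (norm d)\<^sup>2 \<le> 0"
        using bd[OF t(1)] a by auto
      ultimately show "\<exists>y. (?\<phi> has_real_derivative y) (at t) \<and> y \<le> 0" by blast
    qed simp
    then show ?thesis by (simp add: algebra_simps)
  qed
  show ?thesis using *[of 1] *[of "-1"] unfolding d_def abs_le_iff by simp
qed

lemma second_moment_centered_le:
  fixes A :: "'z \<Rightarrow> 'a::euclidean_space"
  assumes D: "prob_space D" and A [measurable]: "A \<in> borel_measurable D"
    and V: "(\<integral>\<^sup>+z. ennreal ((norm (A z))\<^sup>2) \<partial>D) \<le> ennreal V"
  shows "(\<integral>\<^sup>+z. ennreal ((norm (A z - (\<integral>z. A z \<partial>D)))\<^sup>2) \<partial>D) \<le> ennreal V"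
proof -
  interpret prob_space D by fact
  note i = integrable_of_second_moment[OF D A V]
  let ?m = "\<integral>z. A z \<partial>D"
  have eq: "(norm (A z - ?m))\<^sup>2 = (norm (A z))\<^sup>2 - 2 * (?m \<bullet> A z) + (norm ?m)\<^sup>2" for z
    unfolding power2_norm_eq_inner by (simp add: inner_simps inner_commute)
  have ii: "integrable D (\<lambda>z. (norm (A z - ?m))\<^sup>2)"
    unfolding eq using i by auto
  have "(\<integral>z. (norm (A z - ?m))\<^sup>2 \<partial>D) = (\<integral>z. (norm (A z))\<^sup>2 \<partial>D) - (norm ?m)\<^sup>2"
    unfolding eq using i by (simp add: prob_space power2_norm_eq_inner)
  then have "(\<integral>z. (norm (A z - ?m))\<^sup>2 \<partial>D) \<le> (\<integral>z. (norm (A z))\<^sup>2 \<partial>D)" by simp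
  then have "ennreal (\<integral>z. (norm (A z - ?m))\<^sup>2 \<partial>D) \<le> ennreal (\<integral>z. (norm (A z))\<^sup>2 \<partial>D)"
    by (rule ennreal_leI)
  also have "\<dots> \<le> ennreal V"
    using V nn_integral_eq_integral[OF i(2)] by simp
  finally show ?thesis
    using nn_integral_eq_integral[OF ii] by simp
qed

section \<open>The primal function\<close>

lemma linear_eq_inner_axis:
  fixes \<phi> :: "real^'n \<Rightarrow> real"
  assumes "linear \<phi>"
  shows "\<phi> h = (\<chi> i. \<phi> (axis i 1)) \<bullet> h"
proof -
  have "\<phi> h = \<phi> (\<Sum>i\<in>UNIV. h $ i *\<^sub>R axis i 1)"
    using basis_expansion[of h] by (simp add: scalar_mult_eq_scaleR)
  also have "\<dots> = (\<Sum>i\<in>UNIV. h $ i * \<phi> (axis i 1))"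
    by (simp add: linear_sum[OF assms] linear_scale[OF assms])
  finally show ?thesis
    by (simp add: inner_vec_def mult.commute)
qed

text \<open>From here the two partial gradients are one vector of the product space; its squared
  norm is exactly the sum of squares in (A2) and (A5).\<close>

lemma gradx_grady_has_derivative:
  fixes g :: "real^'n \<Rightarrow> real^'d \<Rightarrow> real"
  assumes "(\<lambda>p. g (fst p) (snd p)) differentiable (at (x, y))"
  shows "((\<lambda>p. g (fst p) (snd p)) has_derivative (\<lambda>h. (gradx g x y, grady g x y) \<bullet> h)) (at (x, y))"
proof -
  let ?D = "frechet_derivative (\<lambda>p. g (fst p) (snd p)) (at (x, y))"
  have D: "((\<lambda>p. g (fst p) (snd p)) has_derivative ?D) (at (x, y))"
    using assms frechet_derivative_works by blast
  then have lin: "linear ?D" by (rule has_derivative_linear)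
  have l1: "linear (\<lambda>a. ?D (a, 0))"
    using linear_compose[OF _ lin, of "\<lambda>a. (a, 0)"] by (simp add: o_def linear_iff)
  have l2: "linear (\<lambda>b. ?D (0, b))"
    using linear_compose[OF _ lin, of "\<lambda>b. (0, b)"] by (simp add: o_def linear_iff)
  have "?D h = (gradx g x y, grady g x y) \<bullet> h" for h
  proof -
    have "?D h = ?D ((fst h, 0) + (0, snd h))" by simp
    also have "\<dots> = ?D (fst h, 0) + ?D (0, snd h)" by (rule linear_add[OF lin])
    also have "\<dots> = (gradx g x y, grady g x y) \<bullet> h"
      using linear_eq_inner_axis[OF l1, of "fst h"] linear_eq_inner_axis[OF l2, of "snd h"]
      by (simp add: gradx_def grady_def inner_prod_def)
    finally show ?thesis .
  qed
  then have "?D = (\<lambda>h. (gradx g x y, grady g x y) \<bullet> h)" by blast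
  with D show ?thesis by simp
qed

lemma grad_eqI:
  fixes g :: "real^'n \<Rightarrow> real"
  assumes "(g has_derivative (\<lambda>h. w \<bullet> h)) (at x)"
  shows "grad g x = w"
proof -
  have "frechet_derivative g (at x) = (\<lambda>h. w \<bullet> h)"
    using frechet_derivative_at[OF assms] by simp
  then show ?thesis
    by (simp add: grad_def vec_eq_iff inner_axis)
qed

lemma norm_Pair_sq: "(norm (a, b))\<^sup>2 = (norm a)\<^sup>2 + (norm b)\<^sup>2"
  by (simp add: norm_Pair)

lemma norm_fst_diff_le: "norm (fst a - fst b) \<le> norm (a - b)"
  using dist_fst_le[of a b] by (simp add: dist_norm)

lemma norm_snd_diff_le: "norm (snd a - snd b) \<le> norm (a - b)"
  using dist_snd_le[of a b] by (simp add: dist_norm)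

section \<open>The objective on the product space\<close>

locale minimax =
  fixes F :: "real^'n \<Rightarrow> real^'d \<Rightarrow> 'c \<Rightarrow> real" and D :: "'c measure" and L \<mu> \<sigma> :: real
  assumes minimax: "minimax_assms F D L \<mu> \<sigma>"
begin

definition f :: "(real^'n) \<times> (real^'d) \<Rightarrow> real" where
  "f p = fexp F D (fst p) (snd p)"

definition df :: "(real^'n) \<times> (real^'d) \<Rightarrow> (real^'n) \<times> (real^'d)" where
  "df p = (gradx (fexp F D) (fst p) (snd p), grady (fexp F D) (fst p) (snd p))"

abbreviation "fx p \<equiv> fst (df p)"
abbreviation "fy p \<equiv> snd (df p)"

definition G :: "(real^'n) \<times> (real^'d) \<Rightarrow> 'c \<Rightarrow> (real^'n) \<times> (real^'d)" where
  "G p \<xi> = (Gx F (fst p) (snd p) \<xi>, Gy F (fst p) (snd p) \<xi>)"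

definition "\<kappa> = L / \<mu>"

lemma prob_D: "prob_space D" and L_pos: "L > 0" and mu_pos: "\<mu> > 0" and sigma_pos: "\<sigma> > 0"
  using minimax by (auto simp: minimax_assms_def)

lemma f_has_derivative: "(f has_derivative (\<lambda>h. df p \<bullet> h)) (at p)"
proof -
  have "(\<lambda>p. fexp F D (fst p) (snd p)) differentiable (at (fst p, snd p))"
    using minimax unfolding minimax_assms_def by blast
  from gradx_grady_has_derivative[OF this] show ?thesis
    by (simp add: f_def[abs_def] df_def)
qed

lemma F_has_derivative: "((\<lambda>p. F (fst p) (snd p) \<xi>) has_derivative (\<lambda>h. G p \<xi> \<bullet> h)) (at p)"
proof -
  have "(\<lambda>p. F (fst p) (snd p) \<xi>) differentiable (at (fst p, snd p))"
    using minimax unfolding minimax_assms_def by blast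
  from gradx_grady_has_derivative[OF this] show ?thesis
    by (simp add: G_def Gx_def Gy_def)
qed

lemma F_integrable: "integrable D (F x y)"
  using minimax by (simp add: minimax_assms_def)

lemma G_Lipschitz:
  "(\<integral>\<^sup>+\<xi>. ennreal ((norm (G p \<xi> - G p' \<xi>))\<^sup>2) \<partial>D) \<le> ennreal ((L * norm (p - p'))\<^sup>2)"
proof -
  obtain x y x' y' where p: "p = (x, y)" "p' = (x', y')" by (cases p, cases p')
  show ?thesis
    using minimax unfolding minimax_assms_def p by (simp add: G_def norm_Pair_sq power_mult_distrib)
qed

lemma G_variance: "(\<integral>\<^sup>+\<xi>. ennreal ((norm (G p \<xi> - df p))\<^sup>2) \<partial>D) \<le> ennreal (\<sigma>\<^sup>2)"
  using minimax unfolding minimax_assms_def by (simp add: G_def df_def norm_Pair_sq)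

lemma G_measurable: "(\<lambda>(p, \<xi>). G p \<xi>) \<in> borel_measurable (borel \<Otimes>\<^sub>M D)"
  by (rule borel_measurable_gradient[OF F_has_derivative])
     (use F_integrable in \<open>simp add: borel_measurable_integrable\<close>)

lemma
  shows G_integrable: "integrable D (G p)"
    and integral_G: "(\<integral>\<xi>. G p \<xi> \<partial>D) = df p"
    and df_Lipschitz: "norm (df p - df q) \<le> L * norm (p - q)"
  using integral_gradient[OF prob_D F_has_derivative F_integrable _ G_Lipschitz _ G_variance]
    f_has_derivative L_pos unfolding f_def[abs_def] fexp_def by auto

lemma df_continuous: "continuous_on UNIV df"
proof (rule continuous_on_iff[THEN iffD2], intro ballI allI impI)
  fix p and e :: real assume "e > 0"
  then show "\<exists>d>0. \<forall>q\<in>UNIV. dist q p < d \<longrightarrow> dist (df q) (df p) < e"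
    using df_Lipschitz[of _ p] L_pos
    by (intro exI[of _ "e / L"]) (fastforce simp: dist_norm field_simps intro: le_less_trans)
qed

lemma df_borel [measurable]: "df \<in> borel_measurable borel"
  by (rule borel_measurable_continuous_onI[OF df_continuous])

lemma f_borel [measurable]: "f \<in> borel_measurable borel"
  using f_has_derivative has_derivative_continuous
  by (intro borel_measurable_continuous_onI) (fastforce simp: continuous_on_eq_continuous_at)

lemma f_quadratic_bound: "\<bar>f q - f p - df p \<bullet> (q - p)\<bar> \<le> L / 2 * (norm (q - p))\<^sup>2"
  by (rule Lipschitz_gradient_quadratic_bound[OF f_has_derivative df_Lipschitz])

lemma f_quadratic_upper: "f q \<le> f p + df p \<bullet> (q - p) + L / 2 * (norm (q - p))\<^sup>2"
  and f_quadratic_lower: "f p + df p \<bullet> (q - p) - L / 2 * (norm (q - p))\<^sup>2 \<le> f q"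
  using f_quadratic_bound[of q p] unfolding abs_le_iff by linarith+

text \<open>The defining inequality at parameter \<open>t\<close>, compared with the quadratic upper
  bound at \<open>y + t d\<close> and divided by \<open>t\<close>, leaves an error of order
  \<open>t\<close>; then \<open>t\<close> tends to 0.\<close>

lemma f_strongly_concave:
  "f (x, y') \<le> f (x, y) + fy (x, y) \<bullet> (y' - y) - \<mu> / 2 * (norm (y' - y))\<^sup>2"
proof -
  define d where "d = y' - y"
  let ?A = "f (x, y') - f (x, y) + \<mu> / 2 * (norm d)\<^sup>2 - fy (x, y) \<bullet> d"
  let ?B = "(\<mu> + L) / 2 * (norm d)\<^sup>2"
  have *: "?A \<le> ?B * t" if t: "0 < t" "t \<le> 1" for t :: real
  proof -
    have y: "(1 - t) *\<^sub>R y + t *\<^sub>R y' = y + t *\<^sub>R d"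
      by (simp add: d_def algebra_simps)
    have "strongly_concave_on \<mu> UNIV (\<lambda>y. fexp F D x y)"
      using minimax unfolding minimax_assms_def by blast
    then have "(1 - t) * fexp F D x y + t * fexp F D x y' + \<mu> / 2 * t * (1 - t) * (norm (y - y'))\<^sup>2
        \<le> fexp F D x ((1 - t) *\<^sub>R y + t *\<^sub>R y')"
      using t unfolding strongly_concave_on_def by auto
    then have "(1 - t) * f (x, y) + t * f (x, y') + \<mu> / 2 * t * (1 - t) * (norm d)\<^sup>2 \<le> f (x, y + t *\<^sub>R d)"
      unfolding y by (simp add: f_def d_def norm_minus_commute)
    moreover have "f (x, y + t *\<^sub>R d) \<le> f (x, y) + t * (fy (x, y) \<bullet> d) + L / 2 * (t\<^sup>2 * (norm d)\<^sup>2)"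
      using f_quadratic_upper[of "(x, y + t *\<^sub>R d)" "(x, y)"]
      by (simp add: inner_prod_def norm_Pair_sq power_mult_distrib)
    ultimately have "t * ?A \<le> t * (?B * t)"
      by (simp add: field_simps power2_eq_square)
    then show ?thesis using t by simp
  qed
  have "?A \<le> 0"
  proof (rule LIMSEQ_le_const)
    show "(\<lambda>n. ?B * inverse (real (Suc n))) \<longlonglongrightarrow> 0"
      using tendsto_mult_right_zero[OF LIMSEQ_inverse_real_of_nat] .
    show "\<exists>N. \<forall>n\<ge>N. ?A \<le> ?B * inverse (real (Suc n))"
      using *[of "inverse (real (Suc _))"] by (auto simp: inverse_le_1_iff)
  qed
  then show ?thesis by (simp add: d_def)
qed

section \<open>The maximiser and the gradient of the primal function\<close>

lemma f_max_exists: "\<exists>y. \<forall>y'. f (x, y') \<le> f (x, y)"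
proof -
  define g where "g = fy (x, 0)"
  \<comment> \<open>Beyond this radius the loss \<open>\<mu>/2 |y'|^2\<close> outweighs the gain
    \<open>g \<bullet> y'\<close>, so the maximum over the compact ball is global.\<close>
  define R where "R = 2 * norm g / \<mu>"
  have R: "R \<ge> 0" using mu_pos by (simp add: R_def)
  have "continuous_on UNIV f"
    using f_has_derivative has_derivative_continuous by (fastforce simp: continuous_on_eq_continuous_at)
  then have "continuous_on (cball 0 R) (\<lambda>y. f (x, y))"
    by (rule continuous_on_compose2) (auto intro!: continuous_intros)
  then obtain y where y: "y \<in> cball 0 R" "\<And>y'. y' \<in> cball 0 R \<Longrightarrow> f (x, y') \<le> f (x, y)"
    using continuous_attains_sup[of "cball 0 R" "\<lambda>y. f (x, y)"] R by auto
  have "f (x, y') \<le> f (x, y)" for y'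
  proof (cases "y' \<in> cball 0 R")
    case False
    then have "R < norm y'" by simp
    then have "2 * norm g \<le> \<mu> * norm y'"
      using mu_pos by (simp add: R_def field_simps)
    then have "norm g * norm y' \<le> \<mu> / 2 * (norm y')\<^sup>2"
      using mult_right_mono[of "2 * norm g" "\<mu> * norm y'" "norm y'"] by (simp add: power2_eq_square)
    moreover have "f (x, y') \<le> f (x, 0) + g \<bullet> y' - \<mu> / 2 * (norm y')\<^sup>2"
      using f_strongly_concave[of x y' 0] by (simp add: g_def)
    ultimately have "f (x, y') \<le> f (x, 0)"
      using norm_cauchy_schwarz[of g y'] by linarith
    also have "\<dots> \<le> f (x, y)" using y(2)[of 0] R by simp
    finally show ?thesis .
  qed (rule y(2))
  then show ?thesis by blast
qed

definition ymax :: "real^'n \<Rightarrow> real^'d" where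
  "ymax x = (SOME y. \<forall>y'. f (x, y') \<le> f (x, y))"

lemma f_le_ymax: "f (x, y) \<le> f (x, ymax x)"
  using someI_ex[OF f_max_exists[of x]] unfolding ymax_def by blast

abbreviation "\<Phi> \<equiv> Phi F D"

lemma Phi_eq: "\<Phi> x = f (x, ymax x)"
  unfolding Phi_def
proof (rule cSup_eq_maximum)
  show "f (x, ymax x) \<in> range (fexp F D x)" by (auto simp: f_def)
  show "z \<le> f (x, ymax x)" if "z \<in> range (fexp F D x)" for z
    using that f_le_ymax[of x] by (auto simp: f_def)
qed

lemma f_le_Phi: "f (x, y) \<le> \<Phi> x"
  by (simp add: Phi_eq f_le_ymax)

lemma Phi_star_le: "Phi_star F D \<le> \<Phi> x"
  using minimax unfolding Phi_star_def minimax_assms_def by (intro cINF_lower) auto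

text \<open>A gradient step with step size \<open>1/L\<close> from \<open>ymax x\<close> would gain
  \<open>|g|^2 / (2L)\<close>, which maximality forbids unless \<open>g = 0\<close>.\<close>

lemma fy_ymax: "fy (x, ymax x) = 0"
proof -
  let ?g = "fy (x, ymax x)"
  have "f (x, ymax x + (1 / L) *\<^sub>R ?g) \<ge> f (x, ymax x) + (1 / L) * (?g \<bullet> ?g) - L / 2 * ((1 / L)\<^sup>2 * (norm ?g)\<^sup>2)"
    using f_quadratic_lower[of "(x, ymax x)" "(x, ymax x + (1 / L) *\<^sub>R ?g)"] L_pos
    by (simp add: inner_prod_def norm_Pair_sq power_divide)
  moreover have "(1 / L) * (?g \<bullet> ?g) - L / 2 * ((1 / L)\<^sup>2 * (norm ?g)\<^sup>2) = (norm ?g)\<^sup>2 / (2 * L)"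
    using L_pos by (simp add: power2_norm_eq_inner[symmetric] field_simps power2_eq_square)
  ultimately have "(norm ?g)\<^sup>2 / (2 * L) \<le> 0"
    using f_le_ymax[of x "ymax x + (1 / L) *\<^sub>R ?g"] by linarith
  then show ?thesis using L_pos by (simp add: divide_le_0_iff)
qed

text \<open>The Polyak-Lojasiewicz inequality: \<open>|g|^2 / (2\<mu>)\<close> is the maximum of
  \<open>g \<bullet> d - \<mu>/2 |d|^2\<close> over \<open>d\<close>.\<close>

lemma Phi_gap_le: "\<Phi> x - f (x, y) \<le> (norm (fy (x, y)))\<^sup>2 / (2 * \<mu>)"
proof -
  let ?g = "fy (x, y)" and ?d = "ymax x - y"
  have "0 \<le> (norm (?g - \<mu> *\<^sub>R ?d))\<^sup>2" by simp
  also have "\<dots> = (norm ?g)\<^sup>2 - 2 * \<mu> * (?g \<bullet> ?d) + \<mu>\<^sup>2 * (norm ?d)\<^sup>2"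
    unfolding power2_norm_eq_inner by (simp add: inner_simps inner_commute power2_eq_square algebra_simps)
  finally have "?g \<bullet> ?d - \<mu> / 2 * (norm ?d)\<^sup>2 \<le> (norm ?g)\<^sup>2 / (2 * \<mu>)"
    using mu_pos by (simp add: field_simps power2_eq_square)
  then show ?thesis
    using f_strongly_concave[of x "ymax x" y] by (simp add: Phi_eq)
qed

text \<open>Strong concavity is used from both ends of the segment and added; at
  \<open>ymax x\<close> the linear term vanishes.\<close>

lemma dist_ymax_le: "\<mu> * norm (y - ymax x) \<le> norm (fy (x, y))"
proof -
  let ?d = "ymax x - y"
  have "\<mu> * (norm ?d)\<^sup>2 \<le> fy (x, y) \<bullet> ?d"
    using f_strongly_concave[of x "ymax x" y] f_strongly_concave[of x y "ymax x"]
    by (simp add: fy_ymax norm_minus_commute)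
  also have "\<dots> \<le> norm (fy (x, y)) * norm ?d" by (rule norm_cauchy_schwarz)
  finally have "(\<mu> * norm ?d) * norm ?d \<le> norm (fy (x, y)) * norm ?d"
    by (simp add: power2_eq_square)
  then show ?thesis
    by (cases "?d = 0") (auto simp: norm_minus_commute)
qed

text \<open>Along a unit vector of the \<open>y\<close>-space, which exists because index types are
  nonempty, \<open>f\<close> bends downwards by at least \<mu> and at most \<open>L\<close>.\<close>

lemma kappa_ge_1: "\<kappa> \<ge> 1"
proof -
  let ?y = "axis undefined 1 :: real^'d"
  have "f (0, ?y) \<ge> f (0, 0) + fy (0, 0) \<bullet> ?y - L / 2"
    using f_quadratic_lower[of "(0, 0)" "(0, ?y)"] by (simp add: inner_prod_def norm_Pair_sq)
  moreover have "f (0, ?y) \<le> f (0, 0) + fy (0, 0) \<bullet> ?y - \<mu> / 2"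
    using f_strongly_concave[of 0 ?y 0] by simp
  ultimately show ?thesis using mu_pos by (simp add: \<kappa>_def)
qed

text \<open>Danskin's formula. It is confirmed as the gradient by squeezing \<Phi> between two
  quadratics, without any regularity of \<open>ymax\<close>.\<close>

definition "dPhi x = fx (x, ymax x)"

lemma Phi_lower: "\<Phi> x + dPhi x \<bullet> (x' - x) - L / 2 * (norm (x' - x))\<^sup>2 \<le> \<Phi> x'"
  using f_quadratic_lower[of "(x, ymax x)" "(x', ymax x)"] f_le_Phi[of x' "ymax x"]
  by (simp add: inner_prod_def norm_Pair_sq Phi_eq[of x] dPhi_def)

text \<open>Bounding the gap at \<open>(x', ymax x)\<close> by the squared partial gradient costs only one factor
  \<open>\<kappa>\<close>; estimating through the joint smoothness of \<open>f\<close> and the \<open>\<kappa>\<close>-Lipschitz maximiser costs two.\<close>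

lemma Phi_upper: "\<Phi> x' \<le> \<Phi> x + dPhi x \<bullet> (x' - x) + \<kappa> * L * (norm (x' - x))\<^sup>2"
proof -
  have "norm (fy (x', ymax x)) = norm (fy (x', ymax x) - fy (x, ymax x))"
    by (simp add: fy_ymax)
  also have "\<dots> \<le> norm (df (x', ymax x) - df (x, ymax x))"
    by (rule norm_snd_diff_le)
  also have "\<dots> \<le> L * norm (x' - x)"
    using df_Lipschitz[of "(x', ymax x)" "(x, ymax x)"] by (simp add: norm_Pair)
  finally have "(norm (fy (x', ymax x)))\<^sup>2 \<le> (L * norm (x' - x))\<^sup>2"
    by (simp add: power_mono)
  then have "(norm (fy (x', ymax x)))\<^sup>2 / (2 * \<mu>) \<le> (L * norm (x' - x))\<^sup>2 / (2 * \<mu>)"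
    using mu_pos by (simp add: divide_right_mono)
  also have "\<dots> = \<kappa> * L / 2 * (norm (x' - x))\<^sup>2"
    by (simp add: \<kappa>_def power2_eq_square mult_ac)
  finally have "\<Phi> x' \<le> f (x', ymax x) + \<kappa> * L / 2 * (norm (x' - x))\<^sup>2"
    using Phi_gap_le[of x' "ymax x"] by simp
  moreover have "f (x', ymax x) \<le> \<Phi> x + dPhi x \<bullet> (x' - x) + L / 2 * (norm (x' - x))\<^sup>2"
    using f_quadratic_upper[of "(x', ymax x)" "(x, ymax x)"]
    by (simp add: inner_prod_def norm_Pair_sq Phi_eq[of x] dPhi_def)
  moreover have "L / 2 * (norm (x' - x))\<^sup>2 \<le> \<kappa> * L / 2 * (norm (x' - x))\<^sup>2"
    using kappa_ge_1 L_pos by (intro mult_right_mono) auto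
  ultimately show ?thesis by simp
qed

lemma Phi_has_derivative: "(\<Phi> has_derivative (\<lambda>h. dPhi x \<bullet> h)) (at x)"
  unfolding has_derivative_at
proof
  have *: "\<bar>\<Phi> (x + h) - \<Phi> x - dPhi x \<bullet> h\<bar> \<le> \<kappa> * L * (norm h)\<^sup>2" for h
  proof -
    have "L / 2 * (norm h)\<^sup>2 \<le> \<kappa> * L * (norm h)\<^sup>2"
    proof (rule mult_right_mono)
      show "L / 2 \<le> \<kappa> * L" using mult_right_mono[OF kappa_ge_1, of L] L_pos by simp
    qed simp
    then show ?thesis
      using Phi_lower[of x "x + h"] Phi_upper[of "x + h" x] by (simp add: abs_le_iff)
  qed
  show "(\<lambda>h. norm (\<Phi> (x + h) - \<Phi> x - dPhi x \<bullet> h) / norm h) \<midarrow>0\<rightarrow> 0"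
  proof (rule tendsto_sandwich[where f="\<lambda>_. 0" and h="\<lambda>h. \<kappa> * L * norm h"])
    show "\<forall>\<^sub>F h in at 0. norm (\<Phi> (x + h) - \<Phi> x - dPhi x \<bullet> h) / norm h \<le> \<kappa> * L * norm h"
    proof (rule always_eventually, rule allI)
      fix h show "norm (\<Phi> (x + h) - \<Phi> x - dPhi x \<bullet> h) / norm h \<le> \<kappa> * L * norm h"
        using *[of h] by (cases "h = 0") (auto simp: field_simps power2_eq_square)
    qed
    show "(\<lambda>h. \<kappa> * L * norm h) \<midarrow>(0::real^'n)\<rightarrow> 0"
      by (auto intro!: tendsto_eq_intros)
  qed (auto intro!: always_eventually)
qed (rule bounded_linear_inner_right)

lemma grad_Phi: "grad \<Phi> x = dPhi x"
  by (rule grad_eqI[OF Phi_has_derivative])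

lemma Phi_borel [measurable]: "\<Phi> \<in> borel_measurable borel"
  using Phi_has_derivative has_derivative_continuous
  by (intro borel_measurable_continuous_onI) (fastforce simp: continuous_on_eq_continuous_at)

text \<open>Two errors: evaluating at \<open>y\<close> in place of the maximiser costs
  \<open>L |y - ymax x|\<close>, at most \<kappa> times the partial gradient, and the estimator adds
  its own.\<close>

lemma dPhi_error:
  "(norm (dPhi x - v))\<^sup>2 \<le> 2 * (norm ((v, u) - df (x, y)))\<^sup>2 + 2 * \<kappa>\<^sup>2 * (norm (fy (x, y)))\<^sup>2"
proof -
  have "norm (dPhi x - fx (x, y)) \<le> norm (df (x, ymax x) - df (x, y))"
    unfolding dPhi_def by (rule norm_fst_diff_le)
  also have "\<dots> \<le> L * norm (y - ymax x)"
    using df_Lipschitz[of "(x, ymax x)" "(x, y)"] by (simp add: norm_Pair norm_minus_commute)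
  also have "\<dots> = \<kappa> * (\<mu> * norm (y - ymax x))"
    using mu_pos by (simp add: \<kappa>_def)
  also have "\<dots> \<le> \<kappa> * norm (fy (x, y))"
    using kappa_ge_1 by (intro mult_left_mono dist_ymax_le) auto
  finally have a: "norm (dPhi x - fx (x, y)) \<le> \<kappa> * norm (fy (x, y))" .
  have b: "norm (v - fx (x, y)) \<le> norm ((v, u) - df (x, y))"
    using norm_fst_diff_le[of "(v, u)" "df (x, y)"] by simp
  have "norm (dPhi x - v) \<le> norm (dPhi x - fx (x, y)) + norm (v - fx (x, y))"
    using norm_triangle_ineq4[of "dPhi x - fx (x, y)" "v - fx (x, y)"] by simp
  also have "\<dots> \<le> \<kappa> * norm (fy (x, y)) + norm ((v, u) - df (x, y))"
    using a b by simp
  finally have "(norm (dPhi x - v))\<^sup>2 \<le> (\<kappa> * norm (fy (x, y)) + norm ((v, u) - df (x, y)))\<^sup>2"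
    by (simp add: power_mono)
  also have "\<dots> \<le> 2 * (\<kappa> * norm (fy (x, y)))\<^sup>2 + 2 * (norm ((v, u) - df (x, y)))\<^sup>2"
    using sum_squares_bound[of "\<kappa> * norm (fy (x, y))" "norm ((v, u) - df (x, y))"]
    by (simp add: power2_sum)
  finally show ?thesis by (simp add: power_mult_distrib)
qed

text \<open>This value of \<open>lam\<close> makes \<open>L lam^2 / 2 = lam / 7\<close>. Polarising
  \<open>g \<bullet> u\<close> contributes \<open>lam / 2\<close> times each of \<open>|g|^2\<close>
  and \<open>|u|^2\<close>, and \<open>1/2 - 1/7 = (1/2)(5/7)\<close>. The component
  \<open>v\<close> is arbitrary: it only enlarges the error to that of the full estimator.\<close>

lemma ascent_step:
  assumes lam: "lam = 2 / (7 * L)"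
  shows "\<Phi> x - f (x, y + lam *\<^sub>R u) + lam / 2 * ((norm (fy (x, y)))\<^sup>2 + 5 / 7 * (norm u)\<^sup>2)
    \<le> \<Phi> x - f (x, y) + lam / 2 * (norm ((v, u) - df (x, y)))\<^sup>2"
proof -
  let ?g = "fy (x, y)"
  have X: "L / 2 * (lam\<^sup>2 * (norm u)\<^sup>2) = lam * (norm u)\<^sup>2 / 7"
    using L_pos by (simp add: lam power2_eq_square)
  have "f (x, y + lam *\<^sub>R u) \<ge> f (x, y) + lam * (?g \<bullet> u) - L / 2 * (lam\<^sup>2 * (norm u)\<^sup>2)"
    using f_quadratic_lower[of "(x, y)" "(x, y + lam *\<^sub>R u)"]
    by (simp add: inner_prod_def norm_Pair_sq power_mult_distrib)
  then have "f (x, y + lam *\<^sub>R u) \<ge> f (x, y) + lam * (?g \<bullet> u) - lam * (norm u)\<^sup>2 / 7"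
    unfolding X .
  moreover have "(norm (u - ?g))\<^sup>2 = (norm ?g)\<^sup>2 + (norm u)\<^sup>2 - 2 * (?g \<bullet> u)"
    unfolding power2_norm_eq_inner by (simp add: inner_simps inner_commute)
  then have "lam * (?g \<bullet> u) = lam / 2 * ((norm ?g)\<^sup>2 + (norm u)\<^sup>2 - (norm (u - ?g))\<^sup>2)"
    by simp
  moreover have "lam / 2 * (norm (u - ?g))\<^sup>2 \<le> lam / 2 * (norm ((v, u) - df (x, y)))\<^sup>2"
  proof (intro mult_left_mono power_mono)
    show "norm (u - ?g) \<le> norm ((v, u) - df (x, y))"
      using norm_snd_diff_le[of "(v, u)" "df (x, y)"] by simp
  qed (use L_pos in \<open>auto simp: lam\<close>)
  ultimately show ?thesis by (simp add: algebra_simps)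
qed

section \<open>The normalised outer step\<close>

context
  fixes \<epsilon> \<eta> :: real and x v :: "real^'n"
  assumes eps: "\<epsilon> > 0" and eta: "\<eta> = min (\<epsilon> / (5 * \<kappa> * L * norm v)) (1 / (10 * \<kappa> * L))"
begin

lemma kL_pos: "\<kappa> * L > 0"
  using kappa_ge_1 L_pos by simp

lemma eta_nonneg: "\<eta> \<ge> 0"
  using kappa_ge_1 L_pos eps unfolding eta by simp

lemma step_length: "norm (\<eta> *\<^sub>R v) \<le> \<epsilon> / (5 * \<kappa> * L)"
\<comment> \<open>Cancelling \<open>norm v\<close> needs \<open>v \<noteq> 0\<close>; at
  \<open>v = 0\<close> division by zero makes \<open>\<eta>\<close> equal to 0.\<close>
proof (cases "v = 0")
  case False
  have "\<eta> * norm v \<le> \<epsilon> / (5 * \<kappa> * L * norm v) * norm v"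
    unfolding eta by (intro mult_right_mono) auto
  then show ?thesis using False eta_nonneg by simp
qed (use kL_pos eps in \<open>simp add: mult.assoc\<close>)

text \<open>Recovers \<open>|v|\<close> from the quantity \<open>\<eta> |v|^2\<close> that
  telescopes. If the first entry of the minimum is active, the last term equals \<open>|v|\<close>;
  otherwise it equals \<open>|v|^2 / (2\<epsilon>)\<close> and AM-GM applies.\<close>

lemma norm_le_eta: "norm v \<le> \<epsilon> / 2 + 5 * \<kappa> * L / \<epsilon> * (\<eta> * (norm v)\<^sup>2)"
proof (cases "v = 0")
  case False
  show ?thesis
  proof (cases "\<epsilon> / (5 * \<kappa> * L * norm v) \<le> 1 / (10 * \<kappa> * L)")
    case True
    then have "5 * \<kappa> * L / \<epsilon> * (\<eta> * (norm v)\<^sup>2) = norm v"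
      using False eps kL_pos kappa_ge_1 L_pos unfolding eta by (simp add: min_def power2_eq_square field_simps)
    then show ?thesis using eps by simp
  next
    case c: False
    have "0 \<le> (norm v - \<epsilon>)\<^sup>2" by simp
    then have "2 * \<epsilon> * norm v \<le> \<epsilon>\<^sup>2 + (norm v)\<^sup>2"
      by (simp add: power2_eq_square algebra_simps)
    then have "norm v \<le> \<epsilon> / 2 + (norm v)\<^sup>2 / (2 * \<epsilon>)"
      using eps by (simp add: field_simps power2_eq_square)
    also have "(norm v)\<^sup>2 / (2 * \<epsilon>) = 5 * \<kappa> * L / \<epsilon> * (\<eta> * (norm v)\<^sup>2)"
      using c eps kappa_ge_1 L_pos unfolding eta by (simp add: min_def)
    finally show ?thesis .
  qed
qed (use eps in simp)

text \<open>With \<open>\<eta> \<le> 1/(10\<kappa>L)\<close> the curvature term is at most a tenth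
  of \<open>\<eta> |v|^2\<close>, and polarisation yields half of it:
  \<open>1/2 - 1/10 = 2/5\<close>. The error term gets the weight
  \<open>\<eta>/2 \<le> 1/(20\<kappa>L)\<close>.\<close>

lemma Phi_descent:
  "\<Phi> (x - \<eta> *\<^sub>R v) + 2 / 5 * (\<eta> * (norm v)\<^sup>2) \<le> \<Phi> x + (norm (dPhi x - v))\<^sup>2 / (20 * \<kappa> * L)"
proof -
  have e10: "\<eta> \<le> 1 / (10 * \<kappa> * L)" by (simp add: eta)
  have "\<Phi> (x - \<eta> *\<^sub>R v) \<le> \<Phi> x - \<eta> * (dPhi x \<bullet> v) + \<kappa> * L * (\<eta>\<^sup>2 * (norm v)\<^sup>2)"
    using Phi_upper[of "x - \<eta> *\<^sub>R v" x] by (simp add: power_mult_distrib)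
  moreover have "(norm (dPhi x - v))\<^sup>2 = (norm (dPhi x))\<^sup>2 + (norm v)\<^sup>2 - 2 * (dPhi x \<bullet> v)"
    unfolding power2_norm_eq_inner by (simp add: inner_simps inner_commute)
  then have "- (dPhi x \<bullet> v) \<le> (norm (dPhi x - v))\<^sup>2 / 2 - (norm v)\<^sup>2 / 2"
    using zero_le_power2[of "norm (dPhi x)"] by linarith
  then have "\<eta> * (- (dPhi x \<bullet> v)) \<le> \<eta> * ((norm (dPhi x - v))\<^sup>2 / 2 - (norm v)\<^sup>2 / 2)"
    by (rule mult_left_mono[OF _ eta_nonneg])
  moreover have "\<eta> * (norm (dPhi x - v))\<^sup>2 \<le> 1 / (10 * \<kappa> * L) * (norm (dPhi x - v))\<^sup>2"
    by (rule mult_right_mono[OF e10]) simp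
  moreover have "\<kappa> * L * (\<eta>\<^sup>2 * (norm v)\<^sup>2) \<le> 1 / 10 * (\<eta> * (norm v)\<^sup>2)"
  proof -
    have "\<kappa> * L * \<eta> \<le> 1 / 10"
      using mult_left_mono[OF e10, of "\<kappa> * L"] kL_pos kappa_ge_1 L_pos by simp
    from mult_right_mono[OF this, of "\<eta> * (norm v)\<^sup>2"] show ?thesis
      using eta_nonneg by (simp add: power2_eq_square mult.assoc)
  qed
  ultimately show ?thesis
    by (simp add: algebra_simps)
qed

end

end

section \<open>The process\<close>

lemma borel_measurable_fst' [measurable]:
  "(fst :: 'a::second_countable_topology \<times> 'b::second_countable_topology \<Rightarrow> 'a) \<in> borel_measurable borel"
  by (intro borel_measurable_continuous_onI continuous_intros)

lemma borel_measurable_snd' [measurable]: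
  "(snd :: 'a::second_countable_topology \<times> 'b::second_countable_topology \<Rightarrow> 'b) \<in> borel_measurable borel"
  by (intro borel_measurable_continuous_onI continuous_intros)

lemma avg_Pair: "avg S (\<lambda>i. (a i, b i)) = (avg S a, avg S b)"
  by (simp add: avg_def prod_eq_iff fst_sum snd_sum)

lemma avg_diff: "avg S (\<lambda>i. a i - b i) = avg S a - avg S b"
  by (simp add: avg_def sum_subtractf scaleR_diff_right)

lemma avg_const: "S > 0 \<Longrightarrow> avg S (\<lambda>_. a) = a"
  by (simp add: avg_def sum_constant_scaleR)

text \<open>The ceilings enter only through inequalities: 42 stands below 7368/175, and
  \<open>\<kappa> \<ge> 1\<close> absorbs the rounding of \<open>m\<close> into
  \<open>30\<kappa>\<close>. Of the initialisation only the law \<open>\<nu>\<close> of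
  \<open>y0\<close> and its gradient moment are kept.\<close>

locale sreda = minimax F D L \<mu> \<sigma>
  for F :: "real^'n \<Rightarrow> real^'d \<Rightarrow> 'c \<Rightarrow> real" and D :: "'c measure" and L \<mu> \<sigma> :: real +
  fixes \<epsilon> lam :: real and x0 :: "real^'n" and \<nu> :: "(real^'d) measure" and q m S1 S2 K :: nat
  assumes eps_pos: "\<epsilon> > 0"
    and prob_nu: "prob_space \<nu>" and sets_nu: "sets \<nu> = sets borel"
    and init: "(\<integral>\<^sup>+y. ennreal ((norm (fy (x0, y)))\<^sup>2) \<partial>\<nu>) \<le> ennreal (\<epsilon>\<^sup>2 / \<kappa>\<^sup>2)"
    and lam_eq: "lam = 2 / (7 * L)"
    and q_pos: "q > 0"
    and S1_ge: "real S1 \<ge> 24 * \<sigma>\<^sup>2 * \<kappa>\<^sup>2 / \<epsilon>\<^sup>2"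
    and S2_ge: "real S2 \<ge> 42 * \<kappa> * real q"
    and m_ge: "28 * \<kappa> \<le> real m + 1" and m_le: "real m + 2 \<le> 30 * \<kappa>"
begin

section \<open>The sample space and its resamplings\<close>

definition "M_C = PiM UNIV (\<lambda>_::nat \<times> nat. D)"
definition "M_X = PiM UNIV (\<lambda>_::nat \<times> nat \<times> nat. D)"
definition "M_S = PiM UNIV (\<lambda>_::nat. measure_pmf (pmf_of_set {0..m}))"
definition "M_J = measure_pmf (pmf_of_set {0..K - 1})"
text \<open>All samples are drawn in advance, also for indices that the run never reads, so each
  draw is a fixed coordinate. The factors are initial point, checkpoint batches, inner batches,
  inner indices and output index.\<close>

definition "\<Omega> = \<nu> \<Otimes>\<^sub>M (M_C \<Otimes>\<^sub>M (M_X \<Otimes>\<^sub>M (M_S \<Otimes>\<^sub>M M_J)))"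

lemma prob_M_C: "prob_space M_C" and prob_M_X: "prob_space M_X"
  and prob_M_S: "prob_space M_S" and prob_M_J: "prob_space M_J"
  unfolding M_C_def M_X_def M_S_def M_J_def
  by (auto intro!: prob_space_PiM prob_D prob_space_measure_pmf)

lemma prob_SJ: "prob_space (M_S \<Otimes>\<^sub>M M_J)"
  and prob_XSJ: "prob_space (M_X \<Otimes>\<^sub>M (M_S \<Otimes>\<^sub>M M_J))"
  and prob_CXSJ: "prob_space (M_C \<Otimes>\<^sub>M (M_X \<Otimes>\<^sub>M (M_S \<Otimes>\<^sub>M M_J)))"
  and prob_Omega: "prob_space \<Omega>"
  unfolding \<Omega>_def
  by (intro prob_space_pair prob_M_C prob_M_X prob_M_S prob_M_J prob_nu)+

abbreviation "cC w \<equiv> fst (snd w)"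
abbreviation "cX w \<equiv> fst (snd (snd w))"
abbreviation "cS w \<equiv> fst (snd (snd (snd w)))"
abbreviation "cJ w \<equiv> snd (snd (snd (snd w)))"

definition "updC i w z = (fst w, (cC w)(i := z), snd (snd w))"
definition "updX i w z = (fst w, cC w, (cX w)(i := z), snd (snd (snd w)))"
definition "updS i w z = (fst w, cC w, cX w, (cS w)(i := z), cJ w)"
definition "updJ w z = (fst w, cC w, cX w, cS w, z)"

lemmas sigma_finites = prob_space_imp_sigma_finite[OF prob_nu] prob_space_imp_sigma_finite[OF prob_M_C]
  prob_space_imp_sigma_finite[OF prob_M_X] prob_space_imp_sigma_finite[OF prob_M_S]
  prob_space_imp_sigma_finite[OF prob_M_J] prob_space_imp_sigma_finite[OF prob_SJ]
  prob_space_imp_sigma_finite[OF prob_XSJ] prob_space_imp_sigma_finite[OF prob_CXSJ]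
  prob_space_imp_sigma_finite[OF prob_D] prob_space_imp_sigma_finite[OF prob_space_measure_pmf]

lemma resample_C: "resample \<Omega> D (updC i)"
proof -
  have "resample M_C D (\<lambda>w z. w(i := z))"
    unfolding M_C_def by (rule resample_PiM[OF prob_D])
  then have "resample (M_C \<Otimes>\<^sub>M (M_X \<Otimes>\<^sub>M (M_S \<Otimes>\<^sub>M M_J))) D (\<lambda>p z. ((fst p)(i := z), snd p))"
    by (rule resample_fst[rotated 3]) (rule sigma_finites)+
  from resample_snd[OF _ _ _ this, of \<nu>] show ?thesis
    unfolding \<Omega>_def updC_def[abs_def] by (simp add: sigma_finites)
qed

lemma resample_X: "resample \<Omega> D (updX i)"
proof -
  have "resample M_X D (\<lambda>w z. w(i := z))"
    unfolding M_X_def by (rule resample_PiM[OF prob_D])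
  then have "resample (M_X \<Otimes>\<^sub>M (M_S \<Otimes>\<^sub>M M_J)) D (\<lambda>p z. ((fst p)(i := z), snd p))"
    by (rule resample_fst[rotated 3]) (rule sigma_finites)+
  from resample_snd[OF _ _ _ resample_snd[OF _ _ _ this, of M_C], of \<nu>] show ?thesis
    unfolding \<Omega>_def updX_def[abs_def] by (simp add: sigma_finites)
qed

lemma resample_S: "resample \<Omega> (measure_pmf (pmf_of_set {0..m})) (updS i)"
proof -
  have "resample M_S (measure_pmf (pmf_of_set {0..m})) (\<lambda>w z. w(i := z))"
    unfolding M_S_def by (rule resample_PiM[OF prob_space_measure_pmf])
  then have "resample (M_S \<Otimes>\<^sub>M M_J) (measure_pmf (pmf_of_set {0..m})) (\<lambda>p z. ((fst p)(i := z), snd p))"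
    by (rule resample_fst[rotated 3]) (rule sigma_finites)+
  from resample_snd[OF _ _ _ resample_snd[OF _ _ _ resample_snd[OF _ _ _ this, of M_X], of M_C], of \<nu>]
  show ?thesis
    unfolding \<Omega>_def updS_def[abs_def] by (simp add: sigma_finites)
qed

lemma resample_J: "resample \<Omega> (measure_pmf (pmf_of_set {0..K - 1})) updJ"
proof -
  have "resample M_J M_J (\<lambda>_ z. z)"
    by (rule resample_self[OF prob_M_J])
  from resample_snd[OF _ _ _ resample_snd[OF _ _ _ resample_snd[OF _ _ _ resample_snd[OF _ _ _ this, of M_S], of M_X], of M_C], of \<nu>]
  show ?thesis
    unfolding \<Omega>_def updJ_def[abs_def] M_J_def[symmetric] by (simp add: sigma_finites)
qed

lemma measurable_fst_Omega [measurable]: "fst \<in> borel_measurable \<Omega>"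
  unfolding \<Omega>_def using measurable_fst[of \<nu>] measurable_cong_sets[OF refl sets_nu] by blast

lemma measurable_cC [measurable]: "(\<lambda>w. cC w i) \<in> \<Omega> \<rightarrow>\<^sub>M D"
proof -
  have "(\<lambda>w. w i) \<in> M_C \<rightarrow>\<^sub>M D" unfolding M_C_def by (rule measurable_component_singleton) simp
  from measurable_compose[OF _ this, of "\<lambda>w. cC w" \<Omega>] show ?thesis by (simp add: \<Omega>_def)
qed

lemma measurable_cX [measurable]: "(\<lambda>w. cX w i) \<in> \<Omega> \<rightarrow>\<^sub>M D"
proof -
  have "(\<lambda>w. w i) \<in> M_X \<rightarrow>\<^sub>M D" unfolding M_X_def by (rule measurable_component_singleton) simp
  from measurable_compose[OF _ this, of "\<lambda>w. cX w" \<Omega>] show ?thesis by (simp add: \<Omega>_def)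
qed

lemma measurable_cS [measurable]: "(\<lambda>w. cS w i) \<in> \<Omega> \<rightarrow>\<^sub>M count_space UNIV"
proof -
  have "(\<lambda>w. w i) \<in> M_S \<rightarrow>\<^sub>M measure_pmf (pmf_of_set {0..m})"
    unfolding M_S_def by (rule measurable_component_singleton) simp
  then have "(\<lambda>w. w i) \<in> M_S \<rightarrow>\<^sub>M count_space UNIV" by simp
  from measurable_compose[OF _ this, of "\<lambda>w. cS w" \<Omega>] show ?thesis by (simp add: \<Omega>_def)
qed

lemma measurable_cJ [measurable]: "(\<lambda>w. cJ w) \<in> \<Omega> \<rightarrow>\<^sub>M count_space UNIV"
proof -
  have "(\<lambda>w. cJ w) \<in> \<Omega> \<rightarrow>\<^sub>M M_J" by (simp add: \<Omega>_def)
  then show ?thesis by (simp add: M_J_def)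
qed

lemma measurable_G_compose [measurable (raw)]:
  "p \<in> borel_measurable M \<Longrightarrow> c \<in> M \<rightarrow>\<^sub>M D \<Longrightarrow> (\<lambda>w. G (p w) (c w)) \<in> borel_measurable M"
  using measurable_compose[OF measurable_Pair G_measurable, of p M c]
  by simp

section \<open>The iterates as functions of the sample point\<close>

definition "state k w = sreda_state F \<epsilon> \<kappa> L lam S1 S2 q x0 (fst w)
  (\<lambda>k i. cC w (k, i)) (\<lambda>k t i. cX w (k, t, i)) (cS w) k"

definition pt :: "nat \<Rightarrow> (real^'d) \<times> (nat \<times> nat \<Rightarrow> 'c) \<times> (nat \<times> nat \<times> nat \<Rightarrow> 'c) \<times> (nat \<Rightarrow> nat) \<times> nat \<Rightarrow> (real^'n) \<times> (real^'d)" where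
  "pt k w = (fst (state k w), fst (snd (state k w)))"
definition est :: "nat \<Rightarrow> (real^'d) \<times> (nat \<times> nat \<Rightarrow> 'c) \<times> (nat \<times> nat \<times> nat \<Rightarrow> 'c) \<times> (nat \<Rightarrow> nat) \<times> nat \<Rightarrow> (real^'n) \<times> (real^'d)" where
  "est k w = snd (snd (state k w))"

definition "\<eta> k w = min (\<epsilon> / (5 * \<kappa> * L * norm (fst (est k w)))) (1 / (10 * \<kappa> * L))"
definition "xnext k w = fst (pt k w) - \<eta> k w *\<^sub>R fst (est k w)"

definition "cm k t w = cm_state F S2 lam (\<lambda>t i. cX w (k, t, i)) (fst (pt k w)) (xnext k w)
  (snd (pt k w)) (fst (est k w)) (snd (est k w)) t"
definition "ptI k t w = (xnext k w, fst (cm k t w))"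
definition "estI k t w = snd (cm k t w)"

text \<open>The predecessor of inner index \<open>t\<close>: for \<open>t = 0\<close> it is the
  outer iterate, which the algorithm labels -1. With it a single recursion, \<open>estI_eq\<close>,
  covers the step in \<open>x\<close> and the steps in \<open>y\<close>.\<close>

definition "ptP k t w = (case t of 0 \<Rightarrow> pt k w | Suc t' \<Rightarrow> ptI k t' w)"
definition "estP k t w = (case t of 0 \<Rightarrow> est k w | Suc t' \<Rightarrow> estI k t' w)"

lemma ptP_simps [simp]: "ptP k 0 w = pt k w" "ptP k (Suc t) w = ptI k t w"
  and estP_simps [simp]: "estP k 0 w = est k w" "estP k (Suc t) w = estI k t w"
  by (simp_all add: ptP_def estP_def)

lemma pt_0: "pt 0 w = (x0, fst w)"
  by (simp add: pt_def state_def)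

lemma est_0: "est 0 w = avg S1 (\<lambda>i. G (pt 0 w) (cC w (0, i)))"
  by (simp add: pt_def est_def state_def G_def avg_Pair)

lemma fst_ptI [simp]: "fst (ptI k t w) = xnext k w"
  by (simp add: ptI_def)

lemma ptI_0: "ptI k 0 w = (xnext k w, snd (pt k w))"
  by (simp add: ptI_def cm_def)

lemma ptI_Suc: "ptI k (Suc t) w = (xnext k w, snd (ptI k t w) + lam *\<^sub>R snd (estI k t w))"
  by (simp add: ptI_def estI_def cm_def Let_def split_beta')

lemma estI_eq:
  "estI k t w = estP k t w + avg S2 (\<lambda>i. G (ptI k t w) (cX w (k, t, i)) - G (ptP k t w) (cX w (k, t, i)))"
proof (cases t)
  case 0
  then show ?thesis
    by (simp add: estI_def cm_def ptI_def G_def avg_Pair prod_eq_iff)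
next
  case (Suc t')
  then show ?thesis
    by (simp add: estI_def cm_def ptI_def G_def avg_Pair prod_eq_iff Let_def split_beta')
qed

lemma state_Suc:
  "state (Suc k) w = (if Suc k mod q = 0
     then (xnext k w, fst (cm k (cS w k + 1) w),
           avg S1 (\<lambda>i. Gx F (xnext k w) (fst (cm k (cS w k + 1) w)) (cC w (Suc k, i))),
           avg S1 (\<lambda>i. Gy F (xnext k w) (fst (cm k (cS w k + 1) w)) (cC w (Suc k, i))))
     else (xnext k w, cm k (cS w k + 1) w))"
  by (simp add: state_def pt_def est_def cm_def xnext_def \<eta>_def Let_def split_beta' del: cm_state.simps)

lemma pt_Suc: "pt (Suc k) w = ptI k (Suc (cS w k)) w"
  by (simp add: pt_def ptI_def state_Suc)

lemma est_Suc: "est (Suc k) w = (if Suc k mod q = 0 then avg S1 (\<lambda>i. G (pt (Suc k) w) (cC w (Suc k, i)))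
    else estI k (Suc (cS w k)) w)"
  by (simp add: pt_def est_def estI_def state_Suc G_def avg_Pair)

lemma est_checkpoint: "k mod q = 0 \<Longrightarrow> est k w = avg S1 (\<lambda>i. G (pt k w) (cC w (k, i)))"
  by (cases k) (simp_all add: est_0 est_Suc)

section \<open>Measurability of the iterates\<close>

lemma avg_measurable [measurable (raw)]:
  fixes g :: "nat \<Rightarrow> 'w \<Rightarrow> 'v::euclidean_space"
  shows "(\<And>i. g i \<in> borel_measurable M) \<Longrightarrow> (\<lambda>w. avg S (\<lambda>i. g i w)) \<in> borel_measurable M"
  unfolding avg_def by measurable

lemma inner_measurable:
  assumes [measurable]: "pt k \<in> borel_measurable \<Omega>" "est k \<in> borel_measurable \<Omega>"
  shows "xnext k \<in> borel_measurable \<Omega> \<and> ptI k t \<in> borel_measurable \<Omega> \<and> estI k t \<in> borel_measurable \<Omega>"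
proof (intro conjI)
  show x [measurable]: "xnext k \<in> borel_measurable \<Omega>"
    unfolding xnext_def[abs_def] \<eta>_def by measurable
  have "ptI k t \<in> borel_measurable \<Omega> \<and> estI k t \<in> borel_measurable \<Omega>"
  proof (induction t)
    case 0
    have [measurable]: "ptI k 0 \<in> borel_measurable \<Omega>"
      by (subst ptI_0[abs_def]) measurable
    have "estI k 0 \<in> borel_measurable \<Omega>"
      by (rule measurable_cong[THEN iffD2, OF estI_eq]) (simp, measurable)
    then show ?case by simp
  next
    case (Suc t)
    then have [measurable]: "ptI k t \<in> borel_measurable \<Omega>" "estI k t \<in> borel_measurable \<Omega>" by auto
    have [measurable]: "ptI k (Suc t) \<in> borel_measurable \<Omega>"
      by (subst ptI_Suc[abs_def]) measurable
    have "estI k (Suc t) \<in> borel_measurable \<Omega>"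
      by (rule measurable_cong[THEN iffD2, OF estI_eq]) (simp, measurable)
    then show ?case by simp
  qed
  then show "ptI k t \<in> borel_measurable \<Omega>" "estI k t \<in> borel_measurable \<Omega>" by auto
qed

lemma outer_measurable: "pt k \<in> borel_measurable \<Omega> \<and> est k \<in> borel_measurable \<Omega>"
proof (induction k)
  case 0
  have [measurable]: "pt 0 \<in> borel_measurable \<Omega>"
    by (subst pt_0[abs_def]) measurable
  show ?case by (auto simp: est_0[abs_def])
next
  case (Suc k)
  then have *: "ptI k t \<in> borel_measurable \<Omega>" "estI k t \<in> borel_measurable \<Omega>" for t
    using inner_measurable by auto
  \<comment> \<open>The index \<open>s_k\<close> is random, but having countably many values it may
    be substituted into a family that is measurable for each fixed index.\<close>
  have [measurable]: "pt (Suc k) \<in> borel_measurable \<Omega>" "(\<lambda>w. estI k (Suc (cS w k)) w) \<in> borel_measurable \<Omega>"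
    unfolding pt_Suc[abs_def]
    by (rule measurable_compose_countable[OF _ measurable_cS]; rule *)+
  show ?case by (auto simp: est_Suc[abs_def])
qed

lemmas [measurable] = outer_measurable[THEN conjunct1] outer_measurable[THEN conjunct2]
  inner_measurable[OF outer_measurable[THEN conjunct1] outer_measurable[THEN conjunct2], THEN conjunct1]
  inner_measurable[OF outer_measurable[THEN conjunct1] outer_measurable[THEN conjunct2], THEN conjunct2, THEN conjunct1]
  inner_measurable[OF outer_measurable[THEN conjunct1] outer_measurable[THEN conjunct2], THEN conjunct2, THEN conjunct2]

lemma ptP_measurable [measurable]: "ptP k t \<in> borel_measurable \<Omega>" "estP k t \<in> borel_measurable \<Omega>"
  by (cases t; simp add: ptP_def[abs_def] estP_def[abs_def])+

lemma eta_measurable [measurable]: "\<eta> k \<in> borel_measurable \<Omega>"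
  unfolding \<eta>_def[abs_def] by measurable

section \<open>Which coordinates an iterate reads\<close>

lemma inner_cong:
  assumes "pt k w' = pt k w" "est k w' = est k w" "\<And>t' i. t' \<le> t \<Longrightarrow> cX w' (k, t', i) = cX w (k, t', i)"
  shows "ptI k t w' = ptI k t w \<and> estI k t w' = estI k t w"
proof -
  have x: "xnext k w' = xnext k w" using assms by (simp add: xnext_def \<eta>_def)
  show ?thesis
    using assms(3)
  proof (induction t)
    case 0
    then show ?case using assms x by (simp add: ptI_0 estI_eq)
  next
    case (Suc t)
    then have "ptI k t w' = ptI k t w" "estI k t w' = estI k t w" by auto
    then show ?case using Suc.prems x by (simp add: ptI_Suc estI_eq[of k "Suc t"])
  qed
qed

text \<open>Strict inequality, against the weak one in \<open>inner_cong\<close>: the point and the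
  previous estimate at inner index \<open>t\<close> are fixed before batch \<open>t\<close> is
  drawn. This is the predictability that the variance computation needs.\<close>

lemma ptI_cong:
  assumes "pt k w' = pt k w" "est k w' = est k w" "\<And>t' i. t' < t \<Longrightarrow> cX w' (k, t', i) = cX w (k, t', i)"
  shows "ptI k t w' = ptI k t w" "ptP k t w' = ptP k t w" "estP k t w' = estP k t w"
proof -
  have x: "xnext k w' = xnext k w" using assms by (simp add: xnext_def \<eta>_def)
  show "ptI k t w' = ptI k t w" "ptP k t w' = ptP k t w" "estP k t w' = estP k t w"
    using assms x inner_cong[OF assms(1,2), of "t - 1"]
    by (cases t; simp add: ptI_0 ptI_Suc less_Suc_eq_le)+
qed

lemma outer_cong:
  assumes "fst w' = fst w" "\<And>k' i. k' \<le> k \<Longrightarrow> cC w' (k', i) = cC w (k', i)"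
    "\<And>k' t i. k' < k \<Longrightarrow> cX w' (k', t, i) = cX w (k', t, i)" "\<And>k'. k' < k \<Longrightarrow> cS w' k' = cS w k'"
  shows "pt k w' = pt k w \<and> est k w' = est k w"
  using assms
proof (induction k)
  case 0
  then show ?case by (simp add: pt_0 est_0)
next
  case (Suc k)
  then have "pt k w' = pt k w" "est k w' = est k w" by auto
  from inner_cong[OF this] show ?case
    using Suc.prems by (simp add: pt_Suc est_Suc)
qed

text \<open>As \<open>outer_cong\<close>, but strict in the checkpoint index: \<open>pt k\<close> is
  determined before checkpoint batch \<open>k\<close>, whereas \<open>est k\<close> may read
  it.\<close>

lemma pt_cong:
  assumes "fst w' = fst w" "\<And>k' i. k' < k \<Longrightarrow> cC w' (k', i) = cC w (k', i)"
    "\<And>k' t i. k' < k \<Longrightarrow> cX w' (k', t, i) = cX w (k', t, i)" "\<And>k'. k' < k \<Longrightarrow> cS w' k' = cS w k'"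
  shows "pt k w' = pt k w"
proof (cases k)
  case (Suc k')
  then have "pt k' w' = pt k' w \<and> est k' w' = est k' w"
    using assms by (intro outer_cong) auto
  then show ?thesis
    using assms inner_cong[of k' w' w] by (simp add: Suc pt_Suc)
qed (use assms in \<open>simp add: pt_0\<close>)

lemma updC_pt: "pt k (updC (k, i) w z) = pt k w"
  by (rule pt_cong) (auto simp: updC_def)

lemma updX_pt [simp]: "pt k (updX (k, t, i) w z) = pt k w" "est k (updX (k, t, i) w z) = est k w"
  using outer_cong[of "updX (k, t, i) w z" w k] by (auto simp: updX_def)

lemma updX_xnext [simp]: "xnext k (updX (k, t, i) w z) = xnext k w"
  by (simp add: xnext_def \<eta>_def)

lemma updX_ptI: "t' \<le> t \<Longrightarrow> ptI k t' (updX (k, t, i) w z) = ptI k t' w"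
  "t' < t \<Longrightarrow> estI k t' (updX (k, t, i) w z) = estI k t' w"
  "ptP k t (updX (k, t, i) w z) = ptP k t w" "estP k t (updX (k, t, i) w z) = estP k t w"
  using ptI_cong[where k=k and w="w" and w'="updX (k, t, i) w z" and t=t', OF updX_pt]
    inner_cong[where k=k and w="w" and w'="updX (k, t, i) w z" and t=t', OF updX_pt]
    ptI_cong[where k=k and w="w" and w'="updX (k, t, i) w z" and t=t, OF updX_pt]
  by (auto simp: updX_def)

lemma updS_ptI: "ptI k t (updS k w z) = ptI k t w" "estI k t (updS k w z) = estI k t w"
proof -
  have "pt k (updS k w z) = pt k w \<and> est k (updS k w z) = est k w"
    by (rule outer_cong) (auto simp: updS_def)
  then have "ptI k t (updS k w z) = ptI k t w \<and> estI k t (updS k w z) = estI k t w"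
    by (intro inner_cong) (auto simp: updS_def)
  then show "ptI k t (updS k w z) = ptI k t w" "estI k t (updS k w z) = estI k t w" by auto
qed

lemma updJ_pt: "pt k (updJ w z) = pt k w" "est k (updJ w z) = est k w"
  using outer_cong[of "updJ w z" w k] by (auto simp: updJ_def)

definition "err p v = (norm (v - df p))\<^sup>2" for p v

lemma S_pos: "S1 > 0" "S2 > 0"
proof -
  have "0 < 24 * \<sigma>\<^sup>2 * \<kappa>\<^sup>2 / \<epsilon>\<^sup>2"
    using sigma_pos eps_pos kappa_ge_1 by simp
  then have "real S1 > 0" using S1_ge by linarith
  then show "S1 > 0" by simp
  have "0 < 42 * \<kappa> * real q" using kappa_ge_1 q_pos by simp
  then have "real S2 > 0" using S2_ge by linarith
  then show "S2 > 0" by simp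
qed

text \<open>Given the past, the new error is the old one plus a batch mean of centred gradient
  differences. Their second moment is bounded by (A2), since centring can only lower it.\<close>

lemma est_fresh:
  assumes Rm: "R \<in> borel_measurable \<Omega>" and R: "\<And>i w z. R (updX (k, t, i) w z) = R w" and R0: "\<And>w. R w \<ge> 0"
    and b: "b \<ge> 0"
  shows "(\<integral>\<^sup>+w. ennreal (R w + b * err (ptI k t w) (estI k t w)) \<partial>\<Omega>)
    \<le> (\<integral>\<^sup>+w. ennreal (R w + b * (err (ptP k t w) (estP k t w) +
          L\<^sup>2 * (norm (ptI k t w - ptP k t w))\<^sup>2 / real S2)) \<partial>\<Omega>)"
proof -
  interpret D: prob_space D by (rule prob_D)
  define A where "A = (\<lambda>(p, p') \<xi>. (G p \<xi> - G p' \<xi>) - (df p - df p'))"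
  define V :: "((real^'n) \<times> (real^'d)) \<times> ((real^'n) \<times> (real^'d)) \<Rightarrow> real"
    where "V = (\<lambda>(p, p'). L\<^sup>2 * (norm (p - p'))\<^sup>2)"
  have eq: "estI k t w - df (ptI k t w)
     = (estP k t w - df (ptP k t w)) + avg S2 (\<lambda>i. A (ptI k t w, ptP k t w) (cX w (k, t, i)))" for w
    using S_pos unfolding A_def by (simp add: estI_eq[of k t] avg_diff avg_const)
  have "(\<integral>\<^sup>+w. ennreal (R w + b * (norm ((estP k t w - df (ptP k t w)) + avg S2 (\<lambda>i. A (ptI k t w, ptP k t w) (cX w (k, t, i)))))\<^sup>2) \<partial>\<Omega>)
    \<le> (\<integral>\<^sup>+w. ennreal (R w + b * ((norm (estP k t w - df (ptP k t w)))\<^sup>2 + V (ptI k t w, ptP k t w) / real S2)) \<partial>\<Omega>)"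
  proof (rule resample_avg_mean_zero[OF prob_D, where upd="\<lambda>i. updX (k, t, i)" and crd="\<lambda>i w. cX w (k, t, i)"
        and st="\<lambda>w. (ptI k t w, ptP k t w)" and e="\<lambda>w. estP k t w - df (ptP k t w)"])
    show "resample \<Omega> D (updX (k, t, i))" for i by (rule resample_X)
    show "(\<lambda>(p, z). A p z) \<in> borel_measurable (borel \<Otimes>\<^sub>M D)"
      unfolding A_def split_beta' by measurable
    show "(\<integral>\<^sup>+z. ennreal ((norm (A p z))\<^sup>2) \<partial>D) \<le> ennreal (V p)" for p
    proof -
      obtain p1 p2 where p: "p = (p1, p2)" by (cases p)
      have [measurable]: "(\<lambda>\<xi>. G p1 \<xi> - G p2 \<xi>) \<in> borel_measurable D" by measurable
      have "(\<integral>\<xi>. G p1 \<xi> - G p2 \<xi> \<partial>D) = df p1 - df p2"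
        by (simp add: G_integrable integral_G)
      with second_moment_centered_le[OF prob_D _ G_Lipschitz[of p1 p2]] show ?thesis
        by (simp add: p A_def V_def power_mult_distrib)
    qed
    show "(\<integral>z. A p z \<partial>D) = 0" for p
      by (simp add: A_def split_beta' G_integrable integral_G D.prob_space)
    show "V \<in> borel_measurable borel"
      unfolding V_def split_beta' by measurable
    show "cX (updX (k, t, i) w z) (k, t, i) = z" for i w z by (simp add: updX_def)
    show "i \<noteq> j \<Longrightarrow> cX (updX (k, t, i) w z) (k, t, j) = cX w (k, t, j)" for i j w z by (simp add: updX_def)
  qed (use R0 R b Rm S_pos in \<open>simp_all add: updX_ptI V_def split_beta'\<close>)
  then show ?thesis
    by (simp add: err_def eq V_def)
qed

end

section \<open>Error bounds along the run\<close>

text \<open>Formulated with two summands; where a single one is needed it is passed twice with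
  \<open>c = 0\<close>.\<close>

lemma nn_integral_affine_le:
  assumes M: "prob_space M"
    and [measurable]: "h1 \<in> borel_measurable M" "h2 \<in> borel_measurable M"
    and nn: "\<And>w. h1 w \<ge> 0" "\<And>w. h2 w \<ge> 0" "a \<ge> 0" "b \<ge> 0" "c \<ge> 0" "H1 \<ge> 0" "H2 \<ge> 0"
    and H: "(\<integral>\<^sup>+w. ennreal (h1 w) \<partial>M) \<le> ennreal H1" "(\<integral>\<^sup>+w. ennreal (h2 w) \<partial>M) \<le> ennreal H2"
  shows "(\<integral>\<^sup>+w. ennreal (a + b * h1 w + c * h2 w) \<partial>M) \<le> ennreal (a + b * H1 + c * H2)"
proof -
  interpret prob_space M by fact
  have "(\<integral>\<^sup>+w. ennreal (a + b * h1 w + c * h2 w) \<partial>M)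
      = (\<integral>\<^sup>+w. ennreal a + ennreal b * ennreal (h1 w) + ennreal c * ennreal (h2 w) \<partial>M)"
    using nn by (simp add: ennreal_plus ennreal_mult)
  also have "\<dots> = ennreal a + ennreal b * (\<integral>\<^sup>+w. ennreal (h1 w) \<partial>M) + ennreal c * (\<integral>\<^sup>+w. ennreal (h2 w) \<partial>M)"
    by (simp add: nn_integral_add nn_integral_cmult emeasure_space_1)
  also have "\<dots> \<le> ennreal a + ennreal b * ennreal H1 + ennreal c * ennreal H2"
    by (intro add_mono mult_left_mono H order_refl) auto
  also have "\<dots> = ennreal (a + b * H1 + c * H2)"
    using nn by (simp add: ennreal_plus ennreal_mult)
  finally show ?thesis .
qed

lemma sum_ennreal_div_card:
  assumes "finite A" "\<And>j. j \<in> A \<Longrightarrow> h j \<ge> 0" "A \<noteq> {}"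
  shows "(\<Sum>j\<in>A. ennreal (h j)) / of_nat (card A) = ennreal ((\<Sum>j\<in>A. h j) / real (card A))"
  using assms
  by (simp add: sum_ennreal ennreal_of_nat_eq_real_of_nat divide_ennreal sum_nonneg card_gt_0_iff)

context sreda
begin

definition "D2 = \<epsilon>\<^sup>2 / \<kappa>\<^sup>2"
definition "\<delta> k w = (norm (fy (pt k w)))\<^sup>2"
definition "pot k t w = \<Phi> (xnext k w) - f (ptI k t w)"
definition "gsq k t w = (norm (fy (ptI k t w)))\<^sup>2"
definition "asq k t w = (norm (snd (estI k t w)))\<^sup>2"
text \<open>The progress left after the variance is paid: \<open>3/5\<close> is the
  \<open>5/7\<close> of \<open>ascent_step\<close> minus the \<open>4/35\<close> of
  \<open>cc_absorb\<close>.\<close>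

definition "Z k t w = (\<Sum>j<t. lam / 2 * (gsq k j w + 3 / 5 * asq k j w))"

lemma D2_pos: "D2 > 0"
  using eps_pos kappa_ge_1 by (simp add: D2_def)

lemma lam_pos: "lam > 0"
  using L_pos by (simp add: lam_eq)

lemma L_lam: "L\<^sup>2 * lam\<^sup>2 = 4 / 49"
  using L_pos by (simp add: lam_eq power_divide power_mult_distrib)

lemma f_ptI_le [simp]: "f (ptI k t w) \<le> \<Phi> (xnext k w)"
  using f_le_Phi[of "xnext k w" "snd (ptI k t w)"] prod.collapse[of "ptI k t w"] by simp

lemma run_nonneg [simp]: "err p v \<ge> 0" "\<delta> k w \<ge> 0" "gsq k t w \<ge> 0" "asq k t w \<ge> 0" "pot k t w \<ge> 0" "Z k t w \<ge> 0"
  using lam_pos by (auto simp: err_def \<delta>_def gsq_def asq_def pot_def Z_def intro!: sum_nonneg)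

lemma err_measurable [measurable (raw)]:
  assumes [measurable]: "p \<in> borel_measurable M" "v \<in> borel_measurable M"
  shows "(\<lambda>w. err (p w) (v w)) \<in> borel_measurable M"
  unfolding err_def by measurable

lemma run_measurable [measurable]: "\<delta> k \<in> borel_measurable \<Omega>" "gsq k t \<in> borel_measurable \<Omega>"
  "asq k t \<in> borel_measurable \<Omega>" "pot k t \<in> borel_measurable \<Omega>" "Z k t \<in> borel_measurable \<Omega>"
proof -
  show [measurable]: "\<delta> k \<in> borel_measurable \<Omega>" "gsq k t \<in> borel_measurable \<Omega>"
    "asq k t \<in> borel_measurable \<Omega>" for t
    unfolding \<delta>_def[abs_def] gsq_def[abs_def] asq_def[abs_def] by measurable
  show "pot k t \<in> borel_measurable \<Omega>" "Z k t \<in> borel_measurable \<Omega>"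
    unfolding pot_def[abs_def] Z_def[abs_def] by measurable
qed

lemma S2_ge_42: "real S2 \<ge> 42"
proof -
  have "1 * 1 \<le> \<kappa> * real q"
    using kappa_ge_1 q_pos by (intro mult_mono) auto
  then show ?thesis using S2_ge by simp
qed

lemma kappa_div_S2: "\<kappa> / real S2 \<le> 1 / (42 * real q)"
  using S2_ge S_pos q_pos by (simp add: field_simps)

lemma err_checkpoint:
  assumes "k mod q = 0"
  shows "(\<integral>\<^sup>+w. ennreal (err (pt k w) (est k w)) \<partial>\<Omega>) \<le> ennreal (D2 / 24)"
proof -
  interpret D: prob_space D by (rule prob_D)
  interpret O: prob_space \<Omega> by (rule prob_Omega)
  have "(\<integral>\<^sup>+w. ennreal (0 + 1 * (norm (0 + avg S1 (\<lambda>i. G (pt k w) (cC w (k, i)) - df (pt k w))))\<^sup>2) \<partial>\<Omega>)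
    \<le> (\<integral>\<^sup>+w. ennreal (0 + 1 * ((norm (0 :: (real^'n) \<times> (real^'d)))\<^sup>2 + \<sigma>\<^sup>2 / real S1)) \<partial>\<Omega>)"
  proof (rule resample_avg_mean_zero[OF prob_D, where upd="\<lambda>i. updC (k, i)" and crd="\<lambda>i w. cC w (k, i)"
        and st="pt k" and e="\<lambda>_. 0" and A="\<lambda>p \<xi>. G p \<xi> - df p" and V="\<lambda>_. \<sigma>\<^sup>2"])
    show "resample \<Omega> D (updC (k, i))" for i by (rule resample_C)
    show "(\<lambda>(p, z). G p z - df p) \<in> borel_measurable (borel \<Otimes>\<^sub>M D)"
      unfolding split_beta' by measurable
    show "(\<integral>z. G p z - df p \<partial>D) = 0" for p
      by (simp add: G_integrable integral_G D.prob_space)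
    show "cC (updC (k, i) w z) (k, i) = z" for i w z by (simp add: updC_def)
    show "i \<noteq> j \<Longrightarrow> cC (updC (k, i) w z) (k, j) = cC w (k, j)" for i j w z by (simp add: updC_def)
  qed (use S_pos in \<open>simp_all add: updC_pt G_variance\<close>)
  then have "(\<integral>\<^sup>+w. ennreal (err (pt k w) (est k w)) \<partial>\<Omega>) \<le> ennreal (\<sigma>\<^sup>2 / real S1)"
    using S_pos by (simp add: err_def est_checkpoint[OF assms] avg_diff avg_const O.emeasure_space_1)
  also have "\<dots> \<le> ennreal (D2 / 24)"
    using S1_ge S_pos eps_pos kappa_ge_1 by (intro ennreal_leI) (simp add: D2_def field_simps)
  finally show ?thesis .
qed

lemma xstep_sq: "L\<^sup>2 * (norm (xnext k w - fst (pt k w)))\<^sup>2 \<le> D2 / 25"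
proof -
  have "norm (xnext k w - fst (pt k w)) \<le> \<epsilon> / (5 * \<kappa> * L)"
    using step_length[OF eps_pos \<eta>_def] by (simp add: xnext_def)
  then have "L * norm (xnext k w - fst (pt k w)) \<le> \<epsilon> / (5 * \<kappa>)"
    using L_pos kappa_ge_1 by (simp add: field_simps)
  then have "(L * norm (xnext k w - fst (pt k w)))\<^sup>2 \<le> (\<epsilon> / (5 * \<kappa>))\<^sup>2"
    using L_pos by (intro power_mono) auto
  then show ?thesis
    by (simp add: power_mult_distrib power_divide D2_def)
qed

lemma move_0: "(norm (ptI k 0 w - pt k w))\<^sup>2 = (norm (xnext k w - fst (pt k w)))\<^sup>2"
proof -
  have "ptI k 0 w - pt k w = (xnext k w - fst (pt k w), 0)"
    by (simp add: ptI_0 prod_eq_iff)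
  then show ?thesis by (simp add: norm_Pair_sq)
qed

lemma move_Suc: "L\<^sup>2 * (norm (ptI k (Suc t) w - ptI k t w))\<^sup>2 = 4 / 49 * asq k t w"
proof -
  have "ptI k (Suc t) w - ptI k t w = (0, lam *\<^sub>R snd (estI k t w))"
    by (simp add: ptI_Suc prod_eq_iff)
  then have "L\<^sup>2 * (norm (ptI k (Suc t) w - ptI k t w))\<^sup>2 = (L\<^sup>2 * lam\<^sup>2) * asq k t w"
    by (simp add: norm_Pair_sq asq_def power_mult_distrib)
  then show ?thesis by (simp add: L_lam)
qed

lemma pot_step:
  "pot k (Suc t) w + lam / 2 * (gsq k t w + 5 / 7 * asq k t w)
    \<le> pot k t w + lam / 2 * err (ptI k t w) (estI k t w)"
proof -
  have p: "ptI k t w = (xnext k w, snd (ptI k t w))" by (simp add: prod_eq_iff)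
  show ?thesis
    using ascent_step[OF lam_eq, of "xnext k w" "snd (ptI k t w)" "snd (estI k t w)" "fst (estI k t w)"]
    by (simp add: p[symmetric] pot_def gsq_def asq_def err_def ptI_Suc)
qed

text \<open>The step in \<open>x\<close> changes the partial gradient by at most \<open>L\<close>
  times its length, hence by at most \<open>\<epsilon>/(5\<kappa>)\<close>;
  \<open>Phi_gap_le\<close> at the new \<open>x\<close> turns the gradient into a gap.\<close>

lemma pot_0_le: "pot k 0 w \<le> D2 / (25 * \<mu>) + 1 / \<mu> * \<delta> k w"
proof -
  let ?a = "norm (fy (pt k w))" and ?b = "L * norm (xnext k w - fst (pt k w))"
  have "norm (fy (ptI k 0 w) - fy (pt k w)) \<le> norm (df (ptI k 0 w) - df (pt k w))"
    by (rule norm_snd_diff_le)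
  also have "\<dots> \<le> L * norm (ptI k 0 w - pt k w)" by (rule df_Lipschitz)
  also have "\<dots> = ?b"
    using move_0[of k w] by (simp add: power2_eq_iff_nonneg)
  finally have "norm (fy (ptI k 0 w)) \<le> ?a + ?b"
    using norm_triangle_sub[of "fy (ptI k 0 w)" "fy (pt k w)"] by linarith
  then have "gsq k 0 w \<le> (?a + ?b)\<^sup>2"
    unfolding gsq_def by (intro power_mono) auto
  also have "\<dots> \<le> 2 * ?a\<^sup>2 + 2 * ?b\<^sup>2"
    using sum_squares_bound[of ?a ?b] by (simp add: power2_sum)
  also have "\<dots> \<le> 2 * \<delta> k w + 2 * (D2 / 25)"
    using xstep_sq[of k w] by (simp add: \<delta>_def power_mult_distrib)
  finally have "gsq k 0 w / (2 * \<mu>) \<le> (2 * \<delta> k w + 2 * (D2 / 25)) / (2 * \<mu>)"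
    using mu_pos by (simp add: divide_right_mono)
  moreover have "pot k 0 w \<le> gsq k 0 w / (2 * \<mu>)"
    using Phi_gap_le[of "xnext k w" "snd (pt k w)"] by (simp add: pot_def gsq_def ptI_0)
  ultimately show ?thesis
    using mu_pos by (simp add: field_simps)
qed

definition "cc t = (real m + 2 - real t) * (lam / 2)"

lemma cc_le: "cc t \<le> 30 / (7 * \<mu>)"
proof -
  have "cc t \<le> (30 * \<kappa>) * (lam / 2)"
    unfolding cc_def using m_le lam_pos by (intro mult_right_mono) auto
  also have "\<dots> = 30 / (7 * \<mu>)"
    using L_pos mu_pos by (simp add: \<kappa>_def lam_eq)
  finally show ?thesis .
qed

text \<open>\<open>S2\<close> is at least \<open>42\<kappa>\<close> and \<open>m + 2\<close> at most
  \<open>30\<kappa>\<close>, so \<open>cc t \<le> S2 * lam / 2\<close>: in units of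
  \<open>lam / 2\<close>, all remaining uses of one step's variance together cost at most
  \<open>4/49 \<le> 4/35\<close> of its \<open>|u|^2\<close>.\<close>

lemma cc_absorb: "cc t * (4 / 49 * a / real S2) \<le> lam / 2 * (4 / 35 * a)" if "a \<ge> 0"
proof -
  have q1: "real q \<ge> 1" using q_pos by simp
  have "\<kappa> * 1 \<le> \<kappa> * real q" using q1 kappa_ge_1 by (intro mult_left_mono) auto
  then have "(real m + 2 - real t) \<le> real S2"
    using m_le S2_ge by linarith
  then have "cc t \<le> real S2 * (lam / 2)"
    unfolding cc_def using lam_pos by (intro mult_right_mono) auto
  then have "cc t * (4 / 49 * a / real S2) \<le> real S2 * (lam / 2) * (4 / 49 * a / real S2)"
    using that by (intro mult_right_mono) auto
  also have "\<dots> = lam / 2 * (4 / 49 * a)" using S_pos by simp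
  also have "\<dots> \<le> lam / 2 * (4 / 35 * a)" using lam_pos that by (intro mult_left_mono) auto
  finally show ?thesis .
qed

text \<open>The weight \<open>cc t\<close> pays for the remaining \<open>m + 2 - t\<close> uses of the estimation error, so the
  variance added in each step is absorbed by the step length term of \<open>pot_step\<close>.\<close>

lemma inner_Lyapunov:
  "t \<le> m + 2 \<Longrightarrow> (\<integral>\<^sup>+w. ennreal (pot k t w + Z k t w + cc t * err (ptI k t w) (estI k t w)) \<partial>\<Omega>)
    \<le> (\<integral>\<^sup>+w. ennreal (pot k 0 w + cc 0 * err (ptI k 0 w) (estI k 0 w)) \<partial>\<Omega>)"
proof (induction t)
  case 0
  then show ?case by (simp add: Z_def)
next
  case (Suc t)
  let ?e = "\<lambda>w. err (ptI k t w) (estI k t w)"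
  have c0: "cc (Suc t) \<ge> 0" using Suc.prems lam_pos by (simp add: cc_def)
  \<comment> \<open>\<open>Z k (Suc t)\<close> and \<open>pot k (Suc t)\<close> read only batches up
    to \<open>t\<close>, so they ride along as the bystander while batch \<open>Suc t\<close> is
    resampled.\<close>
  have Zinv: "Z k (Suc t) (updX (k, Suc t, i) w z) = Z k (Suc t) w" for i w z
    unfolding Z_def by (intro sum.cong refl) (simp add: gsq_def asq_def updX_ptI)
  have "(\<integral>\<^sup>+w. ennreal (pot k (Suc t) w + Z k (Suc t) w + cc (Suc t) * err (ptI k (Suc t) w) (estI k (Suc t) w)) \<partial>\<Omega>)
     \<le> (\<integral>\<^sup>+w. ennreal (pot k (Suc t) w + Z k (Suc t) w + cc (Suc t) * (err (ptP k (Suc t) w) (estP k (Suc t) w)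
          + L\<^sup>2 * (norm (ptI k (Suc t) w - ptP k (Suc t) w))\<^sup>2 / real S2)) \<partial>\<Omega>)"
  proof (rule est_fresh)
    show "pot k (Suc t) (updX (k, Suc t, i) w z) + Z k (Suc t) (updX (k, Suc t, i) w z) = pot k (Suc t) w + Z k (Suc t) w" for i w z
      by (simp add: Zinv pot_def updX_ptI)
  qed (use c0 in \<open>simp_all add: add_nonneg_nonneg\<close>)
  also have "\<dots> \<le> (\<integral>\<^sup>+w. ennreal (pot k t w + Z k t w + cc t * ?e w) \<partial>\<Omega>)"
  proof (intro nn_integral_mono ennreal_leI)
    fix w
    have Zs: "Z k (Suc t) w = Z k t w + lam / 2 * (gsq k t w + 3 / 5 * asq k t w)"
      by (simp add: Z_def)
    have "cc t = cc (Suc t) + lam / 2" by (simp add: cc_def field_simps)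
    then have cs: "cc t * ?e w = cc (Suc t) * ?e w + lam / 2 * ?e w"
      by (simp add: distrib_right)
    have "cc (Suc t) * (?e w + 4 / 49 * asq k t w / real S2) \<le> cc (Suc t) * ?e w + lam / 2 * (4 / 35 * asq k t w)"
      using cc_absorb[of "asq k t w" "Suc t"] by (simp add: distrib_left)
    then show "pot k (Suc t) w + Z k (Suc t) w + cc (Suc t) * (err (ptP k (Suc t) w) (estP k (Suc t) w)
          + L\<^sup>2 * (norm (ptI k (Suc t) w - ptP k (Suc t) w))\<^sup>2 / real S2) \<le> pot k t w + Z k t w + cc t * ?e w"
      using pot_step[of k t w] unfolding Zs cs ptP_simps estP_simps move_Suc
      by (simp add: algebra_simps)
  qed
  also have "\<dots> \<le> (\<integral>\<^sup>+w. ennreal (pot k 0 w + cc 0 * err (ptI k 0 w) (estI k 0 w)) \<partial>\<Omega>)"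
    using Suc by simp
  finally show ?case .
qed

text \<open>Inner index 0 is the only one at which \<open>x\<close> moves. Normalisation bounds this
  displacement at every sample point, so the added variance has a deterministic bound.\<close>

lemma err_inner_0:
  assumes "R \<in> borel_measurable \<Omega>" "\<And>i w z. R (updX (k, 0, i) w z) = R w" "\<And>w. R w \<ge> 0" "b \<ge> 0"
  shows "(\<integral>\<^sup>+w. ennreal (R w + b * err (ptI k 0 w) (estI k 0 w)) \<partial>\<Omega>)
    \<le> (\<integral>\<^sup>+w. ennreal (R w + b * (err (pt k w) (est k w) + D2 / (25 * real S2))) \<partial>\<Omega>)"
proof -
  have "L\<^sup>2 * (norm (ptI k 0 w - pt k w))\<^sup>2 / real S2 \<le> D2 / (25 * real S2)" for w
    using divide_right_mono[OF xstep_sq[of k w], of "real S2"] by (simp add: move_0)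
  then have "(\<integral>\<^sup>+w. ennreal (R w + b * (err (ptP k 0 w) (estP k 0 w) + L\<^sup>2 * (norm (ptI k 0 w - ptP k 0 w))\<^sup>2 / real S2)) \<partial>\<Omega>)
    \<le> (\<integral>\<^sup>+w. ennreal (R w + b * (err (pt k w) (est k w) + D2 / (25 * real S2))) \<partial>\<Omega>)"
    using assms(4) by (intro nn_integral_mono ennreal_leI add_left_mono mult_left_mono) simp_all
  with est_fresh[OF assms] show ?thesis by (rule order_trans)
qed

lemma E_Z:
  assumes d: "(\<integral>\<^sup>+w. ennreal (\<delta> k w) \<partial>\<Omega>) \<le> ennreal D2"
    and e: "(\<integral>\<^sup>+w. ennreal (err (pt k w) (est k w)) \<partial>\<Omega>) \<le> ennreal (D2 / 10)"
  shows "(\<integral>\<^sup>+w. ennreal (Z k (m + 2) w) \<partial>\<Omega>) \<le> ennreal (3 / 2 * (D2 / \<mu>))"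
proof -
  let ?c = "30 / (7 * \<mu>)"
  have c0: "cc 0 \<ge> 0" using lam_pos by (simp add: cc_def)
  \<comment> \<open>The weight \<open>cc\<close> vanishes at \<open>m + 2\<close>, so the final
    estimation error drops out.\<close>
  have "(\<integral>\<^sup>+w. ennreal (Z k (m + 2) w) \<partial>\<Omega>)
     \<le> (\<integral>\<^sup>+w. ennreal (pot k (m + 2) w + Z k (m + 2) w + cc (m + 2) * err (ptI k (m + 2) w) (estI k (m + 2) w)) \<partial>\<Omega>)"
    by (intro nn_integral_mono ennreal_leI) (simp add: cc_def)
  also have "\<dots> \<le> (\<integral>\<^sup>+w. ennreal (pot k 0 w + cc 0 * err (ptI k 0 w) (estI k 0 w)) \<partial>\<Omega>)"
    by (rule inner_Lyapunov) simp
  also have "\<dots> \<le> (\<integral>\<^sup>+w. ennreal (pot k 0 w + cc 0 * (err (pt k w) (est k w) + D2 / (25 * real S2))) \<partial>\<Omega>)"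
    by (rule err_inner_0) (use c0 in \<open>simp_all add: pot_def[of k 0 "updX _ _ _"] updX_ptI, simp_all add: pot_def\<close>)
  also have "\<dots> \<le> (\<integral>\<^sup>+w. ennreal ((D2 / (25 * \<mu>) + ?c * (D2 / (25 * 42))) + 1 / \<mu> * \<delta> k w + ?c * err (pt k w) (est k w)) \<partial>\<Omega>)"
  proof (intro nn_integral_mono ennreal_leI)
    fix w
    have "cc 0 * (err (pt k w) (est k w) + D2 / (25 * real S2)) \<le> ?c * (err (pt k w) (est k w) + D2 / (25 * 42))"
      using cc_le[of 0] c0 S2_ge_42 D2_pos S_pos mu_pos
      by (intro mult_mono add_left_mono divide_left_mono) auto
    then show "pot k 0 w + cc 0 * (err (pt k w) (est k w) + D2 / (25 * real S2))
       \<le> (D2 / (25 * \<mu>) + ?c * (D2 / (25 * 42))) + 1 / \<mu> * \<delta> k w + ?c * err (pt k w) (est k w)"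
      using pot_0_le[of k w] unfolding distrib_left by linarith
  qed
  also have "\<dots> \<le> ennreal ((D2 / (25 * \<mu>) + ?c * (D2 / (25 * 42))) + 1 / \<mu> * D2 + ?c * (D2 / 10))"
    by (rule nn_integral_affine_le[OF prob_Omega]) (use D2_pos mu_pos d e in \<open>simp_all add: add_nonneg_nonneg\<close>)
  \<comment> \<open>The four contributions, in units of \<open>D2 / \<mu>\<close>, are 1/25, 1/245,
    1 and 3/7, together about 1.473.\<close>
  also have "\<dots> \<le> ennreal (3 / 2 * (D2 / \<mu>))"
    using D2_pos mu_pos by (intro ennreal_leI) (simp add: field_simps)
  finally show ?thesis .
qed

lemma E_delta_Suc:
  assumes d: "(\<integral>\<^sup>+w. ennreal (\<delta> k w) \<partial>\<Omega>) \<le> ennreal D2"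
    and e: "(\<integral>\<^sup>+w. ennreal (err (pt k w) (est k w)) \<partial>\<Omega>) \<le> ennreal (D2 / 10)"
  shows "(\<integral>\<^sup>+w. ennreal (\<delta> (Suc k) w) \<partial>\<Omega>) \<le> ennreal D2"
proof -
  let ?b = "2 / (lam * (real m + 1))"
  have b: "?b \<ge> 0" using lam_pos by simp
  have "(\<integral>\<^sup>+w. ennreal (\<delta> (Suc k) w) \<partial>\<Omega>) = (\<integral>\<^sup>+w. ennreal (gsq k (Suc (cS w k)) w) \<partial>\<Omega>)"
    by (simp add: \<delta>_def gsq_def pt_Suc)
  also have "\<dots> = (\<integral>\<^sup>+w. (\<Sum>j\<in>{0..m}. ennreal (gsq k (Suc j) w)) / of_nat (card {0..m}) \<partial>\<Omega>)"
    by (rule resample_nn_integral_pmf[OF resample_S[of k], where c="\<lambda>w. cS w k" and h="\<lambda>j w. ennreal (gsq k (Suc j) w)"])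
       (simp_all add: gsq_def updS_ptI, simp_all add: updS_def)
  also have "\<dots> = (\<integral>\<^sup>+w. ennreal ((\<Sum>j\<in>{0..m}. gsq k (Suc j) w) / real (card {0..m})) \<partial>\<Omega>)"
    by (subst sum_ennreal_div_card) auto
  also have "\<dots> \<le> (\<integral>\<^sup>+w. ennreal (0 + ?b * Z k (m + 2) w + 0 * Z k (m + 2) w) \<partial>\<Omega>)"
  proof (intro nn_integral_mono ennreal_leI)
    fix w
    \<comment> \<open>The possible stopping indices 1 to \<open>m + 1\<close> all lie among the
      \<open>m + 2\<close> terms of \<open>Z\<close>.\<close>
    have "(\<Sum>j\<in>{0..m}. gsq k (Suc j) w) = (\<Sum>j\<in>{1..m+1}. gsq k j w)"
      by (rule sum.reindex_bij_witness[of _ "\<lambda>j. j - 1" Suc]) auto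
    also have "\<dots> \<le> (\<Sum>j<m + 2. gsq k j w)"
      by (rule sum_mono2) auto
    also have "\<dots> \<le> (\<Sum>j<m + 2. 2 / lam * (lam / 2 * (gsq k j w + 3 / 5 * asq k j w)))"
      using lam_pos by (intro sum_mono) simp
    also have "\<dots> = 2 / lam * Z k (m + 2) w"
      by (simp only: Z_def sum_distrib_left)
    finally have "(\<Sum>j\<in>{0..m}. gsq k (Suc j) w) / (real m + 1) \<le> (2 / lam * Z k (m + 2) w) / (real m + 1)"
      by (intro divide_right_mono) auto
    then show "(\<Sum>j\<in>{0..m}. gsq k (Suc j) w) / real (card {0..m}) \<le> 0 + ?b * Z k (m + 2) w + 0 * Z k (m + 2) w"
      by (simp add: add.commute)
  qed
  also have "\<dots> \<le> ennreal (0 + ?b * (3 / 2 * (D2 / \<mu>)) + 0 * (3 / 2 * (D2 / \<mu>)))"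
    by (rule nn_integral_affine_le[OF prob_Omega _ _ _ _ _ b _ _ _ E_Z[OF d e] E_Z[OF d e]]) (use D2_pos mu_pos in simp_all)
  also have "\<dots> \<le> ennreal D2"
  proof (rule ennreal_leI)
    \<comment> \<open>From \<open>2 / lam = 7L\<close>; with \<open>m + 1 \<ge> 28\<kappa>\<close>
      the factor is at most 3/8, below the 1 that the induction requires.\<close>
    have "?b * (3 / 2 * (D2 / \<mu>)) = 21 / 2 * \<kappa> / (real m + 1) * D2"
      using L_pos mu_pos by (simp add: lam_eq \<kappa>_def field_simps)
    also have "\<dots> \<le> 1 * D2"
    proof (rule mult_right_mono)
      show "21 / 2 * \<kappa> / (real m + 1) \<le> 1"
        using m_ge kappa_ge_1 by (simp add: divide_le_eq)
    qed (use D2_pos in simp)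
    finally show "0 + ?b * (3 / 2 * (D2 / \<mu>)) + 0 * (3 / 2 * (D2 / \<mu>)) \<le> D2" by simp
  qed
  finally show ?thesis .
qed

text \<open>The increments are kept as random variables, because it is their sum over the loop that
  \<open>Z\<close> controls.\<close>

lemma E_err_inner_le:
  "(\<integral>\<^sup>+w. ennreal (err (ptI k t w) (estI k t w)) \<partial>\<Omega>)
    \<le> (\<integral>\<^sup>+w. ennreal (err (pt k w) (est k w) + D2 / (25 * real S2) + (\<Sum>j<t. 4 / (49 * real S2) * asq k j w)) \<partial>\<Omega>)"
proof (induction t)
  case 0
  then show ?case using err_inner_0[of "\<lambda>_. 0" k 1] by simp
next
  case (Suc t)
  let ?a = "\<lambda>j w. 4 / (49 * real S2) * asq k j w"
  let ?h = "\<lambda>w. err (pt k w) (est k w) + D2 / (25 * real S2) + (\<Sum>j<t. ?a j w)"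
  have h0: "?h w \<ge> 0" for w
    using D2_pos by (intro add_nonneg_nonneg sum_nonneg) auto
  have "(\<integral>\<^sup>+w. ennreal (err (ptI k (Suc t) w) (estI k (Suc t) w)) \<partial>\<Omega>)
     \<le> (\<integral>\<^sup>+w. ennreal (err (ptI k t w) (estI k t w) + ?a t w) \<partial>\<Omega>)"
    using est_fresh[of "\<lambda>_. 0" k "Suc t" 1] by (simp add: move_Suc)
  also have "\<dots> = (\<integral>\<^sup>+w. ennreal (err (ptI k t w) (estI k t w)) \<partial>\<Omega>) + (\<integral>\<^sup>+w. ennreal (?a t w) \<partial>\<Omega>)"
    by (simp add: ennreal_plus nn_integral_add)
  also have "\<dots> \<le> (\<integral>\<^sup>+w. ennreal (?h w) \<partial>\<Omega>) + (\<integral>\<^sup>+w. ennreal (?a t w) \<partial>\<Omega>)"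
    by (rule add_right_mono[OF Suc.IH])
  also have "\<dots> = (\<integral>\<^sup>+w. ennreal (?h w) + ennreal (?a t w) \<partial>\<Omega>)"
    by (rule nn_integral_add[symmetric]) measurable
  also have "\<dots> = (\<integral>\<^sup>+w. ennreal (?h w + ?a t w) \<partial>\<Omega>)"
    using h0 by (intro nn_integral_cong ennreal_plus[symmetric]) auto
  finally show ?case by (simp add: add.assoc)
qed

lemma E_err_inner:
  assumes d: "(\<integral>\<^sup>+w. ennreal (\<delta> k w) \<partial>\<Omega>) \<le> ennreal D2"
    and e: "(\<integral>\<^sup>+w. ennreal (err (pt k w) (est k w)) \<partial>\<Omega>) \<le> ennreal (e * D2)" "0 \<le> e" "e \<le> 1 / 10"
    and t: "t \<le> m + 2"
  shows "(\<integral>\<^sup>+w. ennreal (err (ptI k t w) (estI k t w)) \<partial>\<Omega>) \<le> ennreal ((e + 1 / (20 * real q)) * D2)"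
proof -
  \<comment> \<open>Chosen so that \<open>?b\<close> times \<open>(lam / 2)(3 / 5)\<close> is
    \<open>4 / (49 S2)\<close>, the variance weight of \<open>asq\<close>.\<close>
  let ?b = "40 / (147 * real S2 * lam)"
  have b: "?b \<ge> 0" using lam_pos by simp
  have e': "(\<integral>\<^sup>+w. ennreal (err (pt k w) (est k w)) \<partial>\<Omega>) \<le> ennreal (D2 / 10)"
    using e D2_pos by (intro order_trans[OF e(1)] ennreal_leI) auto
  have "(\<integral>\<^sup>+w. ennreal (err (ptI k t w) (estI k t w)) \<partial>\<Omega>)
    \<le> (\<integral>\<^sup>+w. ennreal (D2 / (25 * real S2) + 1 * err (pt k w) (est k w) + ?b * Z k (m + 2) w) \<partial>\<Omega>)"
  proof (rule order_trans[OF E_err_inner_le], intro nn_integral_mono ennreal_leI)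
    fix w
    have "(\<Sum>j<t. 4 / (49 * real S2) * asq k j w) \<le> (\<Sum>j<m + 2. 4 / (49 * real S2) * asq k j w)"
      using t by (intro sum_mono2) auto
    also have "\<dots> \<le> (\<Sum>j<m + 2. ?b * (lam / 2 * (gsq k j w + 3 / 5 * asq k j w)))"
      using lam_pos S_pos by (intro sum_mono) (simp add: field_simps)
    also have "\<dots> = ?b * Z k (m + 2) w"
      by (simp only: Z_def sum_distrib_left)
    finally show "err (pt k w) (est k w) + D2 / (25 * real S2) + (\<Sum>j<t. 4 / (49 * real S2) * asq k j w)
       \<le> D2 / (25 * real S2) + 1 * err (pt k w) (est k w) + ?b * Z k (m + 2) w" by simp
  qed
  also have "\<dots> \<le> ennreal (D2 / (25 * real S2) + 1 * (e * D2) + ?b * (3 / 2 * (D2 / \<mu>)))"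
    by (rule nn_integral_affine_le[OF prob_Omega _ _ _ _ _ _ b _ _ e(1) E_Z[OF d e']]) (use D2_pos mu_pos e in simp_all)
  also have "\<dots> \<le> ennreal ((e + 1 / (20 * real q)) * D2)"
  proof (rule ennreal_leI)
    have "?b * (3 / 2 * (D2 / \<mu>)) = 10 / 7 * (\<kappa> / real S2) * D2"
      using L_pos mu_pos S_pos by (simp add: lam_eq \<kappa>_def)
    \<comment> \<open>With \<open>\<kappa> / S2 \<le> 1 / (42q)\<close> the left side is at most
      \<open>(1/25 + 10/7) / (42q)\<close>, about \<open>0.035 / q\<close>.\<close>
    moreover have "1 / (25 * real S2) + 10 / 7 * (\<kappa> / real S2) \<le> 1 / (20 * real q)"
    proof -
      have "1 / real S2 \<le> \<kappa> / real S2"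
        using kappa_ge_1 by (intro divide_right_mono) auto
      moreover have "\<kappa> / real S2 \<le> 1 / 42 * (1 / real q)" using kappa_div_S2 by simp
      moreover have "1 / (25 * real S2) = 1 / 25 * (1 / real S2)" "1 / (20 * real q) = 1 / 20 * (1 / real q)"
        "1 / real q > 0" using q_pos by simp_all
      ultimately show ?thesis by linarith
    qed
    then have "(1 / (25 * real S2) + 10 / 7 * (\<kappa> / real S2)) * D2 \<le> 1 / (20 * real q) * D2"
      using D2_pos by (intro mult_right_mono) auto
    ultimately show "D2 / (25 * real S2) + 1 * (e * D2) + ?b * (3 / 2 * (D2 / \<mu>)) \<le> (e + 1 / (20 * real q)) * D2"
      by (simp add: algebra_simps)
  qed
  finally show ?thesis .
qed

text \<open>Unlike the gradient bound, \<open>E_err_inner\<close> holds at every inner index, so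
  averaging over \<open>s_k\<close> loses nothing.\<close>

lemma E_err_Suc:
  assumes d: "(\<integral>\<^sup>+w. ennreal (\<delta> k w) \<partial>\<Omega>) \<le> ennreal D2"
    and e: "(\<integral>\<^sup>+w. ennreal (err (pt k w) (est k w)) \<partial>\<Omega>) \<le> ennreal (e * D2)" "0 \<le> e" "e \<le> 1 / 10"
    and k: "Suc k mod q \<noteq> 0"
  shows "(\<integral>\<^sup>+w. ennreal (err (pt (Suc k) w) (est (Suc k) w)) \<partial>\<Omega>) \<le> ennreal ((e + 1 / (20 * real q)) * D2)"
proof -
  let ?B = "(e + 1 / (20 * real q)) * D2"
  have "(\<integral>\<^sup>+w. ennreal (err (pt (Suc k) w) (est (Suc k) w)) \<partial>\<Omega>)
     = (\<integral>\<^sup>+w. ennreal (err (ptI k (Suc (cS w k)) w) (estI k (Suc (cS w k)) w)) \<partial>\<Omega>)"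
    using k by (simp add: pt_Suc est_Suc)
  also have "\<dots> = (\<integral>\<^sup>+w. (\<Sum>j\<in>{0..m}. ennreal (err (ptI k (Suc j) w) (estI k (Suc j) w))) / of_nat (card {0..m}) \<partial>\<Omega>)"
    by (rule resample_nn_integral_pmf[OF resample_S[of k], where c="\<lambda>w. cS w k" and
          h="\<lambda>j w. ennreal (err (ptI k (Suc j) w) (estI k (Suc j) w))"])
       (simp_all add: updS_ptI, simp_all add: updS_def)
  also have "\<dots> = (\<Sum>j\<in>{0..m}. \<integral>\<^sup>+w. ennreal (err (ptI k (Suc j) w) (estI k (Suc j) w)) \<partial>\<Omega>) / of_nat (card {0..m})"
    by (simp add: nn_integral_divide nn_integral_sum del: sum_ennreal)
  also have "\<dots> \<le> (\<Sum>j\<in>{0..m}. ennreal ?B) / of_nat (card {0..m})"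
    by (intro divide_right_mono_ennreal sum_mono E_err_inner d e) auto
  also have "\<dots> = ennreal ?B"
    using e D2_pos by (subst sum_ennreal_div_card) auto
  finally show ?thesis .
qed

lemma E_delta_0: "(\<integral>\<^sup>+w. ennreal (\<delta> 0 w) \<partial>\<Omega>) \<le> ennreal D2"
proof -
  interpret M: prob_space "M_C \<Otimes>\<^sub>M (M_X \<Otimes>\<^sub>M (M_S \<Otimes>\<^sub>M M_J))" by (rule prob_CXSJ)
  have m: "(\<lambda>w. ennreal ((norm (fy (x0, w)))\<^sup>2)) \<in> borel_measurable \<nu>"
    unfolding measurable_cong_sets[OF sets_nu refl] by measurable
  have "(\<integral>\<^sup>+w. ennreal (\<delta> 0 w) \<partial>\<Omega>) = (\<integral>\<^sup>+y. ennreal ((norm (fy (x0, y)))\<^sup>2) \<partial>\<nu>)"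
    unfolding \<Omega>_def \<delta>_def pt_0
    by (subst M.nn_integral_fst[symmetric]) (use m in \<open>simp_all add: M.emeasure_space_1\<close>)
  then show ?thesis using init by (simp add: D2_def)
qed

lemma mod_ratio_le: "1 / 24 + real (k mod q) / (20 * real q) \<le> 1 / 10"
proof -
  have "real (k mod q) \<le> real q" using q_pos by (simp add: less_imp_le)
  from divide_right_mono[OF this, of "20 * real q"]
  have "real (k mod q) / (20 * real q) \<le> 1 / 20" using q_pos by simp
  then show ?thesis by linarith
qed

text \<open>Neither bound propagates alone: \<open>E_Z\<close>, on which both successor lemmas rest,
  needs the two together. \<open>k mod q\<close> counts the increments since the last checkpoint,
  where the error is reset.\<close>

lemma invariant:
  "(\<integral>\<^sup>+w. ennreal (\<delta> k w) \<partial>\<Omega>) \<le> ennreal D2 \<and>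
   (\<integral>\<^sup>+w. ennreal (err (pt k w) (est k w)) \<partial>\<Omega>) \<le> ennreal ((1 / 24 + real (k mod q) / (20 * real q)) * D2)"
proof (induction k)
  case 0
  then show ?case using E_delta_0 err_checkpoint[of 0] by simp
next
  case (Suc k)
  let ?e = "1 / 24 + real (k mod q) / (20 * real q)"
  have e: "0 \<le> ?e" "?e \<le> 1 / 10"
    using mod_ratio_le by simp_all
  have e': "(\<integral>\<^sup>+w. ennreal (err (pt k w) (est k w)) \<partial>\<Omega>) \<le> ennreal (D2 / 10)"
    using Suc.IH e D2_pos mult_right_mono[OF e(2), of D2]
    by (intro order_trans[OF Suc.IH[THEN conjunct2]] ennreal_leI) auto
  have d: "(\<integral>\<^sup>+w. ennreal (\<delta> (Suc k) w) \<partial>\<Omega>) \<le> ennreal D2"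
    using E_delta_Suc Suc.IH e' by blast
  show ?case
  proof (cases "Suc k mod q = 0")
    case True
    then show ?thesis using d err_checkpoint[OF True] by simp
  next
    case False
    then have "real (Suc k mod q) = real (k mod q) + 1"
      by (simp add: mod_Suc split: if_splits)
    then have "?e + 1 / (20 * real q) = 1 / 24 + real (Suc k mod q) / (20 * real q)"
      by (simp add: add_divide_distrib)
    with E_err_Suc[OF _ _ e False] Suc.IH d show ?thesis by auto
  qed
qed

lemma E_err: "(\<integral>\<^sup>+w. ennreal (err (pt k w) (est k w)) \<partial>\<Omega>) \<le> ennreal (D2 / 10)"
  using mult_right_mono[OF mod_ratio_le, of D2 k] D2_pos
  by (intro order_trans[OF invariant[THEN conjunct2]] ennreal_leI) auto

section \<open>From the error bounds to stationarity\<close>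

definition "\<rho> k w = 2 * err (pt k w) (est k w) + 2 * \<kappa>\<^sup>2 * \<delta> k w"

lemma rho_nonneg: "\<rho> k w \<ge> 0"
  by (simp add: \<rho>_def)

lemma E_rho: "(\<integral>\<^sup>+w. ennreal (\<rho> k w) \<partial>\<Omega>) \<le> ennreal (11 / 5 * \<epsilon>\<^sup>2)"
proof -
  have "(\<integral>\<^sup>+w. ennreal (0 + 2 * err (pt k w) (est k w) + 2 * \<kappa>\<^sup>2 * \<delta> k w) \<partial>\<Omega>)
     \<le> ennreal (0 + 2 * (D2 / 10) + 2 * \<kappa>\<^sup>2 * D2)"
    by (rule nn_integral_affine_le[OF prob_Omega _ _ _ _ _ _ _ _ _ E_err invariant[THEN conjunct1]])
       (use D2_pos in simp_all)
  also have "\<dots> \<le> ennreal (11 / 5 * \<epsilon>\<^sup>2)"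
  proof (rule ennreal_leI)
    \<comment> \<open>\<open>D2 \<le> \<epsilon>^2\<close> because \<open>\<kappa> \<ge> 1\<close>,
      so the total is \<open>(1/5 + 2) \<epsilon>^2\<close>.\<close>
    have "D2 * 1 \<le> D2 * \<kappa>\<^sup>2"
      using D2_pos kappa_ge_1 by (intro mult_left_mono one_le_power) auto
    moreover have "\<kappa>\<^sup>2 * D2 = \<epsilon>\<^sup>2" using kappa_ge_1 by (simp add: D2_def)
    ultimately show "0 + 2 * (D2 / 10) + 2 * \<kappa>\<^sup>2 * D2 \<le> 11 / 5 * \<epsilon>\<^sup>2"
      by (simp add: mult.commute)
  qed
  finally show ?thesis by (simp add: \<rho>_def)
qed

lemma rho_bound: "(norm (dPhi (fst (pt k w)) - fst (est k w)))\<^sup>2 \<le> \<rho> k w"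
  using dPhi_error[of "fst (pt k w)" "fst (est k w)" "snd (est k w)" "snd (pt k w)"]
  by (simp add: \<rho>_def err_def \<delta>_def)

text \<open>A pointwise majorant of the gradient norm, affine in \<open>\<eta> |v|^2\<close> and
  \<rho>: the first telescopes, the second has a bounded mean. The constant 3/2 is the 1/2 of
  \<open>norm_le_eta\<close> plus 1 from
  \<open>r \<le> \<epsilon> + r^2 / (4\<epsilon>)\<close>.\<close>

definition "bnd k w = 3 / 2 * \<epsilon> + 5 * \<kappa> * L / \<epsilon> * (\<eta> k w * (norm (fst (est k w)))\<^sup>2) + \<rho> k w / (4 * \<epsilon>)"

lemma bnd_measurable [measurable]: "bnd k \<in> borel_measurable \<Omega>"
  unfolding bnd_def[abs_def] \<rho>_def[abs_def] by measurable

lemma bnd_nonneg: "bnd k w \<ge> 0"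
  using eps_pos kappa_ge_1 L_pos eta_nonneg[OF eps_pos \<eta>_def, of k w] rho_nonneg[of k w]
  by (simp add: bnd_def add_nonneg_nonneg)

lemma norm_grad_le: "norm (grad \<Phi> (fst (pt k w))) \<le> bnd k w"
proof -
  let ?r = "norm (dPhi (fst (pt k w)) - fst (est k w))"
  have "0 \<le> (?r - 2 * \<epsilon>)\<^sup>2" by simp
  then have "4 * \<epsilon> * ?r \<le> ?r\<^sup>2 + 4 * \<epsilon>\<^sup>2"
    by (simp add: power2_diff power_mult_distrib algebra_simps)
  then have "?r \<le> \<epsilon> + ?r\<^sup>2 / (4 * \<epsilon>)"
    using eps_pos by (simp add: field_simps power2_eq_square)
  also have "\<dots> \<le> \<epsilon> + \<rho> k w / (4 * \<epsilon>)"
    using eps_pos rho_bound[of k w] by (intro add_left_mono divide_right_mono) auto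
  finally have "?r \<le> \<epsilon> + \<rho> k w / (4 * \<epsilon>)" .
  moreover have "norm (dPhi (fst (pt k w))) \<le> ?r + norm (fst (est k w))"
    using norm_triangle_sub[of "dPhi (fst (pt k w))" "fst (est k w)"] by simp
  ultimately show ?thesis
    using norm_le_eta[OF eps_pos \<eta>_def, of k w] by (simp add: bnd_def grad_Phi)
qed

text \<open>Kept at each sample point, so that \<Phi> along the run is never integrated.\<close>

lemma telescope:
  "\<Phi> (fst (pt n w)) + 2 / 5 * (\<Sum>k<n. \<eta> k w * (norm (fst (est k w)))\<^sup>2)
    \<le> \<Phi> x0 + (\<Sum>k<n. \<rho> k w) / (20 * \<kappa> * L)"
proof (induction n)
  case 0
  then show ?case by (simp add: pt_0)
next
  case (Suc n)
  have "\<Phi> (fst (pt (Suc n) w)) + 2 / 5 * (\<eta> n w * (norm (fst (est n w)))\<^sup>2)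
      \<le> \<Phi> (fst (pt n w)) + (norm (dPhi (fst (pt n w)) - fst (est n w)))\<^sup>2 / (20 * \<kappa> * L)"
    using Phi_descent[OF eps_pos \<eta>_def] by (simp add: pt_Suc xnext_def)
  also have "\<dots> \<le> \<Phi> (fst (pt n w)) + \<rho> n w / (20 * \<kappa> * L)"
    using rho_bound[of n w] kappa_ge_1 L_pos by (intro add_left_mono divide_right_mono) auto
  finally show ?case
    using Suc by (simp add: add_divide_distrib distrib_left)
qed

lemma sum_bnd_le:
  "(\<Sum>k<n. bnd k w) \<le> 3 / 2 * real n * \<epsilon> + 25 / 2 * (\<kappa> * L * (\<Phi> x0 - Phi_star F D)) / \<epsilon>
     + 7 / 8 * (\<Sum>k<n. \<rho> k w) / \<epsilon>"
proof -
  let ?E = "\<Sum>k<n. \<eta> k w * (norm (fst (est k w)))\<^sup>2" and ?R = "\<Sum>k<n. \<rho> k w"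
  have kL: "\<kappa> * L > 0" using kappa_ge_1 L_pos by simp
  have "2 / 5 * ?E \<le> (\<Phi> x0 - Phi_star F D) + ?R / (20 * \<kappa> * L)"
    using telescope[where n=n and w=w] Phi_star_le[of "fst (pt n w)"] by linarith
  \<comment> \<open>The factor turns 2/5 into the weight \<open>5\<kappa>L/\<epsilon>\<close> of
    \<open>bnd\<close>; \<rho> receives 5/8 from it, and \<open>5/8 + 1/4 = 7/8\<close>.\<close>
  then have A: "25 / 2 * (\<kappa> * L) / \<epsilon> * (2 / 5 * ?E) \<le> 25 / 2 * (\<kappa> * L) / \<epsilon> * ((\<Phi> x0 - Phi_star F D) + ?R / (20 * \<kappa> * L))"
    using kL eps_pos by (intro mult_left_mono) auto
  have B: "25 / 2 * (\<kappa> * L) / \<epsilon> * (?R / (20 * \<kappa> * L)) = 5 / 8 * ?R / \<epsilon>"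
    using kappa_ge_1 L_pos eps_pos by (simp add: field_simps)
  have C: "25 / 2 * (\<kappa> * L) / \<epsilon> * (2 / 5 * ?E) = 5 * \<kappa> * L / \<epsilon> * ?E"
    "25 / 2 * (\<kappa> * L) / \<epsilon> * (\<Phi> x0 - Phi_star F D) = 25 / 2 * (\<kappa> * L * (\<Phi> x0 - Phi_star F D)) / \<epsilon>"
    by simp_all
  have E: "5 * \<kappa> * L / \<epsilon> * ?E \<le> 25 / 2 * (\<kappa> * L * (\<Phi> x0 - Phi_star F D)) / \<epsilon> + 5 / 8 * ?R / \<epsilon>"
    using A by (simp only: distrib_left B C)
  have "(\<Sum>k<n. bnd k w) = real n * (3 / 2 * \<epsilon>) + 5 * \<kappa> * L / \<epsilon> * ?E + ?R / (4 * \<epsilon>)"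
    by (simp add: bnd_def sum.distrib sum_distrib_left sum_divide_distrib)
  then show ?thesis using E by (simp add: algebra_simps)
qed

theorem expected_gradient_bound:
  assumes gap: "100 * \<kappa> * L * (\<Phi> x0 - Phi_star F D) / (9 * \<epsilon>\<^sup>2) \<le> real (Suc (K - 1))"
  shows "(\<integral>\<^sup>+w. ennreal (norm (grad \<Phi> (fst (pt (cJ w) w)))) \<partial>\<Omega>) \<le> ennreal (1073 / 108 * \<epsilon>)"
proof -
  \<comment> \<open>\<open>N\<close> is \<open>K\<close> unless \<open>K = 0\<close>; then
    \<open>{0..K - 1}\<close> is still \<open>{0}\<close> and the output is
    \<open>x0\<close>.\<close>
  define N where "N = Suc (K - 1)"
  have N: "{0..K - 1} = {..<N}" "N > 0" by (auto simp: N_def)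
  let ?R = "\<lambda>w. (\<Sum>k<N. \<rho> k w)"
  let ?c = "7 / (8 * \<epsilon> * real N)"
  have rm [measurable]: "\<rho> k \<in> borel_measurable \<Omega>" for k
    unfolding \<rho>_def[abs_def] by measurable
  have ER: "(\<integral>\<^sup>+w. ennreal (?R w) \<partial>\<Omega>) \<le> ennreal (real N * (11 / 5 * \<epsilon>\<^sup>2))"
  proof -
    have "(\<integral>\<^sup>+w. ennreal (?R w) \<partial>\<Omega>) = (\<integral>\<^sup>+w. (\<Sum>k<N. ennreal (\<rho> k w)) \<partial>\<Omega>)"
      by (intro nn_integral_cong sum_ennreal[symmetric] rho_nonneg)
    also have "\<dots> = (\<Sum>k<N. \<integral>\<^sup>+w. ennreal (\<rho> k w) \<partial>\<Omega>)"
      by (rule nn_integral_sum) measurable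
    also have "\<dots> \<le> (\<Sum>k<N. ennreal (11 / 5 * \<epsilon>\<^sup>2))"
      by (intro sum_mono E_rho)
    also have "\<dots> = ennreal (real N * (11 / 5 * \<epsilon>\<^sup>2))"
      by (subst sum_ennreal) auto
    finally show ?thesis .
  qed
  have "(\<integral>\<^sup>+w. ennreal (norm (grad \<Phi> (fst (pt (cJ w) w)))) \<partial>\<Omega>) \<le> (\<integral>\<^sup>+w. ennreal (bnd (cJ w) w) \<partial>\<Omega>)"
    by (intro nn_integral_mono ennreal_leI norm_grad_le)
  also have "\<dots> = (\<integral>\<^sup>+w. (\<Sum>j\<in>{0..K - 1}. ennreal (bnd j w)) / of_nat (card {0..K - 1}) \<partial>\<Omega>)"
    by (rule resample_nn_integral_pmf[OF resample_J, where c="\<lambda>w. cJ w" and h="\<lambda>j w. ennreal (bnd j w)"])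
       (simp_all add: bnd_def \<rho>_def \<delta>_def \<eta>_def updJ_pt, simp_all add: updJ_def)
  also have "\<dots> = (\<integral>\<^sup>+w. ennreal ((\<Sum>j<N. bnd j w) / real N) \<partial>\<Omega>)"
  proof -
    have "(\<Sum>j\<in>{0..K - 1}. ennreal (bnd j w)) / of_nat (card {0..K - 1}) = ennreal ((\<Sum>j<N. bnd j w) / real N)" for w
      unfolding N(1) using N(2) by (subst sum_ennreal_div_card) (auto simp: bnd_nonneg)
    then show ?thesis by (intro nn_integral_cong)
  qed
  also have "\<dots> \<le> (\<integral>\<^sup>+w. ennreal (21 / 8 * \<epsilon> + ?c * ?R w + 0 * ?R w) \<partial>\<Omega>)"
  proof (intro nn_integral_mono ennreal_leI)
    fix w
    have "\<kappa> * L * (\<Phi> x0 - Phi_star F D) \<le> 9 * \<epsilon>\<^sup>2 / 100 * real N"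
      using gap eps_pos by (simp add: field_simps N_def)
    then have "25 / 2 * (\<kappa> * L * (\<Phi> x0 - Phi_star F D)) / \<epsilon> \<le> 25 / 2 * (9 * \<epsilon>\<^sup>2 / 100 * real N) / \<epsilon>"
      using eps_pos by (intro divide_right_mono mult_left_mono) auto
    also have "\<dots> = 9 / 8 * real N * \<epsilon>"
      using eps_pos by (simp add: power2_eq_square)
    finally have "(\<Sum>j<N. bnd j w) \<le> 21 / 8 * (real N * \<epsilon>) + 7 / 8 * ?R w / \<epsilon>"
      using sum_bnd_le[of w N] by linarith
    then have "(\<Sum>j<N. bnd j w) / real N \<le> (21 / 8 * (real N * \<epsilon>) + 7 / 8 * ?R w / \<epsilon>) / real N"
      by (rule divide_right_mono) simp
    then show "(\<Sum>j<N. bnd j w) / real N \<le> 21 / 8 * \<epsilon> + ?c * ?R w + 0 * ?R w"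
      using N(2) eps_pos by (simp add: add_divide_distrib mult.commute mult.left_commute)
  qed
  also have "\<dots> \<le> ennreal (21 / 8 * \<epsilon> + ?c * (real N * (11 / 5 * \<epsilon>\<^sup>2)) + 0 * (real N * (11 / 5 * \<epsilon>\<^sup>2)))"
    by (rule nn_integral_affine_le[OF prob_Omega _ _ _ _ _ _ _ _ _ ER ER])
       (use eps_pos in \<open>simp_all add: rho_nonneg sum_nonneg\<close>)
  also have "\<dots> \<le> ennreal (1073 / 108 * \<epsilon>)"
  proof (rule ennreal_leI)
    \<comment> \<open>\<open>77/40\<close> is \<open>7/8\<close> times \<open>11/5\<close>. Of the
      21/8, 3/2 comes from \<open>bnd\<close> and 9/8 from the initial gap through the size of
      \<open>K\<close>. The sum is 4.55, below 1073/108, which is about 9.94.\<close>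
    have c: "?c * (real N * (11 / 5 * \<epsilon>\<^sup>2)) = 77 / 40 * \<epsilon>"
      using N(2) eps_pos by (simp add: field_simps power2_eq_square)
    show "21 / 8 * \<epsilon> + ?c * (real N * (11 / 5 * \<epsilon>\<^sup>2)) + 0 * (real N * (11 / 5 * \<epsilon>\<^sup>2)) \<le> 1073 / 108 * \<epsilon>"
      unfolding c using eps_pos by simp
  qed
  finally show ?thesis .
qed

end

section \<open>The complexity bound\<close>

context sreda
begin

text \<open>The number of iterations is set by the mean of \<open>f(x0, y0)\<close>, the descent
  starts from \<open>\<Phi> x0\<close>. As a nonintegrable function would have Bochner integral 0,
  integrability of the gap comes first, from its finite nonnegative integral.\<close>

lemma init_gap: "\<Phi> x0 - \<epsilon>\<^sup>2 / \<kappa>\<^sup>2 / (2 * \<mu>) \<le> (\<integral>y. fexp F D x0 y \<partial>\<nu>)"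
proof -
  interpret N: prob_space \<nu> by (rule prob_nu)
  let ?h = "\<lambda>y. \<Phi> x0 - f (x0, y)"
  have hm: "?h \<in> borel_measurable \<nu>" and gm: "(\<lambda>y. (norm (fy (x0, y)))\<^sup>2) \<in> borel_measurable \<nu>"
    unfolding measurable_cong_sets[OF sets_nu refl] by measurable
  have "(\<integral>\<^sup>+y. ennreal (?h y) \<partial>\<nu>) \<le> (\<integral>\<^sup>+y. ennreal (0 + 1 / (2 * \<mu>) * (norm (fy (x0, y)))\<^sup>2 + 0 * (norm (fy (x0, y)))\<^sup>2) \<partial>\<nu>)"
    using Phi_gap_le[of x0] by (intro nn_integral_mono ennreal_leI) simp
  also have "\<dots> \<le> ennreal (0 + 1 / (2 * \<mu>) * (\<epsilon>\<^sup>2 / \<kappa>\<^sup>2) + 0 * (\<epsilon>\<^sup>2 / \<kappa>\<^sup>2))"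
    by (rule nn_integral_affine_le[OF prob_nu gm gm _ _ _ _ _ _ _ init init]) (use mu_pos in simp_all)
  finally have le: "(\<integral>\<^sup>+y. ennreal (?h y) \<partial>\<nu>) \<le> ennreal (\<epsilon>\<^sup>2 / \<kappa>\<^sup>2 / (2 * \<mu>))"
    by (simp add: mult.commute)
  then have int: "integrable \<nu> ?h"
    using f_le_Phi by (intro integrableI_nonneg hm) (auto simp: less_top[symmetric] top_unique)
  have "(\<integral>y. ?h y \<partial>\<nu>) \<le> \<epsilon>\<^sup>2 / \<kappa>\<^sup>2 / (2 * \<mu>)"
    using le mu_pos nn_integral_eq_integral[OF int] f_le_Phi by simp
  moreover have "(\<integral>y. fexp F D x0 y \<partial>\<nu>) = (\<integral>y. \<Phi> x0 - ?h y \<partial>\<nu>)"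
    by (simp add: f_def)
  then have "(\<integral>y. fexp F D x0 y \<partial>\<nu>) = \<Phi> x0 - (\<integral>y. ?h y \<partial>\<nu>)"
    using Bochner_Integration.integral_diff[OF _ int, of "\<lambda>_. \<Phi> x0"] by (simp add: N.prob_space)
  ultimately show ?thesis by linarith
qed

end

lemma card_multiples_le:
  assumes "q > 0"
  shows "real (card {k. k < K \<and> k mod q = 0}) \<le> real K / real q + 1"
proof -
  have "{k. k < K \<and> k mod q = 0} \<subseteq> (\<lambda>i. i * q) ` {..K div q}"
  proof
    fix k assume "k \<in> {k. k < K \<and> k mod q = 0}"
    then have "k = (k div q) * q" "k div q \<le> K div q"
      by (auto intro: div_le_mono)
    then show "k \<in> (\<lambda>i. i * q) ` {..K div q}" by blast
  qed
  then have "card {k. k < K \<and> k mod q = 0} \<le> card ((\<lambda>i. i * q) ` {..K div q})"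
    by (rule card_mono[rotated]) simp
  also have "\<dots> \<le> card {..K div q}" by (rule card_image_le) simp
  finally have "real (card {k. k < K \<and> k mod q = 0}) \<le> real (K div q) + 1" by simp
  also have "\<dots> \<le> real K / real q + 1"
    using of_nat_div_le_of_nat[of K q, where 'a=real] by simp
  finally show ?thesis .
qed

text \<open>\<open>a\<close> stands for \<open>L \<Delta>\<close>. Since \<kappa> and
  \<open>1/\<epsilon>\<close> are at least 1, the +1 of each ceiling is absorbed into the leading
  power, at the price of the factors \<open>1 + \<sigma>^2\<close> and \<open>1 + a\<close>. The
  initialisation fits because \<open>1 + ln z \<le> z\<close>. The main loop gives
  \<open>14 * 25 + 13 * 30 * 2 * 86 = 67430\<close>, rounded up.\<close>

lemma sreda_cost_bound:
  fixes \<kappa> \<epsilon> \<sigma> a c0 :: real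
  assumes kap: "\<kappa> \<ge> 1" and eps: "0 < \<epsilon>" "\<epsilon> \<le> 1" and a: "a \<ge> 0" and c0: "c0 \<ge> 0"
    and N0: "real N0 \<le> c0 * \<kappa>\<^sup>2 / \<epsilon>\<^sup>2 * (1 + ln (\<kappa> / \<epsilon>))"
    and q: "1 / \<epsilon> \<le> real q" "real q \<le> 1 / \<epsilon> + 1"
    and S1: "real S1 \<le> 24 * \<sigma>\<^sup>2 * \<kappa>\<^sup>2 / \<epsilon>\<^sup>2 + 1"
    and S2: "real S2 \<le> 7368 / 175 * \<kappa> * real q + 1"
    and m: "real m + 2 \<le> 30 * \<kappa>"
    and K: "real K \<le> 100 * \<kappa> * a / (9 * \<epsilon>\<^sup>2) + 1"
  shows "real (N0 + sreda_main_cost S1 S2 q m K) \<le> 70000 * (1 + c0) * (1 + \<sigma>\<^sup>2) * (1 + a) * \<kappa> ^ 3 / \<epsilon> ^ 3"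
proof -
  define u where "u = 1 / \<epsilon>"
  have u: "u \<ge> 1" using eps by (simp add: u_def)
  let ?X = "\<kappa> ^ 3 * u ^ 3"
  let ?B = "1 + \<sigma>\<^sup>2" and ?A = "1 + a"
  have ku: "\<kappa> * u \<ge> 1" using mult_mono[OF kap u] kap u by simp
  have k2u2: "\<kappa>\<^sup>2 * u\<^sup>2 \<ge> 1" using ku one_le_power[OF ku, of 2] by (simp add: power_mult_distrib)
  have q_pos: "q > 0"
    using q(1) u unfolding u_def by linarith
  have N0': "real N0 \<le> c0 * ?X"
  proof -
    have "1 + ln (\<kappa> * u) \<le> \<kappa> * u" using ln_le_minus_one[of "\<kappa> * u"] ku by simp
    then have "c0 * \<kappa>\<^sup>2 * u\<^sup>2 * (1 + ln (\<kappa> * u)) \<le> c0 * \<kappa>\<^sup>2 * u\<^sup>2 * (\<kappa> * u)"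
      using c0 by (intro mult_left_mono) auto
    also have "\<dots> = c0 * ?X" by (simp add: power2_eq_square power3_eq_cube)
    finally show ?thesis using N0 by (simp add: u_def power_divide)
  qed
  have S1': "real S1 \<le> 25 * ?B * (\<kappa>\<^sup>2 * u\<^sup>2)"
  proof -
    have "24 * \<sigma>\<^sup>2 * (\<kappa>\<^sup>2 * u\<^sup>2) + 1 * 1 \<le> 25 * \<sigma>\<^sup>2 * (\<kappa>\<^sup>2 * u\<^sup>2) + 25 * (\<kappa>\<^sup>2 * u\<^sup>2)"
      using k2u2 by (intro add_mono mult_right_mono mult_mono) auto
    also have "\<dots> = 25 * ?B * (\<kappa>\<^sup>2 * u\<^sup>2)" by (simp add: algebra_simps)
    finally show ?thesis using S1 by (simp add: u_def power_divide mult.assoc)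
  qed
  have K': "real K \<le> 13 * ?A * (\<kappa> * u\<^sup>2)"
  proof -
    have "1 * 1 \<le> \<kappa> * u\<^sup>2" using kap u by (intro mult_mono one_le_power) auto
    moreover from this have "100 / 9 * a * (\<kappa> * u\<^sup>2) \<le> 13 * a * (\<kappa> * u\<^sup>2)"
      using a by (intro mult_right_mono) auto
    ultimately have "100 / 9 * a * (\<kappa> * u\<^sup>2) + 1 \<le> 13 * a * (\<kappa> * u\<^sup>2) + 13 * (\<kappa> * u\<^sup>2)"
      by linarith
    also have "\<dots> = 13 * ?A * (\<kappa> * u\<^sup>2)" by (simp add: algebra_simps)
    finally show ?thesis using K by (simp add: u_def power_divide mult_ac)
  qed
  have card': "real (card {k. k < K \<and> k mod q = 0}) \<le> 14 * ?A * (\<kappa> * u)"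
  proof -
    have "real K / real q \<le> real K / u"
      using q u eps q_pos by (intro divide_left_mono) (auto simp: u_def)
    also have "\<dots> \<le> 13 * ?A * (\<kappa> * u\<^sup>2) / u" using K' u by (intro divide_right_mono) auto
    also have "\<dots> = 13 * ?A * (\<kappa> * u)" using u by (simp add: power2_eq_square)
    finally have "real K / real q \<le> 13 * ?A * (\<kappa> * u)" .
    moreover have "1 * 1 \<le> ?A * (\<kappa> * u)" using a ku by (intro mult_mono) auto
    ultimately show ?thesis using card_multiples_le[OF q_pos, of K] by linarith
  qed
  have S2': "real S2 \<le> 86 * (\<kappa> * u)"
  proof -
    have "real q \<le> 2 * u" using q u by (simp add: u_def)
    then have "\<kappa> * real q \<le> \<kappa> * (2 * u)" using kap by (intro mult_left_mono) auto
    then show ?thesis using S2 ku by simp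
  qed
  have "real (card {k. k < K \<and> k mod q = 0}) * real S1 \<le> (14 * ?A * (\<kappa> * u)) * (25 * ?B * (\<kappa>\<^sup>2 * u\<^sup>2))"
    using a kap u by (intro mult_mono card' S1') auto
  also have "\<dots> = 350 * (?A * ?B * ?X)" by (simp add: power2_eq_square power3_eq_cube algebra_simps)
  finally have c1: "real (card {k. k < K \<and> k mod q = 0}) * real S1 \<le> 350 * (?A * ?B * ?X)" .
  have "real K * (real m + 2) * (2 * real S2) \<le> (13 * ?A * (\<kappa> * u\<^sup>2)) * (30 * \<kappa>) * (2 * (86 * (\<kappa> * u)))"
    using a kap u m K' S2' by (intro mult_mono) auto
  also have "\<dots> = 67080 * (?A * 1 * ?X)" by (simp add: power2_eq_square power3_eq_cube)
  also have "\<dots> \<le> 67080 * (?A * ?B * ?X)"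
    using a kap u by (intro mult_left_mono mult_right_mono) auto
  finally have c2: "real K * (real m + 2) * (2 * real S2) \<le> 67080 * (?A * ?B * ?X)" .
  have X0: "?X \<ge> 0" using kap u by simp
  have "1 * ?X \<le> (?A * ?B) * ?X"
    using a mult_mono[of 1 ?A 1 ?B] X0 by (intro mult_right_mono) auto
  then have "c0 * ?X \<le> c0 * (?A * ?B * ?X)"
    using c0 by (intro mult_left_mono) auto
  moreover have "real (N0 + sreda_main_cost S1 S2 q m K)
      = real N0 + (real (card {k. k < K \<and> k mod q = 0}) * real S1 + real K * (real m + 2) * (2 * real S2))"
    by (simp add: sreda_main_cost_def algebra_simps)
  ultimately have "real (N0 + sreda_main_cost S1 S2 q m K) \<le> c0 * (?A * ?B * ?X) + 67430 * (?A * ?B * ?X)"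
    using N0' c1 c2 by linarith
  also have "\<dots> = (c0 + 67430) * (?A * ?B * ?X)" by (simp only: distrib_right)
  also have "\<dots> \<le> (70000 * (1 + c0)) * (?A * ?B * ?X)"
    using a c0 X0 by (intro mult_right_mono) auto
  also have "\<dots> = 70000 * (1 + c0) * ?B * ?A * \<kappa> ^ 3 / \<epsilon> ^ 3"
    by (simp add: u_def power_divide)
  finally show ?thesis .
qed

text \<open>One \<open>C\<close> serves all problems, so the implied constant of the cost is
  explicit in \<sigma>, \<open>L * \<Delta>\<close> and \<open>c0\<close>. Here \<open>N0\<close> is
  the number of evaluations spent on the initialisation, \<open>c0\<close> the constant in its
  bound, and \<open>\<nu>\<close> the resulting law of \<open>y0\<close>.\<close>

theorem theorem1:
  shows "\<exists>C>0. \<forall>(F :: real^'n \<Rightarrow> real^'d \<Rightarrow> 'c \<Rightarrow> real) (D :: 'c measure) (L::real) (\<mu>::real) (\<sigma>::real)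
            (\<epsilon>::real) (x0 :: real^'n) (\<nu> :: (real^'d) measure) (c0::real) (N0::nat).
     minimax_assms F D L \<mu> \<sigma> \<and> \<epsilon> > 0 \<and>
     prob_space \<nu> \<and> sets \<nu> = sets borel \<and>
     (\<integral>\<^sup>+y. ennreal ((norm (grady (fexp F D) x0 y))\<^sup>2) \<partial>\<nu>) \<le> ennreal ((L / \<mu>) powr (-2) * \<epsilon>\<^sup>2) \<and>
     c0 \<ge> 0 \<and> real N0 \<le> c0 * (L / \<mu>)\<^sup>2 / \<epsilon>\<^sup>2 * (1 + ln ((L / \<mu>) / \<epsilon>))
     \<longrightarrow>
     (let \<kappa> = L / \<mu>;
          \<zeta> = \<kappa> powr (-2) * \<epsilon>\<^sup>2;
          lam = 2 / (7 * L);
          q = nat \<lceil>1 / \<epsilon>\<rceil>;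
          S1 = nat \<lceil>24 * \<sigma>\<^sup>2 * \<kappa>\<^sup>2 / \<epsilon>\<^sup>2\<rceil>;
          S2 = nat \<lceil>7368 / 175 * \<kappa> * real q\<rceil>;
          m = nat \<lceil>28 * \<kappa> - 1\<rceil>;
          \<Delta> = (\<integral>y. fexp F D x0 y \<partial>\<nu>) + \<zeta> / (2 * \<mu>) - Phi_star F D;
          K = nat \<lceil>100 * \<kappa> * L * \<Delta> / (9 * \<epsilon>\<^sup>2)\<rceil>;
          \<Omega> = \<nu> \<Otimes>\<^sub>M (PiM UNIV (\<lambda>_::nat \<times> nat. D) \<Otimes>\<^sub>M (PiM UNIV (\<lambda>_::nat \<times> nat \<times> nat. D) \<Otimes>\<^sub>M
                (PiM UNIV (\<lambda>_::nat. measure_pmf (pmf_of_set {0..m})) \<Otimes>\<^sub>M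
                 measure_pmf (pmf_of_set {0..K - 1}))));
          xhat = (\<lambda>(y0, xic, xim, s, j).
                    fst (sreda_state F \<epsilon> \<kappa> L lam S1 S2 q x0 y0
                           (\<lambda>k i. xic (k, i)) (\<lambda>k t i. xim (k, t, i)) s j))
      in (\<integral>\<^sup>+\<omega>. ennreal (norm (grad (Phi F D) (xhat \<omega>))) \<partial>\<Omega>) \<le> ennreal (1073 / 108 * \<epsilon>)
         \<and> (\<epsilon> \<le> 1 \<longrightarrow>
              real (N0 + sreda_main_cost S1 S2 q m K)
                \<le> C * (1 + c0) * (1 + \<sigma>\<^sup>2) * (1 + L * \<Delta>) * \<kappa> ^ 3 / \<epsilon> ^ 3))"
proof (intro exI[of _ "70000 :: real"] conjI allI impI, goal_cases)
  case 1
  show ?case by simp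
next
  case (2 F D L \<mu> \<sigma> \<epsilon> x0 \<nu> c0 N0)
  then have minimax: "minimax_assms F D L \<mu> \<sigma>" and eps: "\<epsilon> > 0"
    and nu: "prob_space \<nu>" "sets \<nu> = sets borel"
    and init: "(\<integral>\<^sup>+y. ennreal ((norm (grady (fexp F D) x0 y))\<^sup>2) \<partial>\<nu>) \<le> ennreal ((L / \<mu>) powr (-2) * \<epsilon>\<^sup>2)"
    and c0: "c0 \<ge> 0" and N0: "real N0 \<le> c0 * (L / \<mu>)\<^sup>2 / \<epsilon>\<^sup>2 * (1 + ln ((L / \<mu>) / \<epsilon>))"
    by blast+
  interpret M: minimax F D L \<mu> \<sigma> using minimax by unfold_locales
  define \<kappa> where "\<kappa> = L / \<mu>"
  have kap: "M.\<kappa> = \<kappa>" by (simp add: M.\<kappa>_def \<kappa>_def)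
  have kap1: "\<kappa> \<ge> 1" using M.kappa_ge_1 kap by simp
  have powr: "\<kappa> powr (-2) = 1 / \<kappa>\<^sup>2" using kap1 by (simp add: powr_neg_numeral)
  define q where "q = nat \<lceil>1 / \<epsilon>\<rceil>"
  define S1 where "S1 = nat \<lceil>24 * \<sigma>\<^sup>2 * \<kappa>\<^sup>2 / \<epsilon>\<^sup>2\<rceil>"
  define S2 where "S2 = nat \<lceil>7368 / 175 * \<kappa> * real q\<rceil>"
  define m where "m = nat \<lceil>28 * \<kappa> - 1\<rceil>"
  define \<Delta> where "\<Delta> = (\<integral>y. fexp F D x0 y \<partial>\<nu>) + \<kappa> powr (-2) * \<epsilon>\<^sup>2 / (2 * \<mu>) - Phi_star F D"
  define K where "K = nat \<lceil>100 * \<kappa> * L * \<Delta> / (9 * \<epsilon>\<^sup>2)\<rceil>"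
  \<comment> \<open>The upper bound needs a nonnegative argument, since \<open>nat\<close>
    truncates; for \<open>K\<close> this is the sign of \<Delta>, which is known only after
    \<open>init_gap\<close>.\<close>
  have nat_ceil: "z \<le> real (nat \<lceil>z\<rceil>)" "0 \<le> z \<Longrightarrow> real (nat \<lceil>z\<rceil>) \<le> z + 1" for z :: real
    by linarith+
  have q: "1 / \<epsilon> \<le> real q" "real q \<le> 1 / \<epsilon> + 1"
    unfolding q_def using eps by (intro nat_ceil; simp)+
  have S1: "24 * \<sigma>\<^sup>2 * \<kappa>\<^sup>2 / \<epsilon>\<^sup>2 \<le> real S1" "real S1 \<le> 24 * \<sigma>\<^sup>2 * \<kappa>\<^sup>2 / \<epsilon>\<^sup>2 + 1"
    unfolding S1_def using eps by (intro nat_ceil; simp)+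
  have S2: "7368 / 175 * \<kappa> * real q \<le> real S2" "real S2 \<le> 7368 / 175 * \<kappa> * real q + 1"
    unfolding S2_def using kap1 by (intro nat_ceil; simp)+
  have m: "28 * \<kappa> - 1 \<le> real m" "real m \<le> 28 * \<kappa> - 1 + 1"
    unfolding m_def using kap1 by (intro nat_ceil; simp)+
  have q_pos: "q > 0" using eps by (simp add: q_def)
  interpret S: sreda F D L \<mu> \<sigma> \<epsilon> "2 / (7 * L)" x0 \<nu> q m S1 S2 K
  proof (intro sreda.intro sreda_axioms.intro, unfold kap)
    show "42 * \<kappa> * real q \<le> real S2"
    proof -
      have "0 \<le> \<kappa> * real q" using kap1 by simp
      then show ?thesis using S2(1) by simp
    qed
    show "(\<integral>\<^sup>+y. ennreal ((norm (M.fy (x0, y)))\<^sup>2) \<partial>\<nu>) \<le> ennreal (\<epsilon>\<^sup>2 / \<kappa>\<^sup>2)"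
      using init powr by (simp add: M.df_def \<kappa>_def)
    show "28 * \<kappa> \<le> real m + 1" "real m + 2 \<le> 30 * \<kappa>"
      using m kap1 by linarith+
  qed (rule M.minimax_axioms eps nu refl q_pos S1(1))+
  have gap: "M.\<Phi> x0 - Phi_star F D \<le> \<Delta>"
    using S.init_gap by (simp add: \<Delta>_def powr kap)
  have Delta0: "\<Delta> \<ge> 0" using gap M.Phi_star_le[of x0] by linarith
  have z0: "100 * \<kappa> * L * \<Delta> / (9 * \<epsilon>\<^sup>2) \<ge> 0" using Delta0 kap1 M.L_pos by simp
  have K: "100 * \<kappa> * L * \<Delta> / (9 * \<epsilon>\<^sup>2) \<le> real K" "real K \<le> 100 * \<kappa> * (L * \<Delta>) / (9 * \<epsilon>\<^sup>2) + 1"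
    using nat_ceil(1)[of "100 * \<kappa> * L * \<Delta> / (9 * \<epsilon>\<^sup>2)"] nat_ceil(2)[OF z0] unfolding K_def
    by (simp_all add: mult.assoc)
  have "100 * M.\<kappa> * L * (M.\<Phi> x0 - Phi_star F D) / (9 * \<epsilon>\<^sup>2) \<le> 100 * \<kappa> * L * \<Delta> / (9 * \<epsilon>\<^sup>2)"
    unfolding kap using gap kap1 M.L_pos by (intro divide_right_mono mult_left_mono) auto
  also have "\<dots> \<le> real (Suc (K - 1))" using K(1) by linarith
  finally have main: "(\<integral>\<^sup>+w. ennreal (norm (grad M.\<Phi> (fst (S.pt (snd (snd (snd (snd w)))) w)))) \<partial>S.\<Omega>) \<le> ennreal (1073 / 108 * \<epsilon>)"
    by (rule S.expected_gradient_bound)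
  have pt: "fst (S.pt k w) = fst (sreda_state F \<epsilon> \<kappa> L (2 / (7 * L)) S1 S2 q x0 (fst w)
      (\<lambda>k i. fst (snd w) (k, i)) (\<lambda>k t i. fst (snd (snd w)) (k, t, i)) (fst (snd (snd (snd w)))) k)" for k w
    by (simp add: S.pt_def S.state_def kap)
  have cost: "real (N0 + sreda_main_cost S1 S2 q m K)
      \<le> 70000 * (1 + c0) * (1 + \<sigma>\<^sup>2) * (1 + L * \<Delta>) * \<kappa> ^ 3 / \<epsilon> ^ 3" if "\<epsilon> \<le> 1"
  proof (rule sreda_cost_bound[OF kap1 eps that _ c0 N0[folded \<kappa>_def] q S1(2) S2(2) _ K(2)])
    show "0 \<le> L * \<Delta>" using Delta0 M.L_pos by simp
    show "real m + 2 \<le> 30 * \<kappa>" using m kap1 by linarith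
  qed
  show ?case
    unfolding Let_def \<kappa>_def[symmetric] q_def[symmetric] S1_def[symmetric] S2_def[symmetric] m_def[symmetric]
      \<Delta>_def[symmetric] K_def[symmetric]
    using main cost
    unfolding S.\<Omega>_def S.M_C_def S.M_X_def S.M_S_def S.M_J_def pt split_beta' by blast
qed

end
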